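(* Let $\Gamma\curvearrowright X$ be a Borel action of a finitely generated group $\Gamma$ on a standard Borel space $X$. Suppose either that $\Gamma$ is of subexponential growth, or that the asymptotic separation index of the action $\Gamma\curvearrowright X$ is finite. Let $\alpha,\beta\in\mathsf{S}(X,\Gamma,\mathbb{B})$, where $\mathbb{B}$ is the Borel $\sigma$-algebra of $X$. If for some natural numbers $n>m$ the (images of the) elements $\alpha,\beta$ satisfy $n\alpha\le m\beta$ in $\mathsf{S}(X,\Gamma)$, then $\alpha\le\beta$ in $\mathsf{S}(X,\Gamma,\mathbb{B})$.
   Context: An action of $\Gamma$ on $X$ is Borel if for each $\gamma\in\Gamma$ the map $x\mapsto\gamma\cdot x$ is Borel. Type semigroups: Let $\Gamma\curvearrowright X$ be an action of a group on a set and let $\mathbb{A}\subseteq\mathcal{P}(X)$ be a $\Gamma$-invariant subalgebra of the powerset $\mathcal{P}(X)$. The type semigroup $\mathsf{S}(X,\Gamma,\mathbb{A})$ is the commutative monoid generated by the elements $\{[A]:A\in\mathbb{A}\}$ subject to the relations $[A]=[\gamma\cdot A]$ for all $A\in\mathbb{A}$, $\gamma\in\Gamma$, and $[B\sqcup C]=[B]+[C]$ for all disjoint $B,C\in\mathbb{A}$. The full type semigroup is $\mathsf{S}(X,\Gamma)=\mathsf{S}(X,\Gamma,\mathcal{P}(X))$. For $\alpha,\beta\in\mathsf{S}(X,\Gamma,\mathbb{A})$, write $\alpha\le\beta$ if there is $\eta\in\mathsf{S}(X,\Gamma,\mathbb{A})$ with $\beta=\alpha+\eta$. The inclusion $\mathbb{A}\hookrightarrow\mathcal{P}(X)$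 induces a homomorphism $\mathsf{S}(X,\Gamma,\mathbb{A})\to\mathsf{S}(X,\Gamma)$, and the same symbols are used for elements of $\mathsf{S}(X,\Gamma,\mathbb{A})$ and their images in $\mathsf{S}(X,\Gamma)$. A finitely generated group is of subexponential growth if, for a finite generating set $S$, the balls of radius $R$ in the Cayley graph satisfy: for every $\varepsilon>0$, the number of elements in the ball of radius $R$ is at most $e^{\varepsilon R}$ for all sufficiently large $R$. Asymptotic separation index: For a finite generating set $S$ of $\Gamma$, the Schreier graph $\mathsf{Sch}(X,\Gamma,S)$ is the simple graph with vertex set $X$ and edge set $\{\{x,\sigma\cdot x\}: x\in X,\ \sigma\in S,\ x\ne\sigma\cdot x\}$. The asymptotic separation index of $\Gamma\curvearrowright X$ is $\mathsf{asi}(\Gamma\curvearrowright X)=\mathsf{asi}(\mathsf{Sch}(X,\Gamma,S))$ for any (equivalently, every) finite generating set $S$, where for a simple locally finite Borel graph $G$ (i.e. one whose vertex set is standard Borel, whose edge relation is Borel, and all of whose vertices have finite degree), $\mathsf{asi}(G)$ is the smallest $s\in\mathbb{N}$ such that for every $k\in\mathbb{N}$ the vertex set of $G$ can be covered by $s+1$ Borel $G^k$-finite sets, and $\mathsf{asi}(G)=\infty$ if no such $s$ exists. Here $G^k$ is the simple graph on the same vertex set in which $\{x,y\}$ is an edge iff $0<\mathrm{dist}_G(x,y)\le k$, and a set $Y$ of vertices of a graph $H$ is $H$-finite if every connected component of the induced subgraph $H[Y]$ is finite. *)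

theory Defs
  imports
    "HOL-Analysis.Analysis"
    "HOL-Library.Multiset"
    "HOL-Library.Extended_Nat"
    "HOL-Algebra.Generated_Groups"
    "HOL-Algebra.Group_Action"
begin

section \<open>Standard Borel spaces and Borel actions\<close>

definition standard_borel :: "'x measure \<Rightarrow> bool" where
  "standard_borel M \<longleftrightarrow>
    (\<exists>T. completely_metrizable_space T \<and> second_countable T \<and> topspace T = space M \<and>
         sets M = sigma_sets (space M) {U. openin T U})"

definition borel_action ::
    "('g, 'b) monoid_scheme \<Rightarrow> 'x measure \<Rightarrow> ('g \<Rightarrow> 'x \<Rightarrow> 'x) \<Rightarrow> bool" where
  "borel_action \<Gamma> M \<phi> \<longleftrightarrow>
    group_action \<Gamma> (space M) \<phi> \<and> (\<forall>\<gamma>\<in>carrier \<Gamma>. \<phi> \<gamma> \<in> M \<rightarrow>\<^sub>M M)"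

definition finite_generating_set :: "('g, 'b) monoid_scheme \<Rightarrow> 'g set \<Rightarrow> bool" where
  "finite_generating_set \<Gamma> S \<longleftrightarrow> finite S \<and> S \<subseteq> carrier \<Gamma> \<and> generate \<Gamma> S = carrier \<Gamma>"

definition finitely_generated :: "('g, 'b) monoid_scheme \<Rightarrow> bool" where
  "finitely_generated \<Gamma> \<longleftrightarrow> (\<exists>S. finite_generating_set \<Gamma> S)"


section \<open>Type semigroups\<close>

text \<open>
  The free commutative monoid on the symbols \<open>[A]\<close>, \<open>A \<in> \<A>\<close>, is the set of finite multisets
  with members in \<open>\<A>\<close>; \<open>type_equiv \<Gamma> \<phi> \<A>\<close> is the least monoid congruence on it containing the
  defining relations. The relation \<open>[\<emptyset>] = 0\<close> is not among them: \<open>[\<emptyset>]\<close> is absorbed by every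
  \<open>[A]\<close> (take \<open>B = \<emptyset>\<close> and \<open>C = A\<close>), but it is not identified with the neutral element, which is
  the class of the empty multiset.
\<close>

inductive type_equiv ::
    "('g, 'b) monoid_scheme \<Rightarrow> ('g \<Rightarrow> 'x \<Rightarrow> 'x) \<Rightarrow> 'x set set \<Rightarrow>
      'x set multiset \<Rightarrow> 'x set multiset \<Rightarrow> bool"
  for \<Gamma> \<phi> \<A> where
  act: "A \<in> \<A> \<Longrightarrow> \<gamma> \<in> carrier \<Gamma> \<Longrightarrow> type_equiv \<Gamma> \<phi> \<A> {#A#} {#\<phi> \<gamma> ` A#}"
| disj: "B \<in> \<A> \<Longrightarrow> C \<in> \<A> \<Longrightarrow> B \<inter> C = {} \<Longrightarrow> type_equiv \<Gamma> \<phi> \<A> {#B \<union> C#} ({#B#} + {#C#})"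
| refl: "set_mset u \<subseteq> \<A> \<Longrightarrow> type_equiv \<Gamma> \<phi> \<A> u u"
| sym: "type_equiv \<Gamma> \<phi> \<A> u v \<Longrightarrow> type_equiv \<Gamma> \<phi> \<A> v u"
| trans: "type_equiv \<Gamma> \<phi> \<A> u v \<Longrightarrow> type_equiv \<Gamma> \<phi> \<A> v w \<Longrightarrow> type_equiv \<Gamma> \<phi> \<A> u w"
| add: "type_equiv \<Gamma> \<phi> \<A> u v \<Longrightarrow> type_equiv \<Gamma> \<phi> \<A> u' v' \<Longrightarrow>
        type_equiv \<Gamma> \<phi> \<A> (u + u') (v + v')"

definition type_cong ::
    "('g, 'b) monoid_scheme \<Rightarrow> ('g \<Rightarrow> 'x \<Rightarrow> 'x) \<Rightarrow> 'x set set \<Rightarrow>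
      ('x set multiset \<times> 'x set multiset) set" where
  "type_cong \<Gamma> \<phi> \<A> = {(u, v). type_equiv \<Gamma> \<phi> \<A> u v}"

text \<open>
  The monoid operation, written additively on paper, is the \<open>\<otimes>\<close> of the record; thus \<open>n\<alpha>\<close> is
  \<open>\<alpha> [^] n\<close>.
\<close>

definition type_semigroup ::
    "('g, 'b) monoid_scheme \<Rightarrow> ('g \<Rightarrow> 'x \<Rightarrow> 'x) \<Rightarrow> 'x set set \<Rightarrow> 'x set multiset set monoid" where
  "type_semigroup \<Gamma> \<phi> \<A> =
    \<lparr>carrier = {u. set_mset u \<subseteq> \<A>} // type_cong \<Gamma> \<phi> \<A>,
     monoid.mult = (\<lambda>\<alpha> \<beta>. \<Union>u\<in>\<alpha>. \<Union>v\<in>\<beta>. type_cong \<Gamma> \<phi> \<A> `` {u + v}),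
     one = type_cong \<Gamma> \<phi> \<A> `` {{#}}\<rparr>"

abbreviation full_type_semigroup ::
    "('g, 'b) monoid_scheme \<Rightarrow> 'x set \<Rightarrow> ('g \<Rightarrow> 'x \<Rightarrow> 'x) \<Rightarrow> 'x set multiset set monoid" where
  "full_type_semigroup \<Gamma> X \<phi> \<equiv> type_semigroup \<Gamma> \<phi> (Pow X)"

definition monoid_le :: "('a, 'c) monoid_scheme \<Rightarrow> 'a \<Rightarrow> 'a \<Rightarrow> bool" where
  "monoid_le S \<alpha> \<beta> \<longleftrightarrow> (\<exists>\<eta>\<in>carrier S. \<beta> = \<alpha> \<otimes>\<^bsub>S\<^esub> \<eta>)"

text \<open>
  The image of a class \<open>\<alpha>\<close> of \<open>\<A>\<close>-multisets in the type semigroup of a larger algebra \<open>\<B>\<close>: the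
  \<open>\<B>\<close>-class of any representative of \<open>\<alpha>\<close>.
\<close>

definition type_map ::
    "('g, 'b) monoid_scheme \<Rightarrow> ('g \<Rightarrow> 'x \<Rightarrow> 'x) \<Rightarrow> 'x set set \<Rightarrow> 'x set multiset set \<Rightarrow>
      'x set multiset set" where
  "type_map \<Gamma> \<phi> \<B> \<alpha> = (\<Union>u\<in>\<alpha>. type_cong \<Gamma> \<phi> \<B> `` {u})"

lemma type_equiv_mono:
  assumes "type_equiv \<Gamma> \<phi> \<A> u v" and "\<A> \<subseteq> \<B>"
  shows "type_equiv \<Gamma> \<phi> \<B> u v"
  using assms(1)
proof induction
  case (disj B C)
  then show ?case using assms(2) by (intro type_equiv.disj) auto
next
  case (trans u v w)
  then show ?case by (blast intro: type_equiv.trans)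
qed (use assms(2) in \<open>auto intro: type_equiv.intros\<close>)

locale invariant_algebra = group_action \<Gamma> X \<phi> + algebra X \<A> for \<Gamma> (structure) and X \<phi> \<A> +
  assumes invariant: "A \<in> \<A> \<Longrightarrow> \<gamma> \<in> carrier \<Gamma> \<Longrightarrow> \<phi> \<gamma> ` A \<in> \<A>"
begin

lemma type_equiv_members:
  "type_equiv \<Gamma> \<phi> \<A> u v \<Longrightarrow> set_mset u \<subseteq> \<A> \<and> set_mset v \<subseteq> \<A>"
  by (induction rule: type_equiv.induct) (auto simp: invariant)

lemma equiv_type_cong: "equiv {u. set_mset u \<subseteq> \<A>} (type_cong \<Gamma> \<phi> \<A>)"
proof (rule equivI)
  show "type_cong \<Gamma> \<phi> \<A> \<subseteq> {u. set_mset u \<subseteq> \<A>} \<times> {u. set_mset u \<subseteq> \<A>}"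
    using type_equiv_members by (auto simp: type_cong_def)
  show "refl_on {u. set_mset u \<subseteq> \<A>} (type_cong \<Gamma> \<phi> \<A>)"
    by (auto simp: refl_on_def type_cong_def intro: type_equiv.refl)
  show "Relation.sym (type_cong \<Gamma> \<phi> \<A>)"
    by (auto simp: Relation.sym_def type_cong_def intro: type_equiv.sym)
  show "Relation.trans (type_cong \<Gamma> \<phi> \<A>)"
    by (auto simp: Relation.trans_def type_cong_def intro: type_equiv.trans)
qed

lemma type_semigroup_mult_class:
  assumes "set_mset u \<subseteq> \<A>" "set_mset v \<subseteq> \<A>"
  shows "(type_cong \<Gamma> \<phi> \<A> `` {u}) \<otimes>\<^bsub>type_semigroup \<Gamma> \<phi> \<A>\<^esub> (type_cong \<Gamma> \<phi> \<A> `` {v})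
    = type_cong \<Gamma> \<phi> \<A> `` {u + v}"
proof -
  have "congruent2 (type_cong \<Gamma> \<phi> \<A>) (type_cong \<Gamma> \<phi> \<A>) (\<lambda>u v. type_cong \<Gamma> \<phi> \<A> `` {u + v})"
  proof (rule congruent2I')
    fix y1 z1 y2 z2
    assume "(y1, z1) \<in> type_cong \<Gamma> \<phi> \<A>" "(y2, z2) \<in> type_cong \<Gamma> \<phi> \<A>"
    then have "(y1 + y2, z1 + z2) \<in> type_cong \<Gamma> \<phi> \<A>"
      by (auto simp: type_cong_def intro: type_equiv.add)
    then show "type_cong \<Gamma> \<phi> \<A> `` {y1 + y2} = type_cong \<Gamma> \<phi> \<A> `` {z1 + z2}"
      using equiv_type_cong by (simp add: equiv_class_eq)
  qed
  then show ?thesis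
    using UN_equiv_class2[OF equiv_type_cong equiv_type_cong] assms
    by (simp add: type_semigroup_def)
qed

lemma comm_monoid_type_semigroup: "comm_monoid (type_semigroup \<Gamma> \<phi> \<A>)"
proof -
  let ?c = "\<lambda>u. type_cong \<Gamma> \<phi> \<A> `` {u}"
  let ?S = "type_semigroup \<Gamma> \<phi> \<A>"
  have car: "\<alpha> \<in> carrier ?S \<longleftrightarrow> (\<exists>u. set_mset u \<subseteq> \<A> \<and> \<alpha> = ?c u)" for \<alpha>
    by (auto simp: type_semigroup_def quotient_def)
  have one: "\<one>\<^bsub>?S\<^esub> = ?c {#}"
    by (simp add: type_semigroup_def)
  note m = type_semigroup_mult_class
  show ?thesis
  proof (rule comm_monoidI)
    fix \<alpha> \<beta> assume "\<alpha> \<in> carrier ?S" "\<beta> \<in> carrier ?S"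
    then obtain u v where "set_mset u \<subseteq> \<A>" "\<alpha> = ?c u" "set_mset v \<subseteq> \<A>" "\<beta> = ?c v"
      using car by auto
    moreover from this have "set_mset (u + v) \<subseteq> \<A>" by simp
    ultimately show "\<alpha> \<otimes>\<^bsub>?S\<^esub> \<beta> \<in> carrier ?S" "\<alpha> \<otimes>\<^bsub>?S\<^esub> \<beta> = \<beta> \<otimes>\<^bsub>?S\<^esub> \<alpha>"
      using m car by (metis, metis add.commute)
  next
    show "\<one>\<^bsub>?S\<^esub> \<in> carrier ?S" using one car by (metis empty_subsetI set_mset_empty)
  next
    fix \<alpha> \<beta> \<gamma> assume "\<alpha> \<in> carrier ?S" "\<beta> \<in> carrier ?S" "\<gamma> \<in> carrier ?S"
    then obtain u v w where "set_mset u \<subseteq> \<A>" "\<alpha> = ?c u" "set_mset v \<subseteq> \<A>" "\<beta> = ?c v"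
      "set_mset w \<subseteq> \<A>" "\<gamma> = ?c w"
      using car by auto
    then show "\<alpha> \<otimes>\<^bsub>?S\<^esub> \<beta> \<otimes>\<^bsub>?S\<^esub> \<gamma> = \<alpha> \<otimes>\<^bsub>?S\<^esub> (\<beta> \<otimes>\<^bsub>?S\<^esub> \<gamma>)"
      by (simp add: m add.assoc)
  next
    fix \<alpha> assume "\<alpha> \<in> carrier ?S"
    then obtain u where "set_mset u \<subseteq> \<A>" "\<alpha> = ?c u" using car by auto
    then show "\<one>\<^bsub>?S\<^esub> \<otimes>\<^bsub>?S\<^esub> \<alpha> = \<alpha>" by (simp add: one m)
  qed
qed

end

lemma type_map_class:
  assumes "invariant_algebra \<Gamma> X \<phi> \<A>" "invariant_algebra \<Gamma> X \<phi> \<B>" "\<A> \<subseteq> \<B>" "set_mset u \<subseteq> \<A>"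
  shows "type_map \<Gamma> \<phi> \<B> (type_cong \<Gamma> \<phi> \<A> `` {u}) = type_cong \<Gamma> \<phi> \<B> `` {u}"
proof -
  have 1: "u \<in> type_cong \<Gamma> \<phi> \<A> `` {u}"
    using assms(4) by (auto simp: type_cong_def intro: type_equiv.refl)
  have "type_cong \<Gamma> \<phi> \<B> `` {v} = type_cong \<Gamma> \<phi> \<B> `` {u}"
    if "v \<in> type_cong \<Gamma> \<phi> \<A> `` {u}" for v
  proof -
    have "(u, v) \<in> type_cong \<Gamma> \<phi> \<B>"
      using that assms(3) by (auto simp: type_cong_def intro: type_equiv_mono)
    then show ?thesis
      using equiv_class_eq[OF invariant_algebra.equiv_type_cong[OF assms(2)]] by metis
  qed
  with 1 show ?thesis unfolding type_map_def by blast
qed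

lemma type_map_hom:
  assumes "invariant_algebra \<Gamma> X \<phi> \<A>" "invariant_algebra \<Gamma> X \<phi> \<B>" "\<A> \<subseteq> \<B>"
  shows "type_map \<Gamma> \<phi> \<B> \<in> hom (type_semigroup \<Gamma> \<phi> \<A>) (type_semigroup \<Gamma> \<phi> \<B>)"
    and "type_map \<Gamma> \<phi> \<B> \<one>\<^bsub>type_semigroup \<Gamma> \<phi> \<A>\<^esub> = \<one>\<^bsub>type_semigroup \<Gamma> \<phi> \<B>\<^esub>"
proof -
  have car: "\<alpha> \<in> carrier (type_semigroup \<Gamma> \<phi> \<C>) \<longleftrightarrow>
      (\<exists>u. set_mset u \<subseteq> \<C> \<and> \<alpha> = type_cong \<Gamma> \<phi> \<C> `` {u})" for \<alpha> \<C>
    by (auto simp: type_semigroup_def quotient_def)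
  note mA = invariant_algebra.type_semigroup_mult_class[OF assms(1)]
  note mB = invariant_algebra.type_semigroup_mult_class[OF assms(2)]
  note c = type_map_class[OF assms]
  show "type_map \<Gamma> \<phi> \<B> \<in> hom (type_semigroup \<Gamma> \<phi> \<A>) (type_semigroup \<Gamma> \<phi> \<B>)"
  proof (rule homI)
    fix \<alpha> assume "\<alpha> \<in> carrier (type_semigroup \<Gamma> \<phi> \<A>)"
    then obtain u where u: "set_mset u \<subseteq> \<A>" "\<alpha> = type_cong \<Gamma> \<phi> \<A> `` {u}"
      unfolding car by blast
    then have "type_map \<Gamma> \<phi> \<B> \<alpha> = type_cong \<Gamma> \<phi> \<B> `` {u}" "set_mset u \<subseteq> \<B>"
      using c assms(3) by auto
    then show "type_map \<Gamma> \<phi> \<B> \<alpha> \<in> carrier (type_semigroup \<Gamma> \<phi> \<B>)"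
      unfolding car by blast
  next
    fix \<alpha> \<beta> assume "\<alpha> \<in> carrier (type_semigroup \<Gamma> \<phi> \<A>)" "\<beta> \<in> carrier (type_semigroup \<Gamma> \<phi> \<A>)"
    then obtain u v where uv: "set_mset u \<subseteq> \<A>" "\<alpha> = type_cong \<Gamma> \<phi> \<A> `` {u}"
      "set_mset v \<subseteq> \<A>" "\<beta> = type_cong \<Gamma> \<phi> \<A> `` {v}"
      unfolding car by blast
    moreover have "set_mset u \<subseteq> \<B>" "set_mset v \<subseteq> \<B>" using uv assms(3) by auto
    ultimately show "type_map \<Gamma> \<phi> \<B> (\<alpha> \<otimes>\<^bsub>type_semigroup \<Gamma> \<phi> \<A>\<^esub> \<beta>) =
        type_map \<Gamma> \<phi> \<B> \<alpha> \<otimes>\<^bsub>type_semigroup \<Gamma> \<phi> \<B>\<^esub> type_map \<Gamma> \<phi> \<B> \<beta>"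
      by (simp add: mA mB c)
  qed
  show "type_map \<Gamma> \<phi> \<B> \<one>\<^bsub>type_semigroup \<Gamma> \<phi> \<A>\<^esub> = \<one>\<^bsub>type_semigroup \<Gamma> \<phi> \<B>\<^esub>"
    using c[of "{#}"] by (simp add: type_semigroup_def)
qed

lemma invariant_algebra_Pow:
  assumes "group_action \<Gamma> X \<phi>"
  shows "invariant_algebra \<Gamma> X \<phi> (Pow X)"
proof -
  interpret group_action \<Gamma> X \<phi> by fact
  interpret algebra X "Pow X" by (rule algebra_Pow)
  show ?thesis
    by unfold_locales (use surj_prop in blast)
qed

lemma invariant_algebra_borel:
  assumes "borel_action \<Gamma> M \<phi>"
  shows "invariant_algebra \<Gamma> (space M) \<phi> (sets M)"
proof -
  interpret group_action \<Gamma> "space M" \<phi>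
    using assms by (simp add: borel_action_def)
  interpret group \<Gamma>
    using group_hom group_hom.axioms(1) by auto
  interpret algebra "space M" "sets M" ..
  show ?thesis
  proof unfold_locales
    fix A \<gamma> assume A: "A \<in> sets M" and \<gamma>: "\<gamma> \<in> carrier \<Gamma>"
    have "\<phi> \<gamma> ` A = \<phi> (inv\<^bsub>\<Gamma>\<^esub> \<gamma>) -` A \<inter> space M"
    proof (intro equalityI subsetI)
      fix y assume "y \<in> \<phi> \<gamma> ` A"
      then obtain x where x: "x \<in> A" "y = \<phi> \<gamma> x" by auto
      then have "x \<in> space M" using A sets.sets_into_space by blast
      then show "y \<in> \<phi> (inv\<^bsub>\<Gamma>\<^esub> \<gamma>) -` A \<inter> space M"
        using x \<gamma> orbit_sym_aux[of \<gamma> x y] element_image[of \<gamma> x y] by auto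
    next
      fix y assume y: "y \<in> \<phi> (inv\<^bsub>\<Gamma>\<^esub> \<gamma>) -` A \<inter> space M"
      then have "\<phi> \<gamma> (\<phi> (inv\<^bsub>\<Gamma>\<^esub> \<gamma>) y) = y"
        using \<gamma> orbit_sym_aux[of "inv\<^bsub>\<Gamma>\<^esub> \<gamma>" y "\<phi> (inv\<^bsub>\<Gamma>\<^esub> \<gamma>) y"] by auto
      then show "y \<in> \<phi> \<gamma> ` A" using y by (metis IntD1 imageI vimageD)
    qed
    also have "\<dots> \<in> sets M"
      using assms A \<gamma> by (auto simp: borel_action_def intro: measurable_sets)
    finally show "\<phi> \<gamma> ` A \<in> sets M" .
  qed
qed


section \<open>Graphs, growth and asymptotic separation index\<close>

text \<open>
  A simple graph is given by its vertex set and its adjacency relation, a symmetric irreflexive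
  relation on the vertex set.
\<close>

definition graph_dist :: "('v \<times> 'v) set \<Rightarrow> 'v \<Rightarrow> 'v \<Rightarrow> enat" where
  "graph_dist E x y = (INF j \<in> {j. (x, y) \<in> E ^^ j}. enat j)"

definition graph_power :: "'v set \<Rightarrow> ('v \<times> 'v) set \<Rightarrow> nat \<Rightarrow> ('v \<times> 'v) set" where
  "graph_power V E k = {(x, y). x \<in> V \<and> y \<in> V \<and> 0 < graph_dist E x y \<and> graph_dist E x y \<le> enat k}"

definition graph_finite :: "('v \<times> 'v) set \<Rightarrow> 'v set \<Rightarrow> bool" where
  "graph_finite E Y \<longleftrightarrow> (\<forall>x\<in>Y. finite {y. (x, y) \<in> (E \<inter> Y \<times> Y)\<^sup>*})"

definition cayley_graph :: "('g, 'b) monoid_scheme \<Rightarrow> 'g set \<Rightarrow> ('g \<times> 'g) set" where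
  "cayley_graph \<Gamma> S = {(g, h). g \<in> carrier \<Gamma> \<and> h \<in> carrier \<Gamma> \<and> g \<noteq> h \<and>
     (\<exists>\<sigma>\<in>S. h = g \<otimes>\<^bsub>\<Gamma>\<^esub> \<sigma> \<or> g = h \<otimes>\<^bsub>\<Gamma>\<^esub> \<sigma>)}"

definition cayley_ball :: "('g, 'b) monoid_scheme \<Rightarrow> 'g set \<Rightarrow> nat \<Rightarrow> 'g set" where
  "cayley_ball \<Gamma> S R = {g \<in> carrier \<Gamma>. graph_dist (cayley_graph \<Gamma> S) \<one>\<^bsub>\<Gamma>\<^esub> g \<le> enat R}"

definition subexponential_growth :: "('g, 'b) monoid_scheme \<Rightarrow> bool" where
  "subexponential_growth \<Gamma> \<longleftrightarrow> (\<exists>S. finite_generating_set \<Gamma> S \<and>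
     (\<forall>\<epsilon>>0. \<forall>\<^sub>F R in sequentially. real (card (cayley_ball \<Gamma> S R)) \<le> exp (\<epsilon> * real R)))"

definition schreier_graph ::
    "'x set \<Rightarrow> ('g \<Rightarrow> 'x \<Rightarrow> 'x) \<Rightarrow> 'g set \<Rightarrow> ('x \<times> 'x) set" where
  "schreier_graph X \<phi> S = {(x, y). x \<in> X \<and> y \<in> X \<and> x \<noteq> y \<and> (\<exists>\<sigma>\<in>S. y = \<phi> \<sigma> x \<or> x = \<phi> \<sigma> y)}"

text \<open>
  The smallest \<open>s\<close> that works, and \<open>\<infinity>\<close> if there is none, because \<open>Inf {} = \<infinity>\<close> in \<^typ>\<open>enat\<close>.
\<close>

definition asi :: "'v measure \<Rightarrow> ('v \<times> 'v) set \<Rightarrow> enat" where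
  "asi M E = (INF s \<in> {s :: nat. \<forall>k. \<exists>U :: nat \<Rightarrow> 'v set.
      (\<forall>i\<le>s. U i \<in> sets M \<and> graph_finite (graph_power (space M) E k) (U i)) \<and>
      (\<Union>i\<le>s. U i) = space M}. enat s)"

text \<open>
  The index of the Schreier graph does not depend on the finite generating set (see
  \<open>asi_action_eq\<close> below), so the infimum is over a single value.
\<close>

definition asi_action ::
    "('g, 'b) monoid_scheme \<Rightarrow> 'x measure \<Rightarrow> ('g \<Rightarrow> 'x \<Rightarrow> 'x) \<Rightarrow> enat" where
  "asi_action \<Gamma> M \<phi> =
     (INF S \<in> {S. finite_generating_set \<Gamma> S}. asi M (schreier_graph (space M) \<phi> S))"

lemma graph_dist_le_iff: "graph_dist E x y \<le> enat k \<longleftrightarrow> (\<exists>j\<le>k. (x, y) \<in> E ^^ j)"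
proof
  assume *: "graph_dist E x y \<le> enat k"
  let ?A = "enat ` {j. (x, y) \<in> E ^^ j}"
  have "?A \<noteq> {}"
  proof
    assume "?A = {}"
    then have "graph_dist E x y = \<infinity>"
      unfolding graph_dist_def by (simp add: top_enat_def)
    with * show False by simp
  qed
  then have "Inf ?A \<in> ?A" by (metis ex_in_conv wellorder_InfI)
  then obtain j where "(x, y) \<in> E ^^ j" "graph_dist E x y = enat j"
    unfolding graph_dist_def by auto
  with * show "\<exists>j\<le>k. (x, y) \<in> E ^^ j" by auto
next
  assume "\<exists>j\<le>k. (x, y) \<in> E ^^ j"
  then obtain j where "j \<le> k" "(x, y) \<in> E ^^ j" by auto
  then show "graph_dist E x y \<le> enat k"
    unfolding graph_dist_def by (intro INF_lower2[of j]) auto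
qed

lemma graph_dist_pos_iff: "0 < graph_dist E x y \<longleftrightarrow> x \<noteq> y"
  using graph_dist_le_iff[of E x y 0] by (auto simp: zero_enat_def[symmetric])

lemma graph_power_iff:
  "(x, y) \<in> graph_power V E k \<longleftrightarrow> x \<in> V \<and> y \<in> V \<and> x \<noteq> y \<and> (\<exists>j\<le>k. (x, y) \<in> E ^^ j)"
  unfolding graph_power_def graph_dist_le_iff graph_dist_pos_iff by blast

lemma schreier_word:
  assumes act: "group_action \<Gamma> X \<phi>" and S: "S \<subseteq> carrier \<Gamma>" and g: "g \<in> generate \<Gamma> S"
  shows "\<exists>c. \<forall>x\<in>X. \<exists>j\<le>c. (x, \<phi> g x) \<in> schreier_graph X \<phi> S ^^ j"
  using g
proof induction
  interpret group_action \<Gamma> X \<phi> by fact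
  interpret group \<Gamma>
    using group_hom group_hom.axioms(1) by auto
  let ?E = "schreier_graph X \<phi> S"
  have step: "\<exists>j\<le>1. (x, y) \<in> ?E ^^ j"
    if "x \<in> X" "y \<in> X" "h \<in> S" "y = \<phi> h x \<or> x = \<phi> h y" for x y h
  proof (cases "x = y")
    case True
    then show ?thesis by (intro exI[of _ 0]) auto
  next
    case False
    then show ?thesis using that by (intro exI[of _ 1]) (auto simp: schreier_graph_def)
  qed
  {
    case one
    have "\<phi> \<one>\<^bsub>\<Gamma>\<^esub> x = x" if "x \<in> X" for x using id_eq_one that by (metis restrict_apply')
    then show ?case by (intro exI[of _ 0]) auto
  next
    case (incl h)
    then show ?case using step S element_image by (intro exI[of _ 1]) blast
  next
    case (inv h)
    have "\<exists>j\<le>1. (x, \<phi> (inv\<^bsub>\<Gamma>\<^esub> h) x) \<in> ?E ^^ j" if x: "x \<in> X" for x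
    proof (rule step[OF x _ inv])
      have "h \<in> carrier \<Gamma>" using inv S by auto
      then show "\<phi> (inv\<^bsub>\<Gamma>\<^esub> h) x \<in> X" 
        and "\<phi> (inv\<^bsub>\<Gamma>\<^esub> h) x = \<phi> h x \<or> x = \<phi> h (\<phi> (inv\<^bsub>\<Gamma>\<^esub> h) x)"
        using x element_image[of "inv\<^bsub>\<Gamma>\<^esub> h" x] orbit_sym_aux[of "inv\<^bsub>\<Gamma>\<^esub> h" x] by auto
    qed
    then show ?case by blast
  next
    case (eng g h)
    then obtain c d where
      c: "\<forall>x\<in>X. \<exists>j\<le>c. (x, \<phi> g x) \<in> ?E ^^ j" and d: "\<forall>x\<in>X. \<exists>j\<le>d. (x, \<phi> h x) \<in> ?E ^^ j"
      by blast
    have gh: "g \<in> carrier \<Gamma>" "h \<in> carrier \<Gamma>"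
      using eng generate_in_carrier[OF S] by auto
    have "\<exists>j\<le>d + c. (x, \<phi> (g \<otimes>\<^bsub>\<Gamma>\<^esub> h) x) \<in> ?E ^^ j" if x: "x \<in> X" for x
    proof -
      have "\<phi> h x \<in> X" using x gh element_image by blast
      then obtain i j where "i \<le> d" "(x, \<phi> h x) \<in> ?E ^^ i" "j \<le> c" "(\<phi> h x, \<phi> g (\<phi> h x)) \<in> ?E ^^ j"
        using c d x by blast
      then show ?thesis
        using composition_rule[OF x gh]
        by (intro exI[of _ "i + j"]) (auto simp: relpow_add)
    qed
    then show ?case by blast
  }
qed

lemma sym_schreier_graph: "Relation.sym (schreier_graph X \<phi> S)"
  by (auto simp: Relation.sym_def schreier_graph_def)

lemma relpow_schreier_sym:
  "(x, y) \<in> schreier_graph X \<phi> S ^^ j \<Longrightarrow> (y, x) \<in> schreier_graph X \<phi> S ^^ j"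
proof (induction j arbitrary: y)
  case (Suc j)
  then obtain z where "(x, z) \<in> schreier_graph X \<phi> S ^^ j" "(z, y) \<in> schreier_graph X \<phi> S"
    by auto
  then show ?case
    using Suc.IH sym_schreier_graph by (metis relpow_Suc_I2 symD)
qed auto

lemma graph_finite_mono:
  assumes "graph_finite E' Y" "E \<subseteq> E'"
  shows "graph_finite E Y"
proof -
  have "(E \<inter> Y \<times> Y)\<^sup>* \<subseteq> (E' \<inter> Y \<times> Y)\<^sup>*"
    using assms(2) by (intro rtrancl_mono) auto
  then have "{y. (x, y) \<in> (E \<inter> Y \<times> Y)\<^sup>*} \<subseteq> {y. (x, y) \<in> (E' \<inter> Y \<times> Y)\<^sup>*}" for x
    by auto
  with assms(1) show ?thesis
    unfolding graph_finite_def by (blast intro: finite_subset)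
qed

lemma asi_schreier_le:
  assumes act: "group_action \<Gamma> (space M) \<phi>"
    and S: "finite_generating_set \<Gamma> S" and T: "finite_generating_set \<Gamma> T"
  shows "asi M (schreier_graph (space M) \<phi> T) \<le> asi M (schreier_graph (space M) \<phi> S)"
proof -
  let ?X = "space M"
  let ?E = "schreier_graph ?X \<phi> S" and ?F = "schreier_graph ?X \<phi> T"
  have "\<forall>t\<in>T. \<exists>c. \<forall>x\<in>?X. \<exists>j\<le>c. (x, \<phi> t x) \<in> ?E ^^ j"
    using schreier_word[OF act] S T unfolding finite_generating_set_def by blast
  then obtain c where c: "\<forall>t\<in>T. \<forall>x\<in>?X. \<exists>j\<le>c t. (x, \<phi> t x) \<in> ?E ^^ j"
    by metis
  define C where "C = (\<Sum>t\<in>T. c t)"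
  have cC: "c t \<le> C" if "t \<in> T" for t
    using that T unfolding C_def finite_generating_set_def by (auto intro: member_le_sum)
  have F1: "\<exists>j\<le>C. (x, y) \<in> ?E ^^ j" if xy: "(x, y) \<in> ?F" for x y
  proof -
    from xy obtain t where t: "t \<in> T" "x \<in> ?X" "y \<in> ?X" "y = \<phi> t x \<or> x = \<phi> t y"
      unfolding schreier_graph_def by auto
    then have "(\<exists>j\<le>c t. (x, y) \<in> ?E ^^ j) \<or> (\<exists>j\<le>c t. (y, x) \<in> ?E ^^ j)"
      using c by blast
    then show ?thesis using relpow_schreier_sym cC[OF t(1)] by (meson order_trans)
  qed
  have Fj: "\<exists>i\<le>j * C. (x, y) \<in> ?E ^^ i" if "(x, y) \<in> ?F ^^ j" for x y j
    using that
  proof (induction j arbitrary: y)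
    case (Suc j)
    then obtain z where z: "(x, z) \<in> ?F ^^ j" "(z, y) \<in> ?F" by auto
    obtain i where "i \<le> j * C" "(x, z) \<in> ?E ^^ i" using Suc.IH z by blast
    moreover obtain i' where "i' \<le> C" "(z, y) \<in> ?E ^^ i'" using F1 z by blast
    ultimately show ?case
      by (intro exI[of _ "i + i'"]) (auto simp: relpow_add)
  qed auto
  have pow: "graph_power ?X ?F k \<subseteq> graph_power ?X ?E (k * C)" for k
  proof (intro subrelI)
    fix x y assume "(x, y) \<in> graph_power ?X ?F k"
    then obtain j where j: "x \<in> ?X" "y \<in> ?X" "x \<noteq> y" "j \<le> k" "(x, y) \<in> ?F ^^ j"
      by (auto simp: graph_power_iff)
    then obtain i where "i \<le> j * C" "(x, y) \<in> ?E ^^ i" using Fj by blast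
    moreover have "j * C \<le> k * C" using j by simp
    ultimately have "\<exists>i\<le>k * C. (x, y) \<in> ?E ^^ i" using order_trans by blast
    then show "(x, y) \<in> graph_power ?X ?E (k * C)"
      using j by (simp add: graph_power_iff)
  qed
  have fin: "graph_finite (graph_power ?X ?F k) Y"
    if "graph_finite (graph_power ?X ?E (k * C)) Y" for k Y
    using that pow by (rule graph_finite_mono)
  show ?thesis
    unfolding asi_def
  proof (rule INF_superset_mono)
    show "{s :: nat. \<forall>k. \<exists>U. (\<forall>i\<le>s. U i \<in> sets M \<and> graph_finite (graph_power ?X ?E k) (U i)) \<and>
              (\<Union>i\<le>s. U i) = ?X}
        \<subseteq> {s :: nat. \<forall>k. \<exists>U. (\<forall>i\<le>s. U i \<in> sets M \<and> graph_finite (graph_power ?X ?F k) (U i)) \<and>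
              (\<Union>i\<le>s. U i) = ?X}"
    proof (intro subsetI CollectI allI)
      fix s k :: nat
      assume "s \<in> {s. \<forall>k. \<exists>U. (\<forall>i\<le>s. U i \<in> sets M \<and>
        graph_finite (graph_power ?X ?E k) (U i)) \<and> (\<Union>i\<le>s. U i) = ?X}"
      then obtain U where U: "\<forall>i\<le>s. U i \<in> sets M \<and> graph_finite (graph_power ?X ?E (k * C)) (U i)"
        "(\<Union>i\<le>s. U i) = ?X"
        by blast
      then show "\<exists>U. (\<forall>i\<le>s. U i \<in> sets M \<and> graph_finite (graph_power ?X ?F k) (U i)) \<and>
          (\<Union>i\<le>s. U i) = ?X"
        using fin by (intro exI[of _ U]) simp
    qed
  qed simp
qed

lemma asi_action_eq:
  assumes "borel_action \<Gamma> M \<phi>" and "finite_generating_set \<Gamma> S"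
  shows "asi_action \<Gamma> M \<phi> = asi M (schreier_graph (space M) \<phi> S)"
proof (rule antisym)
  show "asi_action \<Gamma> M \<phi> \<le> asi M (schreier_graph (space M) \<phi> S)"
    unfolding asi_action_def by (rule INF_lower) (use assms in auto)
  show "asi M (schreier_graph (space M) \<phi> S) \<le> asi_action \<Gamma> M \<phi>"
    unfolding asi_action_def
    by (rule INF_greatest) (use assms asi_schreier_le in \<open>auto simp: borel_action_def\<close>)
qed

end

theory Submission
  imports Defs
begin

text \<open>
  Up to the difference between \<open>0\<close> and \<open>[\<emptyset>]\<close>, an element of a type semigroup is determined by a
  bounded function \<open>X \<rightarrow> \<nat>\<close>, the multiplicity function of any representative, and the element does
  not change if the mass of this function is moved by finitely many group elements
  (\<open>type_equiv_of_flow\<close>). So \<open>\<alpha> \<le> \<beta>\<close> asks for a Borel integral flow that sends all the mass of the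
  multiplicity function \<open>a\<close> of \<open>\<alpha>\<close> along finitely many group elements without exceeding the
  multiplicity function \<open>b\<close> of \<open>\<beta>\<close>. Of the hypothesis \<open>n\<alpha> \<le> m\<beta>\<close> in the full type semigroup only a
  counting consequence is kept: there is a finite \<open>F \<subseteq> \<Gamma>\<close> with \<open>n a(Y) \<le> m b(F Y)\<close> for all finite
  \<open>Y\<close> (\<open>type_equiv_expansion\<close>). As \<open>n > m\<close>, this is Hall's condition with a factor to spare.

  The Borel flow is built by augmentation. If an unsaturated source admits no improvement near it,
  then the sets of sources reached from it by alternating paths satisfy \<open>b(F H\<^sub>j) \<le> a(H\<^sub>j\<^sub>+\<^sub>1)\<close>
  (\<open>saturated_expansion\<close>). If such a failure is impossible within a fixed finite window, then
  improvements can be made simultaneously at all points of a well separated Borel set, and finitely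
  many Borel sets of this kind cover \<open>X\<close>, so that finitely many rounds saturate every source
  (\<open>saturating_flow_exists\<close>).

  Under subexponential growth the failure would give \<open>n\<^sup>r \<le> m\<^sup>r a(H\<^sub>r)\<close>, which is more than the ball
  of radius \<open>r\<close> can hold when \<open>r\<close> is large; hence \<open>saturating_flow_subexponential\<close>.

  Without a growth bound the same argument works as soon as \<open>a\<close> lives on a set with finite
  components, because then the sets \<open>H\<^sub>j\<close> stabilise
  (\<open>saturating_flow_finite_components\<close>). Finite asymptotic separation index provides covers of \<open>X\<close>
  by \<open>s + 1\<close> such sets, and two steps combine the flows found on these sets. The flows are averaged
  over many slowly varying partitions subordinate to the cover. Each sink sees at most \<open>s + 1\<close> of
  the partitions change nearby, so that the average is a Borel fractional flow, with \<open>n'\<close> units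
  leaving each unit of \<open>a\<close>, at most \<open>m'\<close> units reaching each unit of \<open>b\<close>, and still \<open>m' < n'\<close>
  (\<open>measurable_fractional_flow\<close>). The fractional flow is then rounded separately on each of the
  \<open>s + 1\<close> classes of a partition. Rounding up costs less than one unit per class and sink, and this
  is absorbed by first gathering the sinks in bounded Borel cells that are either large or entire
  components (\<open>round_fractional_flow\<close>).
\<close>

section \<open>Multiplicity functions and flows\<close>

definition translates :: "('g \<Rightarrow> 'x \<Rightarrow> 'x) \<Rightarrow> 'g set \<Rightarrow> 'x set \<Rightarrow> 'x set" where
  "translates \<phi> D Y = (\<Union>d\<in>D. \<phi> d ` Y)"

definition cover_count :: "'x set multiset \<Rightarrow> 'x \<Rightarrow> nat" where
  "cover_count u x = size {#A \<in># u. x \<in> A#}"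

text \<open>
  A flow with labels in \<open>E\<close> is a function \<open>z\<close>, where \<open>z \<gamma> x\<close> units travel from \<open>x\<close> to \<open>\<phi> \<gamma> x\<close>.
  Labels are kept apart even if they move \<open>x\<close> to the same point.
\<close>

definition outflow :: "'g set \<Rightarrow> ('g \<Rightarrow> 'x \<Rightarrow> nat) \<Rightarrow> 'x \<Rightarrow> nat" where
  "outflow E z x = (\<Sum>\<gamma>\<in>E. z \<gamma> x)"

definition inflow ::
    "('g, 'b) monoid_scheme \<Rightarrow> ('g \<Rightarrow> 'x \<Rightarrow> 'x) \<Rightarrow> 'g set \<Rightarrow> ('g \<Rightarrow> 'x \<Rightarrow> nat) \<Rightarrow> 'x \<Rightarrow> nat" where
  "inflow \<Gamma> \<phi> E z y = (\<Sum>\<gamma>\<in>E. z \<gamma> (\<phi> (inv\<^bsub>\<Gamma>\<^esub> \<gamma>) y))"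

lemma finite_translates: "finite D \<Longrightarrow> finite Y \<Longrightarrow> finite (translates \<phi> D Y)"
  by (simp add: translates_def)

lemma translates_mono: "D \<subseteq> D' \<Longrightarrow> Y \<subseteq> Y' \<Longrightarrow> translates \<phi> D Y \<subseteq> translates \<phi> D' Y'"
  by (auto simp: translates_def)

lemma cover_count_simps [simp]:
  "cover_count {#} x = 0"
  "cover_count (u + v) x = cover_count u x + cover_count v x"
  "cover_count {#A#} x = of_bool (x \<in> A)"
  "cover_count (add_mset A u) x = of_bool (x \<in> A) + cover_count u x"
  by (auto simp: cover_count_def)

lemma cover_count_repeat [simp]: "cover_count (repeat_mset n u) x = n * cover_count u x"
  by (induction n) auto

lemma cover_count_sum: "finite I \<Longrightarrow> cover_count (\<Sum>i\<in>I. f i) x = (\<Sum>i\<in>I. cover_count (f i) x)"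
  by (induction I rule: finite_induct) auto

lemma cover_count_le_size: "cover_count u x \<le> size u"
  unfolding cover_count_def by (rule size_filter_mset_lesseq)

context group_action
begin

lemma group_acting: "group G"
  using group_hom group_hom.axioms(1) by auto

lemma act_closed: "g \<in> carrier G \<Longrightarrow> x \<in> E \<Longrightarrow> \<phi> g x \<in> E"
  using element_image by blast

lemma act_one: "x \<in> E \<Longrightarrow> \<phi> \<one> x = x"
  using id_eq_one by (metis restrict_apply')

lemma act_inv_act: "g \<in> carrier G \<Longrightarrow> x \<in> E \<Longrightarrow> \<phi> (inv g) (\<phi> g x) = x"
  using orbit_sym_aux by blast

lemma act_act_inv: "g \<in> carrier G \<Longrightarrow> x \<in> E \<Longrightarrow> \<phi> g (\<phi> (inv g) x) = x"
  using orbit_sym_aux[of "inv g" x] group.inv_inv[OF group_acting] group.inv_closed[OF group_acting]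
  by force

lemma act_eq_iff: "g \<in> carrier G \<Longrightarrow> x \<in> E \<Longrightarrow> y \<in> E \<Longrightarrow> \<phi> g x = y \<longleftrightarrow> x = \<phi> (inv g) y"
  using act_inv_act act_act_inv by auto

lemma act_image_iff:
  "g \<in> carrier G \<Longrightarrow> A \<subseteq> E \<Longrightarrow> y \<in> E \<Longrightarrow> y \<in> \<phi> g ` A \<longleftrightarrow> \<phi> (inv g) y \<in> A"
  using act_inv_act act_act_inv by (force simp: subset_iff image_iff)

lemma translates_in_space: "D \<subseteq> carrier G \<Longrightarrow> Y \<subseteq> E \<Longrightarrow> translates \<phi> D Y \<subseteq> E"
  by (auto simp: translates_def intro!: act_closed)

lemma translates_translates:
  assumes "D \<subseteq> carrier G" "D' \<subseteq> carrier G" "Y \<subseteq> E"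
  shows "translates \<phi> D (translates \<phi> D' Y) = translates \<phi> (D <#>\<^bsub>G\<^esub> D') Y"
proof -
  have "\<phi> d (\<phi> d' y) = \<phi> (d \<otimes> d') y" if "d \<in> D" "d' \<in> D'" "y \<in> Y" for d d' y
    using that assms by (simp add: composition_rule subset_iff)
  then show ?thesis
    unfolding translates_def set_mult_def by (auto 4 4 simp: image_iff)
qed

lemma finite_set_mult: "finite D \<Longrightarrow> finite D' \<Longrightarrow> finite (D <#>\<^bsub>G\<^esub> D')"
  by (simp add: set_mult_def)

lemma set_mult_carrier: "D \<subseteq> carrier G \<Longrightarrow> D' \<subseteq> carrier G \<Longrightarrow> D <#>\<^bsub>G\<^esub> D' \<subseteq> carrier G"
  using group.is_monoid[OF group_acting] by (force simp: set_mult_def intro: monoid.m_closed)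

lemma sum_outflow_le_sum_inflow:
  assumes "finite F" "F \<subseteq> carrier G" "finite Y" "Y \<subseteq> E"
  shows "sum (outflow F z) Y \<le> sum (inflow G \<phi> F z) (translates \<phi> F Y)"
proof -
  have "sum (outflow F z) Y = (\<Sum>\<gamma>\<in>F. \<Sum>x\<in>Y. z \<gamma> x)"
    unfolding outflow_def by (rule sum.swap)
  also have "\<dots> \<le> (\<Sum>\<gamma>\<in>F. \<Sum>y\<in>translates \<phi> F Y. z \<gamma> (\<phi> (inv \<gamma>) y))"
  proof (rule sum_mono)
    fix \<gamma> assume g: "\<gamma> \<in> F"
    have "(\<Sum>x\<in>Y. z \<gamma> x) = (\<Sum>x\<in>Y. z \<gamma> (\<phi> (inv \<gamma>) (\<phi> \<gamma> x)))"
      using g assms by (intro sum.cong) (auto simp: act_inv_act subset_iff)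
    also have "\<dots> = (\<Sum>y\<in>\<phi> \<gamma> ` Y. z \<gamma> (\<phi> (inv \<gamma>) y))"
      using g assms inj_prop by (subst sum.reindex) (auto intro: inj_on_subset)
    also have "\<dots> \<le> (\<Sum>y\<in>translates \<phi> F Y. z \<gamma> (\<phi> (inv \<gamma>) y))"
      using g assms by (intro sum_mono2) (auto simp: translates_def)
    finally show "(\<Sum>x\<in>Y. z \<gamma> x) \<le> (\<Sum>y\<in>translates \<phi> F Y. z \<gamma> (\<phi> (inv \<gamma>) y))" .
  qed
  also have "\<dots> = sum (inflow G \<phi> F z) (translates \<phi> F Y)"
    unfolding inflow_def by (rule sum.swap)
  finally show ?thesis .
qed

definition expands_into :: "'a set \<Rightarrow> ('c \<Rightarrow> nat) \<Rightarrow> ('c \<Rightarrow> nat) \<Rightarrow> bool" where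
  "expands_into F c c' \<longleftrightarrow> (\<forall>Y. finite Y \<longrightarrow> Y \<subseteq> E \<longrightarrow> sum c Y \<le> sum c' (translates \<phi> F Y))"

lemma sum_translates_mono:
  assumes "finite F'" "finite Y" "F \<subseteq> F'"
  shows "sum c (translates \<phi> F Y) \<le> (sum c (translates \<phi> F' Y) :: nat)"
  using assms translates_mono[of F F' Y Y] by (intro sum_mono2) (auto simp: finite_translates)

lemma expands_into_translate:
  assumes "finite F" "F \<subseteq> carrier G" "\<gamma> \<in> F" and c: "\<And>x. x \<in> E \<Longrightarrow> c x = c' (\<phi> \<gamma> x)"
  shows "expands_into F c c'"
  unfolding expands_into_def
proof (intro allI impI)
  fix Y assume Y: "finite Y" "Y \<subseteq> E"
  have "inj_on (\<phi> \<gamma>) Y" using assms Y inj_prop by (blast intro: inj_on_subset)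
  then have "sum c Y = sum c' (\<phi> \<gamma> ` Y)"
    using c Y by (auto simp: sum.reindex intro!: sum.cong)
  also have "\<dots> \<le> sum c' (translates \<phi> F Y)"
    using assms Y by (intro sum_mono2) (auto simp: translates_def)
  finally show "sum c Y \<le> sum c' (translates \<phi> F Y)" .
qed

lemma expands_into_trans:
  assumes "expands_into F c c'" "expands_into F' c' c''" "finite H" "F' <#>\<^bsub>G\<^esub> F \<subseteq> H"
    and F: "finite F" "F \<subseteq> carrier G" "F' \<subseteq> carrier G"
  shows "expands_into H c c''"
  unfolding expands_into_def
proof (intro allI impI)
  fix Y assume Y: "finite Y" "Y \<subseteq> E"
  have "sum c Y \<le> sum c' (translates \<phi> F Y)" using assms(1) Y by (simp add: expands_into_def)
  also have "\<dots> \<le> sum c'' (translates \<phi> F' (translates \<phi> F Y))"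
    using assms(2) Y F by (simp add: expands_into_def finite_translates translates_in_space)
  also have "\<dots> \<le> sum c'' (translates \<phi> H Y)"
    using sum_translates_mono[OF assms(3) Y(1) assms(4)] F Y by (simp add: translates_translates)
  finally show "sum c Y \<le> sum c'' (translates \<phi> H Y)" .
qed

lemma expands_into_mono:
  "expands_into F c c' \<Longrightarrow> finite F' \<Longrightarrow> F \<subseteq> F' \<Longrightarrow> expands_into F' c c'"
  unfolding expands_into_def using sum_translates_mono by (meson order_trans)

lemma expands_into_add:
  "expands_into F c c' \<Longrightarrow> expands_into F d d' \<Longrightarrow>
    expands_into F (\<lambda>x. c x + d x) (\<lambda>x. c' x + d' x)"
  unfolding expands_into_def by (auto simp: sum.distrib intro: add_mono)

text \<open>
  The part of an equality of types that survives without measurability. A finite set of group elements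
  suffices because a derivation uses only finitely many of them; transitivity multiplies the sets, and
  the symmetric form makes the induction pass through \<open>sym\<close>.
\<close>

lemma type_equiv_expansion:
  assumes "type_equiv G \<phi> (Pow E) u v"
  shows "\<exists>F. finite F \<and> F \<subseteq> carrier G \<and> expands_into F (cover_count u) (cover_count v) \<and>
    expands_into F (cover_count v) (cover_count u)"
  using assms
proof induction
  case (act A \<gamma>)
  interpret group G by (rule group_acting)
  let ?F = "{\<gamma>, inv \<gamma>}"
  have A: "A \<subseteq> E" and F: "finite ?F" "?F \<subseteq> carrier G" using act by auto
  have *: "x \<in> A \<longleftrightarrow> \<phi> \<gamma> x \<in> \<phi> \<gamma> ` A" "x \<in> \<phi> \<gamma> ` A \<longleftrightarrow> \<phi> (inv \<gamma>) x \<in> A" if "x \<in> E" for x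
    using that A act by (simp_all add: act_image_iff act_closed act_inv_act)
  have "expands_into ?F (cover_count {#A#}) (cover_count {#\<phi> \<gamma> ` A#})"
    by (rule expands_into_translate[OF F, of \<gamma>]) (simp_all flip: *(1))
  moreover have "expands_into ?F (cover_count {#\<phi> \<gamma> ` A#}) (cover_count {#A#})"
    by (rule expands_into_translate[OF F, of "inv \<gamma>"]) (simp_all add: *(2))
  ultimately show ?case using F by blast
next
  case (disj B C)
  interpret group G by (rule group_acting)
  have "cover_count {#B \<union> C#} = cover_count ({#B#} + {#C#})"
    using disj by (intro ext) auto
  then show ?case
    by (intro exI[of _ "{\<one>}"]) (auto intro!: expands_into_translate[of _ \<one>] simp: act_one)
next
  case (refl u)
  interpret group G by (rule group_acting)
  show ?case
    by (intro exI[of _ "{\<one>}"]) (auto intro!: expands_into_translate[of _ \<one>] simp: act_one)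
next
  case (sym u v)
  then show ?case by blast
next
  case (trans u v w)
  from trans.IH obtain F F' where F: "finite F" "F \<subseteq> carrier G"
      "expands_into F (cover_count u) (cover_count v)" "expands_into F (cover_count v) (cover_count u)"
    and F': "finite F'" "F' \<subseteq> carrier G"
      "expands_into F' (cover_count v) (cover_count w)" "expands_into F' (cover_count w) (cover_count v)"
    by blast
  let ?H = "(F' <#>\<^bsub>G\<^esub> F) \<union> (F <#>\<^bsub>G\<^esub> F')"
  have H: "finite ?H" "?H \<subseteq> carrier G" using F F' set_mult_carrier by (auto simp: finite_set_mult)
  have "expands_into ?H (cover_count u) (cover_count w)"
    by (rule expands_into_trans[OF F(3) F'(3) H(1) _ F(1,2) F'(2)]) simp
  moreover have "expands_into ?H (cover_count w) (cover_count u)"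
    by (rule expands_into_trans[OF F'(4) F(4) H(1) _ F'(1,2) F(2)]) simp
  ultimately show ?case using H by blast
next
  case (add u v u' v')
  from add.IH obtain F F' where F: "finite F" "F \<subseteq> carrier G"
      "expands_into F (cover_count u) (cover_count v)" "expands_into F (cover_count v) (cover_count u)"
    and F': "finite F'" "F' \<subseteq> carrier G"
      "expands_into F' (cover_count u') (cover_count v')" "expands_into F' (cover_count v') (cover_count u')"
    by blast
  have "finite (F \<union> F')" "F \<subseteq> F \<union> F'" "F' \<subseteq> F \<union> F'" using F F' by auto
  note lift = expands_into_mono[OF _ this(1,2)] expands_into_mono[OF _ this(1,3)]
  have sum: "cover_count (p + q) = (\<lambda>x. cover_count p x + cover_count q x)" for p q :: "'c set multiset"
    by (intro ext) simp
  have "expands_into (F \<union> F') (cover_count (u + u')) (cover_count (v + v'))"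
    "expands_into (F \<union> F') (cover_count (v + v')) (cover_count (u + u'))"
    unfolding sum
    by (intro expands_into_add lift(1)[OF F(3)] lift(2)[OF F'(3)])
      (intro expands_into_add lift(1)[OF F(4)] lift(2)[OF F'(4)])
  moreover have "finite (F \<union> F')" "F \<union> F' \<subseteq> carrier G" using F F' by auto
  ultimately show ?case by blast
qed

end

section \<open>Types are determined by multiplicity functions\<close>

context invariant_algebra
begin

text \<open>
  The normal form of an element with multiplicity function \<open>a\<close>, for \<open>a\<close> bounded by \<open>K\<close>.
\<close>

definition superlevels :: "('c \<Rightarrow> nat) \<Rightarrow> nat \<Rightarrow> 'c set multiset" where
  "superlevels a K = (\<Sum>t\<in>{1..K}. {#{x \<in> X. t \<le> a x}#})"

lemma type_equiv_sum:
  assumes "finite I" "\<And>i. i \<in> I \<Longrightarrow> type_equiv \<Gamma> \<phi> \<A> (f i) (g i)"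
  shows "type_equiv \<Gamma> \<phi> \<A> (\<Sum>i\<in>I. f i) (\<Sum>i\<in>I. g i)"
  using assms
  by (induction I rule: finite_induct) (simp_all add: type_equiv.add type_equiv.refl)

lemma set_mset_sum_subset:
  "finite I \<Longrightarrow> (\<And>i. i \<in> I \<Longrightarrow> set_mset (f i) \<subseteq> S) \<Longrightarrow> set_mset (\<Sum>i\<in>I. f i) \<subseteq> S"
  by (induction I rule: finite_induct) auto

lemma type_equiv_UN:
  assumes "finite I" "I \<noteq> {}" "\<And>i. i \<in> I \<Longrightarrow> B i \<in> \<A>" "disjoint_family_on B I"
  shows "type_equiv \<Gamma> \<phi> \<A> {#\<Union>i\<in>I. B i#} (\<Sum>i\<in>I. {#B i#})"
  using assms
proof (induction I rule: finite_ne_induct)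
  case (singleton i)
  have "type_equiv \<Gamma> \<phi> \<A> {#B i#} {#B i#}"
    by (rule type_equiv.refl) (simp add: singleton)
  then show ?case by simp
next
  case (insert i I)
  have members: "B i \<in> \<A>" "\<And>j. j \<in> I \<Longrightarrow> B j \<in> \<A>" using insert.prems by simp_all
  have disj: "disjoint_family_on B I"
    by (rule disjoint_family_on_mono[OF _ insert.prems(2)]) blast
  have U: "(\<Union>i\<in>I. B i) \<in> \<A>" using insert.hyps members by (intro finite_UN) simp_all
  have "B i \<inter> (\<Union>i\<in>I. B i) = {}"
    using insert.prems(2) insert.hyps by (auto simp: disjoint_family_on_def)
  then have 1: "type_equiv \<Gamma> \<phi> \<A> {#B i \<union> (\<Union>i\<in>I. B i)#} ({#B i#} + {#\<Union>i\<in>I. B i#})"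
    by (rule type_equiv.disj[OF members(1) U])
  have 2: "type_equiv \<Gamma> \<phi> \<A> {#B i#} {#B i#}"
    by (rule type_equiv.refl) (simp add: members)
  have "type_equiv \<Gamma> \<phi> \<A> {#B i \<union> (\<Union>i\<in>I. B i)#} ({#B i#} + (\<Sum>i\<in>I. {#B i#}))"
    by (rule type_equiv.trans[OF 1 type_equiv.add[OF 2 insert.IH[OF members(2) disj]]])
  then show ?case using insert.hyps by simp
qed

lemma superlevel_in_algebra:
  "set_mset u \<subseteq> \<A> \<Longrightarrow> {x \<in> X. t \<le> cover_count u x} \<in> \<A>"
proof (induction u arbitrary: t)
  case empty
  then show ?case by (cases t) auto
next
  case (add A u)
  show ?case
  proof (cases t)
    case 0
    then show ?thesis by auto
  next
    case (Suc k)
    have A: "A \<in> \<A>" "A \<subseteq> X" using add.prems sets_into_space by auto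
    have "{x \<in> X. t \<le> cover_count (add_mset A u) x} =
        {x \<in> X. t \<le> cover_count u x} \<union> (A \<inter> {x \<in> X. k \<le> cover_count u x})"
      using Suc A(2) by auto
    then show ?thesis using add A by auto
  qed
qed

text \<open>
  Adding \<open>A\<close> to \<open>u\<close> raises the multiplicity by one on \<open>A\<close>, so the part of \<open>A\<close> on which the old
  multiplicity is \<open>t - 1\<close> joins the \<open>t\<close>-th level. The summand \<open>[\<emptyset>]\<close> covers the case that \<open>u\<close> is
  empty while the normal form consists of \<open>K\<close> empty sets; it makes no difference for nonempty \<open>u\<close> by
  \<open>type_equiv_add_empty\<close> below.
\<close>

lemma type_equiv_superlevels:
  assumes "set_mset u \<subseteq> \<A>" "size u \<le> K" "K \<ge> 1"
  shows "type_equiv \<Gamma> \<phi> \<A> (u + {#{}#}) (superlevels (cover_count u) K)"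
  using assms
proof (induction u)
  case empty
  then have "type_equiv \<Gamma> \<phi> \<A> {#\<Union>i\<in>{1..K}. {}#} (\<Sum>i\<in>{1..K}. {#{}#})"
    by (intro type_equiv_UN) (auto simp: disjoint_family_on_def)
  moreover have "superlevels (\<lambda>x. 0) K = (\<Sum>i\<in>{1..K}. {#{}#})"
    unfolding superlevels_def by (intro sum.cong) auto
  moreover have "(\<Union>i\<in>{1..K}. {}) = ({} :: 'c set)" by blast
  ultimately show ?case by simp
next
  case (add A u)
  let ?c = "cover_count u"
  have A: "A \<in> \<A>" "A \<subseteq> X" using add.prems sets_into_space by auto
  have lev: "{x \<in> X. t \<le> ?c x} \<in> \<A>" for t
    using add.prems superlevel_in_algebra[of u t] by auto
  define B where "B t = A \<inter> {x \<in> X. ?c x = t - 1}" for t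
  have B: "B t \<in> \<A>" for t
  proof -
    have "{x \<in> X. ?c x = t - 1} = {x \<in> X. t - 1 \<le> ?c x} - {x \<in> X. Suc (t - 1) \<le> ?c x}"
      by auto
    then show ?thesis
      unfolding B_def using Int[OF A(1) Diff[OF lev lev]] by simp
  qed
  have "(\<Union>t\<in>{1..K}. B t) = A"
  proof -
    have "?c x < K" for x using cover_count_le_size[of u x] add.prems by simp
    then have "x \<in> (\<Union>t\<in>{1..K}. B t)" if "x \<in> A" for x
      using that A(2) by (intro UN_I[of "Suc (?c x)"]) (auto simp: B_def Suc_le_eq)
    then show ?thesis by (auto simp: B_def)
  qed
  moreover have "disjoint_family_on B {1..K}"
    by (auto simp: disjoint_family_on_def B_def)
  ultimately have 1: "type_equiv \<Gamma> \<phi> \<A> {#A#} (\<Sum>t\<in>{1..K}. {#B t#})"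
    using type_equiv_UN[of "{1..K}" B] B add.prems by auto
  have "type_equiv \<Gamma> \<phi> \<A> ({#A#} + (u + {#{}#})) ((\<Sum>t\<in>{1..K}. {#B t#}) + superlevels ?c K)"
    using 1 add by (intro type_equiv.add add.IH) auto
  moreover have "type_equiv \<Gamma> \<phi> \<A> ((\<Sum>t\<in>{1..K}. {#B t#}) + superlevels ?c K)
      (superlevels (cover_count (add_mset A u)) K)"
    unfolding superlevels_def sum.distrib[symmetric]
  proof (rule type_equiv_sum)
    fix t assume t: "t \<in> {1..K}"
    have eq: "{x \<in> X. t \<le> cover_count (add_mset A u) x} = B t \<union> {x \<in> X. t \<le> ?c x}"
      using t A(2) by (auto simp: B_def)
    have "B t \<inter> {x \<in> X. t \<le> ?c x} = {}"
      using t by (auto simp: B_def)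
    then show "type_equiv \<Gamma> \<phi> \<A> ({#B t#} + {#{x \<in> X. t \<le> ?c x}#})
        {#{x \<in> X. t \<le> cover_count (add_mset A u) x}#}"
      unfolding eq by (intro type_equiv.sym[OF type_equiv.disj] B lev)
  qed simp
  ultimately have "type_equiv \<Gamma> \<phi> \<A> ({#A#} + (u + {#{}#})) (superlevels (cover_count (add_mset A u)) K)"
    by (rule type_equiv.trans)
  then show ?case by (simp del: cover_count_simps)
qed

lemma type_equiv_of_cover_count_eq:
  assumes "set_mset u \<subseteq> \<A>" "set_mset v \<subseteq> \<A>" "\<And>x. x \<in> X \<Longrightarrow> cover_count u x = cover_count v x"
  shows "type_equiv \<Gamma> \<phi> \<A> (u + {#{}#}) (v + {#{}#})"
proof -
  let ?K = "Suc (size u + size v)"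
  have "superlevels (cover_count u) ?K = superlevels (cover_count v) ?K"
    unfolding superlevels_def using assms(3) by (intro sum.cong) auto
  moreover have "type_equiv \<Gamma> \<phi> \<A> (u + {#{}#}) (superlevels (cover_count u) ?K)"
    "type_equiv \<Gamma> \<phi> \<A> (v + {#{}#}) (superlevels (cover_count v) ?K)"
    using assms by (intro type_equiv_superlevels; simp)+
  ultimately show ?thesis using type_equiv.trans[OF _ type_equiv.sym, of \<Gamma> \<phi> \<A> "u + {#{}#}"] by simp
qed

lemma type_equiv_add_empty:
  assumes "set_mset u \<subseteq> \<A>" "u \<noteq> {#}"
  shows "type_equiv \<Gamma> \<phi> \<A> u (u + {#{}#})"
proof -
  obtain A w where u: "u = add_mset A w" using assms(2) by (meson multiset_cases)
  have "type_equiv \<Gamma> \<phi> \<A> {#A \<union> {}#} ({#A#} + {#{}#})"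
    using assms u by (intro type_equiv.disj) auto
  then have "type_equiv \<Gamma> \<phi> \<A> ({#A#} + w) (({#A#} + {#{}#}) + w)"
    using assms u by (intro type_equiv.add type_equiv.refl) auto
  then show ?thesis by (simp add: u add_mset_commute)
qed

lemma superlevels_members:
  "(\<And>t. {x \<in> X. t \<le> a x} \<in> \<A>) \<Longrightarrow> set_mset (superlevels a K) \<subseteq> \<A>"
  unfolding superlevels_def by (rule set_mset_sum_subset) auto

lemma cover_count_superlevels:
  assumes "x \<in> X" "a x \<le> K"
  shows "cover_count (superlevels a K) x = a x"
proof -
  have "cover_count (superlevels a K) x = (\<Sum>t\<in>{1..K}. of_bool (t \<le> a x))"
    unfolding superlevels_def using assms by (simp add: cover_count_sum)
  also have "\<dots> = (\<Sum>t\<in>{1..K} \<inter> {t. t \<le> a x}. 1)"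
    by simp
  also have "{1..K} \<inter> {t. t \<le> a x} = {1..a x}" using assms by auto
  finally show ?thesis by simp
qed

text \<open>
  Each level set of each \<open>z \<gamma>\<close> may be translated by \<open>\<gamma>\<close>; before the translation the levels have
  multiplicity function \<open>outflow F z\<close>, after it \<open>inflow \<Gamma> \<phi> F z\<close>.
\<close>

lemma type_equiv_of_flow:
  assumes "finite F" "F \<subseteq> carrier \<Gamma>"
    and z: "\<And>\<gamma> t. \<gamma> \<in> F \<Longrightarrow> {x \<in> X. t \<le> z \<gamma> x} \<in> \<A>" "\<And>\<gamma> x. \<gamma> \<in> F \<Longrightarrow> x \<in> X \<Longrightarrow> z \<gamma> x \<le> K"
    and u: "set_mset u \<subseteq> \<A>" "\<And>x. x \<in> X \<Longrightarrow> cover_count u x = outflow F z x"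
    and v: "set_mset v \<subseteq> \<A>" "\<And>x. x \<in> X \<Longrightarrow> cover_count v x = inflow \<Gamma> \<phi> F z x"
  shows "type_equiv \<Gamma> \<phi> \<A> (u + {#{}#}) (v + {#{}#})"
proof -
  interpret group \<Gamma> by (rule group_acting)
  define u' where "u' = (\<Sum>\<gamma>\<in>F. superlevels (z \<gamma>) K)"
  define v' where "v' = (\<Sum>\<gamma>\<in>F. \<Sum>t\<in>{1..K}. {#\<phi> \<gamma> ` {x \<in> X. t \<le> z \<gamma> x}#})"
  have "set_mset u' \<subseteq> \<A>" unfolding u'_def
    using assms by (intro set_mset_sum_subset superlevels_members) auto
  moreover have "cover_count u' x = outflow F z x" if "x \<in> X" for x
    unfolding u'_def outflow_def cover_count_sum[OF assms(1)]
    using that z by (intro sum.cong cover_count_superlevels) auto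
  ultimately have 1: "type_equiv \<Gamma> \<phi> \<A> (u + {#{}#}) (u' + {#{}#})"
    using u by (intro type_equiv_of_cover_count_eq) auto
  have 2: "type_equiv \<Gamma> \<phi> \<A> (u' + {#{}#}) (v' + {#{}#})"
    unfolding u'_def v'_def superlevels_def
    using assms by (intro type_equiv.add type_equiv_sum type_equiv.act type_equiv.refl) auto
  have "set_mset v' \<subseteq> \<A>" unfolding v'_def
    using assms invariant by (intro set_mset_sum_subset) auto
  moreover have "cover_count v' y = inflow \<Gamma> \<phi> F z y" if y: "y \<in> X" for y
  proof -
    have "(\<Sum>t\<in>{1..K}. cover_count {#\<phi> \<gamma> ` {x \<in> X. t \<le> z \<gamma> x}#} y) = z \<gamma> (\<phi> (inv \<gamma>) y)"
      if g: "\<gamma> \<in> F" for \<gamma>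
    proof -
      have gc: "\<gamma> \<in> carrier \<Gamma>" and iy: "\<phi> (inv \<gamma>) y \<in> X"
        using g assms y by (auto intro!: act_closed)
      have "y \<in> \<phi> \<gamma> ` {x \<in> X. t \<le> z \<gamma> x} \<longleftrightarrow> t \<le> z \<gamma> (\<phi> (inv \<gamma>) y)" for t
        using act_image_iff[OF gc _ y, of "{x \<in> X. t \<le> z \<gamma> x}"] iy by auto
      then have "(\<Sum>t\<in>{1..K}. cover_count {#\<phi> \<gamma> ` {x \<in> X. t \<le> z \<gamma> x}#} y) =
          cover_count (superlevels (z \<gamma>) K) (\<phi> (inv \<gamma>) y)"
        unfolding superlevels_def using iy by (subst cover_count_sum) auto
      also have "\<dots> = z \<gamma> (\<phi> (inv \<gamma>) y)"
        using iy z g by (intro cover_count_superlevels) auto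
      finally show ?thesis .
    qed
    then show ?thesis
      unfolding v'_def inflow_def using assms(1) by (simp add: cover_count_sum)
  qed
  ultimately have "type_equiv \<Gamma> \<phi> \<A> (v' + {#{}#}) (v + {#{}#})"
    using v by (intro type_equiv_of_cover_count_eq) auto
  then show ?thesis by (rule type_equiv.trans[OF 1 type_equiv.trans[OF 2]])
qed

lemma type_class_in_carrier_iff:
  "\<alpha> \<in> carrier (type_semigroup \<Gamma> \<phi> \<A>) \<longleftrightarrow> (\<exists>u. set_mset u \<subseteq> \<A> \<and> \<alpha> = type_cong \<Gamma> \<phi> \<A> `` {u})"
  by (auto simp: type_semigroup_def quotient_def)

lemma type_class_eq_iff:
  assumes "set_mset u \<subseteq> \<A>" "set_mset v \<subseteq> \<A>"
  shows "type_cong \<Gamma> \<phi> \<A> `` {u} = type_cong \<Gamma> \<phi> \<A> `` {v} \<longleftrightarrow> type_equiv \<Gamma> \<phi> \<A> u v"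
  using eq_equiv_class_iff[OF equiv_type_cong, of u v] assms by (simp add: type_cong_def)

lemma type_class_pow:
  assumes "set_mset u \<subseteq> \<A>"
  shows "(type_cong \<Gamma> \<phi> \<A> `` {u}) [^]\<^bsub>type_semigroup \<Gamma> \<phi> \<A>\<^esub> (n :: nat) =
    type_cong \<Gamma> \<phi> \<A> `` {repeat_mset n u}"
proof (induction n)
  case 0
  interpret S: comm_monoid "type_semigroup \<Gamma> \<phi> \<A>" by (rule comm_monoid_type_semigroup)
  show ?case by (simp add: type_semigroup_def)
next
  case (Suc n)
  interpret S: comm_monoid "type_semigroup \<Gamma> \<phi> \<A>" by (rule comm_monoid_type_semigroup)
  have "set_mset (repeat_mset n u) \<subseteq> \<A>"
    using assms by (induction n) auto
  then show ?case
    using Suc assms by (simp add: type_semigroup_mult_class add.commute)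
qed

lemma monoid_le_type_class_iff:
  assumes "set_mset u \<subseteq> \<A>" "set_mset v \<subseteq> \<A>"
  shows "monoid_le (type_semigroup \<Gamma> \<phi> \<A>) (type_cong \<Gamma> \<phi> \<A> `` {u}) (type_cong \<Gamma> \<phi> \<A> `` {v})
    \<longleftrightarrow> (\<exists>w. set_mset w \<subseteq> \<A> \<and> type_equiv \<Gamma> \<phi> \<A> v (u + w))"
proof -
  have "(type_cong \<Gamma> \<phi> \<A> `` {v} = type_cong \<Gamma> \<phi> \<A> `` {u} \<otimes>\<^bsub>type_semigroup \<Gamma> \<phi> \<A>\<^esub> (type_cong \<Gamma> \<phi> \<A> `` {w}))
      \<longleftrightarrow> type_equiv \<Gamma> \<phi> \<A> v (u + w)" if "set_mset w \<subseteq> \<A>" for w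
    using that assms by (simp add: type_semigroup_mult_class type_class_eq_iff)
  then show ?thesis
    unfolding monoid_le_def type_class_in_carrier_iff Bex_def by metis
qed

end

section \<open>Measurable choices and bounded Borel graphs\<close>

text \<open>
  A choice depending on a point is measurable if it takes the first admissible member of a finite list
  and admissibility is measurable (\<open>measurable_first_that\<close>).
\<close>

fun first_that :: "('i \<Rightarrow> bool) \<Rightarrow> ('i \<Rightarrow> 'r) \<Rightarrow> 'r \<Rightarrow> 'i list \<Rightarrow> 'r" where
  "first_that P f d [] = d"
| "first_that P f d (i # is) = (if P i then f i else first_that P f d is)"

lemma first_that_none: "(\<And>i. i \<in> set is \<Longrightarrow> \<not> P i) \<Longrightarrow> first_that P f d is = d"
  by (induction "is") auto

lemma first_that_some:
  "\<exists>i\<in>set is. P i \<Longrightarrow> \<exists>i\<in>set is. P i \<and> first_that P f d is = f i"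
  by (induction "is") auto

lemma first_that_cong:
  "(\<And>i. i \<in> set is \<Longrightarrow> P i \<longleftrightarrow> Q i) \<Longrightarrow> (\<And>i. i \<in> set is \<Longrightarrow> Q i \<Longrightarrow> f i = g i) \<Longrightarrow>
    first_that P f d is = first_that Q g d is"
  by (induction "is") auto

lemma first_that_apply: "h (first_that P f d is) = first_that P (\<lambda>i. h (f i)) (h d) is"
  by (induction "is") auto

lemma measurable_first_that:
  assumes "\<And>i. i \<in> set is \<Longrightarrow> {x \<in> space M. P x i} \<in> sets M"
    and "\<And>i. i \<in> set is \<Longrightarrow> (\<lambda>x. f x i) \<in> M \<rightarrow>\<^sub>M N" and "d \<in> M \<rightarrow>\<^sub>M N"
  shows "(\<lambda>x. first_that (P x) (f x) (d x) is) \<in> M \<rightarrow>\<^sub>M N"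
  using assms
proof (induction "is")
  case (Cons i "is")
  have "(\<lambda>x. first_that (P x) (f x) (d x) is) \<in> M \<rightarrow>\<^sub>M N"
    by (rule Cons.IH) (use Cons.prems in auto)
  then show ?case using Cons.prems by (auto intro!: measurable_If)
qed auto

lemma measurable_nat_op:
  fixes f g :: "'x \<Rightarrow> nat"
  assumes f: "f \<in> M \<rightarrow>\<^sub>M count_space UNIV" and g: "g \<in> M \<rightarrow>\<^sub>M count_space UNIV"
  shows "(\<lambda>x. h (f x) (g x)) \<in> M \<rightarrow>\<^sub>M count_space UNIV"
proof (rule measurable_compose_countable[OF _ f])
  fix i
  show "(\<lambda>x. h i (g x)) \<in> M \<rightarrow>\<^sub>M count_space UNIV"
    by (rule measurable_compose[OF g]) simp
qed

lemma measurable_nat_sum: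
  fixes f :: "'i \<Rightarrow> 'x \<Rightarrow> nat"
  assumes "\<And>i. i \<in> I \<Longrightarrow> f i \<in> M \<rightarrow>\<^sub>M count_space UNIV"
  shows "(\<lambda>x. \<Sum>i\<in>I. f i x) \<in> M \<rightarrow>\<^sub>M count_space UNIV"
proof (cases "finite I")
  case True
  then show ?thesis using assms
    by (induction I rule: finite_induct) (auto intro: measurable_nat_op[where h = "(+)"])
qed simp

lemma measurable_nat_rel:
  fixes f g :: "'x \<Rightarrow> nat"
  assumes "f \<in> M \<rightarrow>\<^sub>M count_space UNIV" "g \<in> M \<rightarrow>\<^sub>M count_space UNIV"
  shows "{x \<in> space M. h (f x) (g x)} \<in> sets M"
  using measurable_nat_op[OF assms, of h] by (simp add: pred_def)

lemma measurable_nat_restrict: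
  fixes f :: "'x \<Rightarrow> nat"
  assumes "f \<in> M \<rightarrow>\<^sub>M count_space UNIV" "A \<in> sets M"
  shows "(\<lambda>x. if x \<in> A then f x else 0) \<in> M \<rightarrow>\<^sub>M count_space UNIV"
  using assms by (intro measurable_If_set) auto

primrec words :: "('g, 'b) monoid_scheme \<Rightarrow> 'g set \<Rightarrow> nat \<Rightarrow> 'g set" where
  "words \<Gamma> D 0 = {\<one>\<^bsub>\<Gamma>\<^esub>}"
| "words \<Gamma> D (Suc j) = D <#>\<^bsub>\<Gamma>\<^esub> words \<Gamma> D j"

definition adjacency :: "('g \<Rightarrow> 'x \<Rightarrow> 'x) \<Rightarrow> 'g set \<Rightarrow> 'x set \<Rightarrow> ('x \<times> 'x) set" where
  "adjacency \<phi> D V = {(p, q). p \<in> V \<and> q \<in> V \<and> (\<exists>d\<in>D. q = \<phi> d p)}"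

locale borel_system =
  fixes \<Gamma> :: "('g, 'b) monoid_scheme" (structure)
    and M :: "'x measure" and \<phi> :: "'g \<Rightarrow> 'x \<Rightarrow> 'x"
  assumes standard: "standard_borel M" and borel: "borel_action \<Gamma> M \<phi>"

sublocale borel_system \<subseteq> invariant_algebra \<Gamma> "space M" \<phi> "sets M"
  by (rule invariant_algebra_borel[OF borel])

sublocale borel_system \<subseteq> group \<Gamma>
  by (rule group_acting)

context borel_system
begin

abbreviation (input) "X \<equiv> space M"

definition symmetric_nhd :: "'g set \<Rightarrow> bool" where
  "symmetric_nhd D \<longleftrightarrow> finite D \<and> D \<subseteq> carrier \<Gamma> \<and> \<one> \<in> D \<and> (\<forall>d\<in>D. inv d \<in> D)"

text \<open>
  Two sources with a common target under \<open>E\<close> differ by an element of \<open>quotients E\<close>. The unit is added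
  so that the adjacency relation is reflexive even for empty \<open>E\<close>; then balls of increasing radius are
  increasing sets.
\<close>

definition quotients :: "'g set \<Rightarrow> 'g set" where
  "quotients E = insert \<one> ((\<lambda>(\<gamma>, \<delta>). inv \<gamma> \<otimes> \<delta>) ` (E \<times> E))"

lemma symmetric_nhd_quotients:
  assumes "finite E" "E \<subseteq> carrier \<Gamma>"
  shows "symmetric_nhd (quotients E)"
proof -
  have "inv (inv \<gamma> \<otimes> \<delta>) = inv \<delta> \<otimes> \<gamma>" if "\<gamma> \<in> E" "\<delta> \<in> E" for \<gamma> \<delta>
    using that assms by (simp add: inv_mult_group subset_iff)
  then show ?thesis
    unfolding symmetric_nhd_def quotients_def using assms by (auto simp: subset_iff)
qed

lemma words_carrier: "D \<subseteq> carrier \<Gamma> \<Longrightarrow> words \<Gamma> D j \<subseteq> carrier \<Gamma>"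
  by (induction j) (auto intro: set_mult_carrier[THEN subsetD])

lemma finite_words: "finite D \<Longrightarrow> finite (words \<Gamma> D j)"
  by (induction j) (auto simp: finite_set_mult)

lemma translates_one: "Y \<subseteq> X \<Longrightarrow> translates \<phi> {\<one>} Y = Y"
  using act_one by (force simp: translates_def subset_iff)

lemma act_measurable [measurable]: "g \<in> carrier \<Gamma> \<Longrightarrow> \<phi> g \<in> M \<rightarrow>\<^sub>M M"
  using borel by (simp add: borel_action_def)

lemma act_preimage: "g \<in> carrier \<Gamma> \<Longrightarrow> A \<in> sets M \<Longrightarrow> {x \<in> X. \<phi> g x \<in> A} \<in> sets M"
  using measurable_sets[OF act_measurable] by (simp add: vimage_def Int_def conj_commute)

lemma act_compose:
  "g \<in> carrier \<Gamma> \<Longrightarrow> f \<in> M \<rightarrow>\<^sub>M N \<Longrightarrow> (\<lambda>x. f (\<phi> g x)) \<in> M \<rightarrow>\<^sub>M N"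
  by (rule measurable_compose[OF act_measurable])

lemma translates_sets:
  "finite D \<Longrightarrow> D \<subseteq> carrier \<Gamma> \<Longrightarrow> A \<in> sets M \<Longrightarrow> translates \<phi> D A \<in> sets M"
  unfolding translates_def using invariant by (intro sets.finite_UN) auto

lemma outflow_measurable:
  "(\<And>\<gamma>. \<gamma> \<in> E \<Longrightarrow> z \<gamma> \<in> M \<rightarrow>\<^sub>M count_space UNIV) \<Longrightarrow> outflow E z \<in> M \<rightarrow>\<^sub>M count_space UNIV"
  unfolding outflow_def by (rule measurable_nat_sum)

lemma inflow_measurable:
  "E \<subseteq> carrier \<Gamma> \<Longrightarrow> (\<And>\<gamma>. \<gamma> \<in> E \<Longrightarrow> z \<gamma> \<in> M \<rightarrow>\<^sub>M count_space UNIV) \<Longrightarrow>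
    inflow \<Gamma> \<phi> E z \<in> M \<rightarrow>\<^sub>M count_space UNIV"
  unfolding inflow_def by (intro measurable_nat_sum act_compose) auto

text \<open>
  The only place where the topology of a standard Borel space is used: a countable base separates a
  point from a finite set.
\<close>

lemma separating_sequence:
  obtains W :: "nat \<Rightarrow> 'x set" where "\<And>n. W n \<in> sets M"
    "\<And>x Z. x \<in> X \<Longrightarrow> finite Z \<Longrightarrow> Z \<subseteq> X \<Longrightarrow> x \<notin> Z \<Longrightarrow> \<exists>n. x \<in> W n \<and> W n \<inter> Z = {}"
proof -
  obtain T where T: "completely_metrizable_space T" "second_countable T" "topspace T = X"
    "sets M = sigma_sets X {U. openin T U}"
    using standard unfolding standard_borel_def by auto
  have t1: "t1_space T"
    using T(1) by (simp add: completely_metrizable_imp_metrizable_space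
        metrizable_imp_Hausdorff_space Hausdorff_imp_t1_space)
  obtain B where B: "countable B" "\<And>V. V \<in> B \<Longrightarrow> openin T V"
    "\<And>U x. openin T U \<Longrightarrow> x \<in> U \<Longrightarrow> \<exists>V\<in>B. x \<in> V \<and> V \<subseteq> U"
    using T(2) unfolding second_countable_def by metis
  let ?B = "insert {} B"
  have BM: "V \<in> sets M" if "V \<in> ?B" for V
    using that B(2) T(4) by (auto intro: sigma_sets.Basic)
  show thesis
  proof (rule that[of "from_nat_into ?B"])
    fix n show "from_nat_into ?B n \<in> sets M"
      by (intro BM from_nat_into) simp
  next
    fix x Z assume xZ: "x \<in> X" "finite Z" "Z \<subseteq> X" "x \<notin> Z"
    then have "closedin T Z"
      using t1 T(3) by (simp add: t1_space_closedin_finite)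
    then have "openin T (X - Z)" using T(3) by (metis closedin_def)
    then obtain V where V: "V \<in> B" "x \<in> V" "V \<subseteq> X - Z" using B(3) xZ by blast
    then obtain n where "from_nat_into ?B n = V"
      using B(1) from_nat_into_surj[of ?B V] by auto
    with V show "\<exists>n. x \<in> from_nat_into ?B n \<and> from_nat_into ?B n \<inter> Z = {}" by blast
  qed
qed

lemma act_eq_measurable:
  assumes "g \<in> carrier \<Gamma>" "h \<in> carrier \<Gamma>"
  shows "{x \<in> X. \<phi> g x = \<phi> h x} \<in> sets M"
proof -
  obtain W :: "nat \<Rightarrow> 'x set" where W: "\<And>n. W n \<in> sets M"
    "\<And>x Z. x \<in> X \<Longrightarrow> finite Z \<Longrightarrow> Z \<subseteq> X \<Longrightarrow> x \<notin> Z \<Longrightarrow> \<exists>n. x \<in> W n \<and> W n \<inter> Z = {}"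
    using separating_sequence by blast
  have "\<exists>n. \<phi> g x \<in> W n \<and> \<phi> h x \<notin> W n" if "x \<in> X" "\<phi> g x \<noteq> \<phi> h x" for x
    using W(2)[of "\<phi> g x" "{\<phi> h x}"] that assms by (auto simp: act_closed)
  then have "{x \<in> X. \<phi> g x = \<phi> h x} =
      X - (\<Union>n. {x \<in> X. \<phi> g x \<in> W n} - {x \<in> X. \<phi> h x \<in> W n})"
    by auto
  also have "\<dots> \<in> sets M"
    using W(1) assms by (intro sets.Diff sets.countable_UN) (auto intro!: act_preimage sets.Diff)
  finally show ?thesis .
qed

text \<open>
  The argument of Kechris, Solecki and Todorcevic. A separating sequence gives a cover of \<open>Y\<close> by countably
  many independent sets \<open>P j\<close>; adding them one after another, each time without the neighbours of the
  points already chosen, gives a maximal independent set.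
\<close>

lemma maximal_independent_set:
  assumes D: "finite D" "D \<subseteq> carrier \<Gamma>" and Y: "Y \<in> sets M"
    and r: "\<And>x y. x \<in> X \<Longrightarrow> y \<in> X \<Longrightarrow> r x y \<Longrightarrow> r y x" "\<And>x. x \<in> X \<Longrightarrow> \<not> r x x"
    "\<And>x y. x \<in> X \<Longrightarrow> r x y \<Longrightarrow> \<exists>d\<in>D. y = \<phi> d x"
    and rm: "\<And>d. d \<in> D \<Longrightarrow> {x \<in> X. r x (\<phi> d x)} \<in> sets M"
  shows "\<exists>I\<in>sets M. I \<subseteq> Y \<and> (\<forall>x\<in>I. \<forall>y\<in>I. \<not> r x y) \<and> (\<forall>x\<in>Y - I. \<exists>y\<in>I. r x y)"
proof -
  obtain W :: "nat \<Rightarrow> 'x set" where W: "\<And>n. W n \<in> sets M"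
    "\<And>x Z. x \<in> X \<Longrightarrow> finite Z \<Longrightarrow> Z \<subseteq> X \<Longrightarrow> x \<notin> Z \<Longrightarrow> \<exists>n. x \<in> W n \<and> W n \<inter> Z = {}"
    using separating_sequence by blast
  have YX: "Y \<subseteq> X" using Y sets.sets_into_space by auto
  define P where "P j = (Y \<inter> W j) - (\<Union>d\<in>D. {x \<in> X. r x (\<phi> d x)} \<inter> {x \<in> X. \<phi> d x \<in> W j})" for j
  have Pm: "P j \<in> sets M" for j
    unfolding P_def using Y W(1) D rm
    by (intro sets.Diff sets.finite_UN sets.Int act_preimage) auto
  have Pind: "\<not> r x y" if "x \<in> P j" "y \<in> P j" for x y j
  proof
    assume "r x y"
    moreover have "x \<in> X" using that YX by (auto simp: P_def)
    ultimately obtain d where "d \<in> D" "y = \<phi> d x" using r(3) by blast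
    then show False using that \<open>r x y\<close> \<open>x \<in> X\<close> by (auto simp: P_def)
  qed
  have Pcov: "\<exists>j. x \<in> P j" if x: "x \<in> Y" for x
  proof -
    let ?Z = "(\<lambda>d. \<phi> d x) ` {d \<in> D. r x (\<phi> d x)}"
    have xX: "x \<in> X" using x YX by auto
    have "?Z \<subseteq> X" using D xX by (auto intro: act_closed)
    moreover have "x \<notin> ?Z"
    proof
      assume "x \<in> ?Z"
      then obtain d where "d \<in> D" "r x (\<phi> d x)" "x = \<phi> d x" by blast
      then show False using r(2)[OF xX] by simp
    qed
    ultimately obtain j where "x \<in> W j" "W j \<inter> ?Z = {}" using W(2)[OF xX, of ?Z] D by auto
    then have "x \<in> P j" using x by (auto simp: P_def)
    then show ?thesis ..
  qed
  define J where "J = rec_nat {} (\<lambda>j S. S \<union> (P j - (\<Union>d\<in>D. {x \<in> X. r x (\<phi> d x)} \<inter> {x \<in> X. \<phi> d x \<in> S})))"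
  have J0: "J 0 = {}" and JS: "J (Suc j) = J j \<union> (P j - (\<Union>d\<in>D. {x \<in> X. r x (\<phi> d x)} \<inter> {x \<in> X. \<phi> d x \<in> J j}))" for j
    by (simp_all add: J_def)
  have Jm: "J j \<in> sets M" for j
    by (induction j) (use D Pm rm in \<open>auto simp: J0 JS intro!: sets.Un sets.Diff sets.finite_UN sets.Int act_preimage\<close>)
  have JY: "J j \<subseteq> Y" for j
    by (induction j) (auto simp: J0 JS P_def)
  have new: "\<not> r x y" if "x \<in> J (Suc j) - J j" "y \<in> J j" for x y j
  proof
    assume rxy: "r x y"
    have xX: "x \<in> X" using that JY YX by blast
    obtain d where "d \<in> D" "y = \<phi> d x" using r(3)[OF xX rxy] by blast
    then show False using that rxy xX by (auto simp: JS)
  qed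
  have Jind: "\<forall>x\<in>J j. \<forall>y\<in>J j. \<not> r x y" for j
  proof (induction j)
    case (Suc j)
    show ?case
    proof (intro ballI)
      fix x y assume xy: "x \<in> J (Suc j)" "y \<in> J (Suc j)"
      then have X: "x \<in> X" "y \<in> X" using JY YX by blast+
      consider "x \<in> J j" "y \<in> J j" | "x \<in> J j" "y \<in> J (Suc j) - J j" | "x \<in> J (Suc j) - J j" "y \<in> J j"
        | "x \<in> J (Suc j) - J j" "y \<in> J (Suc j) - J j" using xy by blast
      then show "\<not> r x y"
      proof cases
        case 1 then show ?thesis using Suc by blast
      next
        case 2 then show ?thesis using new r(1) X by blast
      next
        case 3 then show ?thesis using new by blast
      next
        case 4 then have "x \<in> P j" "y \<in> P j" by (auto simp: JS)
        then show ?thesis by (rule Pind)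
      qed
    qed
  qed (simp add: J0)
  have Jmono: "J i \<subseteq> J j" if "i \<le> j" for i j
    using that by (induction rule: dec_induct) (auto simp: JS)
  define I where "I = (\<Union>j. J j)"
  have "I \<in> sets M" unfolding I_def using Jm by (intro sets.countable_UN) auto
  moreover have "I \<subseteq> Y" unfolding I_def using JY by auto
  moreover have ind: "\<forall>x\<in>I. \<forall>y\<in>I. \<not> r x y"
  proof (intro ballI)
    fix x y assume that: "x \<in> I" "y \<in> I"
    from that obtain i j where "x \<in> J i" "y \<in> J j" unfolding I_def by auto
    then have "x \<in> J (max i j)" "y \<in> J (max i j)" using Jmono[of i "max i j"] Jmono[of j "max i j"] by auto
    then show "\<not> r x y" using Jind by blast
  qed
  moreover have "\<forall>x\<in>Y - I. \<exists>y\<in>I. r x y"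
  proof
    fix x assume x: "x \<in> Y - I"
    obtain j where "x \<in> P j" using x Pcov[of x] by blast
    moreover have "x \<notin> J (Suc j)" using x by (auto simp: I_def)
    ultimately obtain d where "d \<in> D" "r x (\<phi> d x)" "\<phi> d x \<in> J j" by (auto simp: JS)
    then show "\<exists>y\<in>I. r x y" unfolding I_def by blast
  qed
  ultimately show ?thesis by (intro bexI[of _ I] conjI)
qed

text \<open>
  Maximal independent sets are removed until nothing is left; the degree bound \<open>card D\<close> stops this
  after finitely many rounds.
\<close>

lemma finite_coloring:
  assumes D: "finite D" "D \<subseteq> carrier \<Gamma>" and Dinv: "\<And>d. d \<in> D \<Longrightarrow> inv d \<in> D"
  shows "\<exists>Ys. (\<forall>Y\<in>set Ys. Y \<in> sets M \<and> (\<forall>x\<in>Y. \<forall>d\<in>D. \<phi> d x \<noteq> x \<longrightarrow> \<phi> d x \<notin> Y)) \<and> X = \<Union>(set Ys)"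
proof -
  define r where "r x y \<longleftrightarrow> x \<noteq> y \<and> (\<exists>d\<in>D. y = \<phi> d x)" for x y
  have rm: "{x \<in> X. r x (\<phi> d x)} \<in> sets M" if "d \<in> D" for d
  proof -
    have "{x \<in> X. r x (\<phi> d x)} = X - {x \<in> X. \<phi> d x = \<phi> \<one> x}"
      using that by (auto simp: r_def act_one)
    then show ?thesis using that D by (auto intro!: sets.Diff act_eq_measurable)
  qed
  have rsym: "r y x" if x: "x \<in> X" and "y \<in> X" and r: "r x y" for x y
  proof -
    obtain d where "d \<in> D" "y = \<phi> d x" "x \<noteq> y" using r unfolding r_def by blast
    then have "x = \<phi> (inv d) y" using x D by (simp add: act_inv_act subset_iff)
    then show ?thesis using \<open>d \<in> D\<close> \<open>x \<noteq> y\<close> Dinv by (auto simp: r_def)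
  qed
  have mis: "\<exists>I\<in>sets M. I \<subseteq> Y \<and> (\<forall>x\<in>I. \<forall>y\<in>I. \<not> r x y) \<and> (\<forall>x\<in>Y - I. \<exists>y\<in>I. r x y)"
    if "Y \<in> sets M" for Y
  proof (rule maximal_independent_set[where r = r, OF D that])
    show "\<And>x y. x \<in> X \<Longrightarrow> r x y \<Longrightarrow> \<exists>d\<in>D. y = \<phi> d x" "\<And>x. x \<in> X \<Longrightarrow> \<not> r x x"
      by (auto simp: r_def)
  qed (rule rsym rm; assumption)+
  \<comment> \<open>After \<open>t\<close> rounds every point left over has a neighbour in each of the \<open>t\<close> disjoint sets chosen.\<close>
  have "\<exists>Ys R. R \<in> sets M \<and> (\<forall>Y\<in>set Ys. Y \<in> sets M \<and> (\<forall>x\<in>Y. \<forall>y\<in>Y. \<not> r x y)) \<and> X = R \<union> \<Union>(set Ys)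
      \<and> (\<forall>x\<in>R. t \<le> card {y \<in> X - R. r x y})" for t
  proof (induction t)
    case 0
    show ?case by (intro exI[of _ "[]"] exI[of _ X]) auto
  next
    case (Suc t)
    then obtain Ys R where R: "R \<in> sets M" "\<forall>Y\<in>set Ys. Y \<in> sets M \<and> (\<forall>x\<in>Y. \<forall>y\<in>Y. \<not> r x y)"
      "X = R \<union> \<Union>(set Ys)" "\<forall>x\<in>R. t \<le> card {y \<in> X - R. r x y}" by blast
    obtain I where I: "I \<in> sets M" "I \<subseteq> R" "\<forall>x\<in>I. \<forall>y\<in>I. \<not> r x y" "\<forall>x\<in>R - I. \<exists>y\<in>I. r x y"
      using mis[OF R(1)] by blast
    have "Suc t \<le> card {y \<in> X - (R - I). r x y}" if x: "x \<in> R - I" for x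
    proof -
      obtain y where y: "y \<in> I" "r x y" using I(4) x by blast
      have fin: "finite {y \<in> X - (R - I). r x y}"
        by (rule finite_subset[of _ "(\<lambda>d. \<phi> d x) ` D"]) (use D in \<open>auto simp: r_def\<close>)
      have "Suc t \<le> Suc (card {y \<in> X - R. r x y})" using R(4) x by auto
      also have "\<dots> = card (insert y {y \<in> X - R. r x y})"
        using y I(2) fin by (subst card_insert_disjoint) (auto intro: finite_subset[OF _ fin])
      also have "\<dots> \<le> card {y \<in> X - (R - I). r x y}"
        using y I(2) R(3) fin by (intro card_mono) auto
      finally show ?thesis .
    qed
    then show ?case using R I by (intro exI[of _ "I # Ys"] exI[of _ "R - I"]) auto
  qed
  from this[of "Suc (card D)"] obtain Ys R where R: "R \<in> sets M"
    "\<forall>Y\<in>set Ys. Y \<in> sets M \<and> (\<forall>x\<in>Y. \<forall>y\<in>Y. \<not> r x y)"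
    "X = R \<union> \<Union>(set Ys)" "\<forall>x\<in>R. Suc (card D) \<le> card {y \<in> X - R. r x y}" by blast
  have "card {y \<in> X - R. r x y} \<le> card D" for x
  proof -
    have "card {y \<in> X - R. r x y} \<le> card ((\<lambda>d. \<phi> d x) ` D)"
      using D by (intro card_mono) (auto simp: r_def)
    also have "\<dots> \<le> card D" using D by (intro card_image_le) auto
    finally show ?thesis .
  qed
  then have "R = {}" using R(4) by (meson all_not_in_conv not_less_eq_eq)
  then have "X = \<Union>(set Ys)" using R(3) by simp
  moreover have "\<phi> d x \<notin> Y" if "Y \<in> set Ys" "x \<in> Y" "d \<in> D" "\<phi> d x \<noteq> x" for Y x d
    using R(2) that unfolding r_def by metis
  ultimately show ?thesis using R(2) by blast
qed

lemma adjacency_sym: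
  assumes "symmetric_nhd D" "V \<subseteq> X" shows "(p, q) \<in> adjacency \<phi> D V \<Longrightarrow> (q, p) \<in> adjacency \<phi> D V"
  using assms unfolding adjacency_def symmetric_nhd_def by (auto simp: subset_iff) (metis act_inv_act)

lemma adjacency_refl:
  "symmetric_nhd D \<Longrightarrow> V \<subseteq> X \<Longrightarrow> p \<in> V \<Longrightarrow> (p, p) \<in> adjacency \<phi> D V"
  unfolding adjacency_def symmetric_nhd_def using act_one by force

lemma relpow_sym: "(\<And>p q. (p, q) \<in> R \<Longrightarrow> (q, p) \<in> R) \<Longrightarrow> (x, y) \<in> R ^^ j \<Longrightarrow> (y, x) \<in> R ^^ j"
  for R :: "('y \<times> 'y) set"
proof (induction j arbitrary: y)
  case (Suc j)
  then show ?case by (metis relpow_Suc_E relpow_Suc_I2)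
qed auto

lemma adjacency_relpow_in: "(x, y) \<in> adjacency \<phi> D V ^^ j \<Longrightarrow> x \<in> V \<Longrightarrow> y \<in> V"
  by (cases j) (auto simp: adjacency_def relcomp_unfold)

lemma adjacency_relpow_words:
  assumes "D \<subseteq> carrier \<Gamma>" "V \<subseteq> X" "(x, y) \<in> adjacency \<phi> D V ^^ j" "x \<in> V"
  shows "\<exists>g\<in>words \<Gamma> D j. y = \<phi> g x"
  using assms(3)
proof (induction j arbitrary: y)
  case 0
  then show ?case using assms act_one by auto
next
  case (Suc j)
  then obtain p where "(x, p) \<in> adjacency \<phi> D V ^^ j" "(p, y) \<in> adjacency \<phi> D V" by auto
  then obtain d where "d \<in> D" "y = \<phi> d p" by (auto simp: adjacency_def)
  moreover obtain g where "g \<in> words \<Gamma> D j" "p = \<phi> g x"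
    using Suc.IH[OF \<open>(x, p) \<in> adjacency \<phi> D V ^^ j\<close>] by blast
  ultimately have "y = \<phi> (d \<otimes> g) x"
    using assms words_carrier[OF assms(1), of j] by (simp add: composition_rule subset_iff)
  then show ?case using \<open>g \<in> words \<Gamma> D j\<close> \<open>d \<in> D\<close> by (auto simp: set_mult_def)
qed

lemma adjacency_relpow_mono:
  assumes "symmetric_nhd D" "V \<subseteq> X" "x \<in> V" "i \<le> j" "(x, y) \<in> adjacency \<phi> D V ^^ i"
  shows "(x, y) \<in> adjacency \<phi> D V ^^ j"
  using assms(4,5)
proof (induction rule: dec_induct)
  case (step k)
  then have "(x, y) \<in> adjacency \<phi> D V ^^ k" by simp
  moreover from this have "y \<in> V" using adjacency_relpow_in assms by blast
  ultimately show ?case using adjacency_refl assms by (meson relpow_Suc_I)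
qed

lemma adjacency_relpow_measurable:
  assumes "D \<subseteq> carrier \<Gamma>" "finite D" "V \<in> sets M" "g \<in> carrier \<Gamma>"
  shows "{x \<in> X. (x, \<phi> g x) \<in> adjacency \<phi> D V ^^ j} \<in> sets M"
  using assms(4)
proof (induction j arbitrary: g)
  case 0
  have "{x \<in> X. (x, \<phi> g x) \<in> adjacency \<phi> D V ^^ 0} = {x \<in> X. \<phi> \<one> x = \<phi> g x}"
    by (auto simp: act_one)
  then show ?case using 0 act_eq_measurable by simp
next
  case (Suc j)
  have eq: "{x \<in> X. (x, \<phi> g x) \<in> adjacency \<phi> D V ^^ Suc j} =
     (\<Union>d\<in>D. {x \<in> X. (x, \<phi> (inv d \<otimes> g) x) \<in> adjacency \<phi> D V ^^ j} \<inter>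
        ({x \<in> X. \<phi> (inv d \<otimes> g) x \<in> V} \<inter> {x \<in> X. \<phi> g x \<in> V}))" (is "?L = ?R")
  proof (intro equalityI subsetI)
    fix x assume "x \<in> ?L"
    then obtain p where x: "x \<in> X" and p: "(x, p) \<in> adjacency \<phi> D V ^^ j" "(p, \<phi> g x) \<in> adjacency \<phi> D V"
      by auto
    then obtain d where d: "d \<in> D" "\<phi> g x = \<phi> d p" "p \<in> V" "\<phi> g x \<in> V" by (auto simp: adjacency_def)
    have "d \<in> carrier \<Gamma>" "p \<in> X" using d assms sets.sets_into_space by auto
    then have "p = \<phi> (inv d) (\<phi> g x)" using d act_inv_act by simp
    also have "\<dots> = \<phi> (inv d \<otimes> g) x" using x Suc.prems \<open>d \<in> carrier \<Gamma>\<close> composition_rule by simp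
    finally show "x \<in> ?R" using x p d by auto
  next
    fix x assume "x \<in> ?R"
    then obtain d where d: "d \<in> D" and x: "x \<in> X" "(x, \<phi> (inv d \<otimes> g) x) \<in> adjacency \<phi> D V ^^ j"
      "\<phi> (inv d \<otimes> g) x \<in> V" "\<phi> g x \<in> V" by auto
    have dc: "d \<in> carrier \<Gamma>" using d assms by auto
    have "\<phi> d (\<phi> (inv d \<otimes> g) x) = \<phi> g x"
      using dc x Suc.prems by (simp add: composition_rule act_act_inv act_closed)
    then have "(\<phi> (inv d \<otimes> g) x, \<phi> g x) \<in> adjacency \<phi> D V"
      using x d by (auto simp: adjacency_def intro: bexI[of _ d])
    then show "x \<in> ?L" using x by auto
  qed
  show ?case unfolding eq
  proof (intro sets.finite_UN sets.Int)
    fix d assume "d \<in> D"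
    then have c: "inv d \<otimes> g \<in> carrier \<Gamma>" using assms Suc.prems by auto
    show "{x \<in> X. (x, \<phi> (inv d \<otimes> g) x) \<in> adjacency \<phi> D V ^^ j} \<in> sets M"
      by (rule Suc.IH[OF c])
    show "{x \<in> X. \<phi> (inv d \<otimes> g) x \<in> V} \<in> sets M" by (rule act_preimage[OF c assms(3)])
    show "{x \<in> X. \<phi> g x \<in> V} \<in> sets M" by (rule act_preimage[OF Suc.prems assms(3)])
  qed (rule assms)
qed

end

section \<open>Alternating paths\<close>

definition increment :: "('g \<Rightarrow> 'x \<Rightarrow> nat) \<Rightarrow> 'g \<Rightarrow> 'x \<Rightarrow> 'g \<Rightarrow> 'x \<Rightarrow> nat" where
  "increment w \<gamma> p = (\<lambda>\<delta> q. w \<delta> q + of_bool (\<delta> = \<gamma> \<and> q = p))"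

lemma decrement_exists:
  assumes "0 < w \<gamma> p"
  obtains v where "increment v \<gamma> p = w" "\<And>\<delta> q. q \<noteq> p \<Longrightarrow> v \<delta> q = w \<delta> q"
proof (rule that[of "\<lambda>\<delta> q. w \<delta> q - of_bool (\<delta> = \<gamma> \<and> q = p)"])
  show "increment (\<lambda>\<delta> q. w \<delta> q - of_bool (\<delta> = \<gamma> \<and> q = p)) \<gamma> p = w"
    using assms by (intro ext) (auto simp: increment_def)
qed auto

lemma outflow_increment:
  "finite E \<Longrightarrow> \<gamma> \<in> E \<Longrightarrow> outflow E (increment w \<gamma> p) q = outflow E w q + of_bool (q = p)"
  by (simp add: outflow_def increment_def sum.distrib of_bool_def sum.delta)

text \<open>
  The sources reached from \<open>x\<close> in at most \<open>j\<close> steps, a step going forward from a source to any of its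
  possible targets and back along a label that carries flow.
\<close>

primrec alternating :: "('g \<Rightarrow> 'x \<Rightarrow> 'x) \<Rightarrow> 'x set \<Rightarrow> 'g set \<Rightarrow> ('g \<Rightarrow> 'x \<Rightarrow> nat) \<Rightarrow> 'x \<Rightarrow> nat \<Rightarrow> 'x set" where
  "alternating \<phi> X E w x 0 = {x}"
| "alternating \<phi> X E w x (Suc j) = alternating \<phi> X E w x j \<union>
     {p \<in> X. \<exists>\<gamma>\<in>E. 0 < w \<gamma> p \<and> (\<exists>q\<in>alternating \<phi> X E w x j. \<exists>\<delta>\<in>E. \<phi> \<gamma> p = \<phi> \<delta> q)}"

context borel_system
begin

definition subflow :: "'g set \<Rightarrow> ('x \<Rightarrow> nat) \<Rightarrow> ('x \<Rightarrow> nat) \<Rightarrow> ('g \<Rightarrow> 'x \<Rightarrow> nat) \<Rightarrow> bool" where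
  "subflow E a b w \<longleftrightarrow> (\<forall>x\<in>X. outflow E w x \<le> a x) \<and> (\<forall>y\<in>X. inflow \<Gamma> \<phi> E w y \<le> b y)"

definition improvable ::
    "'g set \<Rightarrow> ('x \<Rightarrow> nat) \<Rightarrow> ('x \<Rightarrow> nat) \<Rightarrow> 'x set \<Rightarrow> ('g \<Rightarrow> 'x \<Rightarrow> nat) \<Rightarrow> 'x \<Rightarrow> bool" where
  "improvable E a b N w x \<longleftrightarrow> (\<exists>w'. subflow E a b w' \<and>
     (\<forall>p\<in>X. p \<notin> N \<longrightarrow> (\<forall>\<gamma>\<in>E. w' \<gamma> p = w \<gamma> p)) \<and>
     (\<forall>p\<in>X. outflow E w p \<le> outflow E w' p) \<and> outflow E w x < outflow E w' x)"

lemma improvable_mono: "improvable E a b N w x \<Longrightarrow> N \<subseteq> N' \<Longrightarrow> improvable E a b N' w x"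
  unfolding improvable_def by (meson subsetD)

lemma inflow_increment:
  assumes "finite E" "E \<subseteq> carrier \<Gamma>" "\<gamma> \<in> E" "p \<in> X" "y \<in> X"
  shows "inflow \<Gamma> \<phi> E (increment w \<gamma> p) y = inflow \<Gamma> \<phi> E w y + of_bool (y = \<phi> \<gamma> p)"
proof -
  have "\<phi> (inv \<gamma>) y = p \<longleftrightarrow> y = \<phi> \<gamma> p"
    using assms act_eq_iff[of \<gamma> p y] by auto
  then have "(\<Sum>\<delta>\<in>E. of_bool (\<delta> = \<gamma> \<and> \<phi> (inv \<delta>) y = p)) = (\<Sum>\<delta>\<in>E. if \<delta> = \<gamma> then of_bool (y = \<phi> \<gamma> p) else (0::nat))"
    by (intro sum.cong) auto
  also have "\<dots> = of_bool (y = \<phi> \<gamma> p)" using assms by (simp add: sum.delta)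
  finally show ?thesis by (simp add: inflow_def increment_def sum.distrib)
qed

lemma alternating_in_space: "x \<in> X \<Longrightarrow> alternating \<phi> X E w x j \<subseteq> X"
  by (induction j) auto

lemma alternating_mono: "i \<le> j \<Longrightarrow> alternating \<phi> X E w x i \<subseteq> alternating \<phi> X E w x j"
  by (induction rule: dec_induct) auto

lemma alternating_adjacency:
  assumes E: "finite E" "E \<subseteq> carrier \<Gamma>" and w: "subflow E a b w" and x: "x \<in> X" "0 < a x"
    and p: "p \<in> alternating \<phi> X E w x j"
  shows "(x, p) \<in> adjacency \<phi> (quotients E) {q \<in> X. 0 < a q} ^^ j"
  using p
proof (induction j arbitrary: p)
  case 0
  then show ?case by simp
next
  case (Suc j)
  let ?V = "{q \<in> X. 0 < a q}"
  note nhd = symmetric_nhd_quotients[OF E]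
  show ?case
  proof (cases "p \<in> alternating \<phi> X E w x j")
    case True
    then have "(x, p) \<in> adjacency \<phi> (quotients E) ?V ^^ j" by (rule Suc.IH)
    then show ?thesis
      using x by (intro adjacency_relpow_mono[OF nhd, of ?V x j "Suc j"]) auto
  next
    case False
    then obtain \<gamma> \<delta> q where g: "\<gamma> \<in> E" "\<delta> \<in> E" "0 < w \<gamma> p" "\<phi> \<gamma> p = \<phi> \<delta> q"
      and q: "q \<in> alternating \<phi> X E w x j" and p: "p \<in> X"
      using Suc.prems by auto
    have qX: "q \<in> X" using q alternating_in_space[OF x(1)] by blast
    have gc: "\<gamma> \<in> carrier \<Gamma>" "\<delta> \<in> carrier \<Gamma>" using g E by auto
    have "p = \<phi> (inv \<gamma>) (\<phi> \<delta> q)" using g p gc act_inv_act by metis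
    then have pd: "p = \<phi> (inv \<gamma> \<otimes> \<delta>) q" using gc qX by (simp add: composition_rule)
    have xq: "(x, q) \<in> adjacency \<phi> (quotients E) ?V ^^ j" using Suc.IH q by blast
    have "w \<gamma> p \<le> outflow E w p"
      unfolding outflow_def using E g by (intro member_le_sum) auto
    also have "\<dots> \<le> a p" using w p by (simp add: subflow_def)
    finally have "0 < a p" using g by simp
    moreover have "q \<in> ?V" using adjacency_relpow_in[OF xq] x by auto
    moreover have "inv \<gamma> \<otimes> \<delta> \<in> quotients E"
      using g by (auto simp: quotients_def intro: image_eqI[of _ _ "(\<gamma>, \<delta>)"])
    ultimately have "(q, p) \<in> adjacency \<phi> (quotients E) ?V"
      using p pd by (auto simp: adjacency_def)
    with xq show ?thesis by auto
  qed
qed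

lemma finite_alternating:
  assumes E: "finite E" "E \<subseteq> carrier \<Gamma>" and w: "subflow E a b w" and x: "x \<in> X" "0 < a x"
  shows "alternating \<phi> X E w x j \<subseteq> translates \<phi> (words \<Gamma> (quotients E) j) {x}"
    and "finite (alternating \<phi> X E w x j)"
proof -
  have nhd: "finite (quotients E)" "quotients E \<subseteq> carrier \<Gamma>"
    using symmetric_nhd_quotients[OF E] by (auto simp: symmetric_nhd_def)
  show *: "alternating \<phi> X E w x j \<subseteq> translates \<phi> (words \<Gamma> (quotients E) j) {x}"
  proof
    fix p assume "p \<in> alternating \<phi> X E w x j"
    then have "(x, p) \<in> adjacency \<phi> (quotients E) {q \<in> X. 0 < a q} ^^ j"
      by (rule alternating_adjacency[OF assms])
    then obtain g where "g \<in> words \<Gamma> (quotients E) j" "p = \<phi> g x"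
      using adjacency_relpow_words[OF nhd(2), of "{q \<in> X. 0 < a q}" x p j] x by auto
    then show "p \<in> translates \<phi> (words \<Gamma> (quotients E) j) {x}" by (auto simp: translates_def)
  qed
  show "finite (alternating \<phi> X E w x j)"
    by (rule finite_subset[OF *]) (simp add: finite_translates finite_words nhd)
qed

text \<open>
  Rerouting one unit along an alternating path from \<open>x\<close> to \<open>p\<close> makes \<open>p\<close> the source that lacks a
  unit. The induction takes only the last step of the path explicitly: a source reached for the first
  time at stage \<open>j + 1\<close> has not been touched by the rerouting inside stage \<open>j\<close>, so the unit to be taken
  from it is still there.
\<close>

lemma move_deficit:
  assumes E: "finite E" "E \<subseteq> carrier \<Gamma>" and x: "x \<in> X" and p: "p \<in> alternating \<phi> X E w x j"
  shows "\<exists>w'. (\<forall>q. q \<notin> alternating \<phi> X E w x j \<longrightarrow> (\<forall>\<gamma>. w' \<gamma> q = w \<gamma> q)) \<and>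
    (\<forall>y\<in>X. inflow \<Gamma> \<phi> E w' y = inflow \<Gamma> \<phi> E w y) \<and>
    (\<forall>q\<in>X. outflow E w' q + of_bool (q = p) = outflow E w q + of_bool (q = x))"
  using p
proof (induction j arbitrary: p)
  case 0
  then show ?case by (intro exI[of _ w]) auto
next
  case (Suc j)
  let ?H = "alternating \<phi> X E w x"
  show ?case
  proof (cases "p \<in> ?H j")
    case True
    from Suc.IH[OF True] obtain w' where w': "\<forall>q. q \<notin> ?H j \<longrightarrow> (\<forall>\<gamma>. w' \<gamma> q = w \<gamma> q)"
      "\<forall>y\<in>X. inflow \<Gamma> \<phi> E w' y = inflow \<Gamma> \<phi> E w y"
      "\<forall>q\<in>X. outflow E w' q + of_bool (q = p) = outflow E w q + of_bool (q = x)" by blast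
    have "\<forall>q. q \<notin> ?H (Suc j) \<longrightarrow> (\<forall>\<gamma>. w' \<gamma> q = w \<gamma> q)" using w'(1) by simp
    then show ?thesis using w'(2,3) by blast
  next
    case False
    then obtain \<gamma> \<delta> q where g: "\<gamma> \<in> E" "\<delta> \<in> E" "0 < w \<gamma> p" "\<phi> \<gamma> p = \<phi> \<delta> q"
      and q: "q \<in> ?H j" and p: "p \<in> X"
      using Suc.prems by auto
    have qX: "q \<in> X" using q alternating_in_space[OF x] by blast
    obtain w' where w': "\<And>r \<gamma>. r \<notin> ?H j \<Longrightarrow> w' \<gamma> r = w \<gamma> r"
      "\<And>y. y \<in> X \<Longrightarrow> inflow \<Gamma> \<phi> E w' y = inflow \<Gamma> \<phi> E w y"
      "\<And>r. r \<in> X \<Longrightarrow> outflow E w' r + of_bool (r = q) = outflow E w r + of_bool (r = x)"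
      using Suc.IH[OF q] by blast
    have "0 < increment w' \<delta> q \<gamma> p" using w'(1)[OF False, of \<gamma>] g by (simp add: increment_def)
    then obtain v where v: "increment v \<gamma> p = increment w' \<delta> q"
      "\<And>\<epsilon> r. r \<noteq> p \<Longrightarrow> v \<epsilon> r = increment w' \<delta> q \<epsilon> r"
      using decrement_exists[of "increment w' \<delta> q" \<gamma> p] by metis
    have "v \<epsilon> r = w \<epsilon> r" if "r \<notin> ?H (Suc j)" for r \<epsilon>
    proof -
      have "r \<noteq> p" "r \<notin> ?H j" using that Suc.prems by auto
      then show ?thesis using v(2)[of r \<epsilon>] w'(1)[of r \<epsilon>] q by (auto simp: increment_def)
    qed
    moreover have "inflow \<Gamma> \<phi> E v y = inflow \<Gamma> \<phi> E w y" if "y \<in> X" for y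
      using inflow_increment[OF E g(1) p that, of v] inflow_increment[OF E g(2) qX that, of w']
        w'(2)[OF that] g(4) v(1) by simp
    moreover have "outflow E v r + of_bool (r = p) = outflow E w r + of_bool (r = x)" if "r \<in> X" for r
      using outflow_increment[OF E(1) g(1), of v p r] outflow_increment[OF E(1) g(2), of w' q r]
        w'(3)[OF that] v(1) by simp
    ultimately show ?thesis by blast
  qed
qed

text \<open>
  If a target of a reached source has free capacity, the missing unit is moved to that source and sent
  to the free target.
\<close>

lemma improve_or_saturated:
  assumes E: "finite E" "E \<subseteq> carrier \<Gamma>" and w: "subflow E a b w" and x: "x \<in> X" "outflow E w x < a x"
    and y: "y \<in> translates \<phi> E (alternating \<phi> X E w x j)" "inflow \<Gamma> \<phi> E w y < b y"
  shows "improvable E a b (alternating \<phi> X E w x j) w x"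
proof -
  let ?H = "alternating \<phi> X E w x j"
  obtain \<delta> p where p: "p \<in> ?H" and d: "\<delta> \<in> E" "y = \<phi> \<delta> p" using y(1) by (auto simp: translates_def)
  have pX: "p \<in> X" using p alternating_in_space[OF x(1)] by blast
  obtain w' where w': "\<And>r \<gamma>. r \<notin> ?H \<Longrightarrow> w' \<gamma> r = w \<gamma> r"
      "\<And>y. y \<in> X \<Longrightarrow> inflow \<Gamma> \<phi> E w' y = inflow \<Gamma> \<phi> E w y"
      "\<And>r. r \<in> X \<Longrightarrow> outflow E w' r + of_bool (r = p) = outflow E w r + of_bool (r = x)"
    using move_deficit[OF E x(1) p] by blast
  let ?v = "increment w' \<delta> p"
  have out: "outflow E ?v r = outflow E w r + of_bool (r = x)" if "r \<in> X" for r
    using w'(3)[OF that] outflow_increment[OF E(1) d(1), of w' p r] by simp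
  have "inflow \<Gamma> \<phi> E ?v s = inflow \<Gamma> \<phi> E w s + of_bool (s = y)" if "s \<in> X" for s
    using w'(2)[OF that] inflow_increment[OF E d(1) pX that, of w'] d(2) by simp
  then have "subflow E a b ?v"
    using out w x y(2) by (auto simp: subflow_def Suc_le_eq)
  moreover have "?v \<gamma> q = w \<gamma> q" if "q \<notin> ?H" for \<gamma> q
    using w'(1)[OF that, of \<gamma>] p that by (auto simp: increment_def)
  ultimately show ?thesis unfolding improvable_def using out x(1) by (intro exI[of _ ?v]) auto
qed

text \<open>
  All the flow that enters a target of stage \<open>j\<close> comes from sources of stage \<open>j + 1\<close>.
\<close>

lemma saturated_expansion:
  assumes E: "finite E" "E \<subseteq> carrier \<Gamma>" and w: "subflow E a b w" and x: "x \<in> X" "0 < a x"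
    and sat: "\<And>y. y \<in> translates \<phi> E (alternating \<phi> X E w x j) \<Longrightarrow> b y \<le> inflow \<Gamma> \<phi> E w y"
  shows "sum b (translates \<phi> E (alternating \<phi> X E w x j)) \<le>
    sum (outflow E w) (alternating \<phi> X E w x (Suc j))"
proof -
  let ?H = "alternating \<phi> X E w x"
  let ?T = "translates \<phi> E (?H j)"
  have HX: "?H j \<subseteq> X" by (rule alternating_in_space[OF x(1)])
  have fin: "finite (?H i)" for i by (rule finite_alternating[OF E w x])
  have TX: "?T \<subseteq> X" by (rule translates_in_space[OF E(2) HX])
  have finT: "finite ?T" by (rule finite_translates[OF E(1) fin])
  have "sum b ?T \<le> (\<Sum>y\<in>?T. inflow \<Gamma> \<phi> E w y)" by (rule sum_mono) (rule sat)
  also have "\<dots> = (\<Sum>\<gamma>\<in>E. \<Sum>y\<in>?T. w \<gamma> (\<phi> (inv \<gamma>) y))"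
    unfolding inflow_def by (rule sum.swap)
  also have "\<dots> \<le> (\<Sum>\<gamma>\<in>E. \<Sum>p\<in>?H (Suc j). w \<gamma> p)"
  proof (rule sum_mono)
    fix \<gamma> assume g: "\<gamma> \<in> E"
    then have gc: "\<gamma> \<in> carrier \<Gamma>" using E by auto
    have "inj_on (\<phi> (inv \<gamma>)) ?T" using inj_prop[of "inv \<gamma>"] gc TX by (auto intro: inj_on_subset)
    then have "(\<Sum>y\<in>?T. w \<gamma> (\<phi> (inv \<gamma>) y)) = (\<Sum>p\<in>\<phi> (inv \<gamma>) ` ?T. w \<gamma> p)"
      by (simp add: sum.reindex)
    also have "\<dots> = (\<Sum>p\<in>(\<phi> (inv \<gamma>) ` ?T) \<inter> ?H (Suc j). w \<gamma> p)"
    proof (rule sum.mono_neutral_right)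
      show "\<forall>p\<in>\<phi> (inv \<gamma>) ` ?T - \<phi> (inv \<gamma>) ` ?T \<inter> ?H (Suc j). w \<gamma> p = 0"
      proof (intro ballI, rule ccontr)
        fix p assume p: "p \<in> \<phi> (inv \<gamma>) ` ?T - \<phi> (inv \<gamma>) ` ?T \<inter> ?H (Suc j)" and "w \<gamma> p \<noteq> 0"
        then obtain y where y: "y \<in> ?T" "p = \<phi> (inv \<gamma>) y" by blast
        then have yX: "y \<in> X" using TX by blast
        have "p \<in> X" using y yX gc act_closed by simp
        moreover have "\<phi> \<gamma> p = y" using y yX gc act_act_inv by simp
        ultimately have "p \<in> ?H (Suc j)"
          using y(1) g \<open>w \<gamma> p \<noteq> 0\<close> by (auto simp: translates_def)
        with p y show False by blast
      qed
    qed (use finT in auto)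
    also have "\<dots> \<le> (\<Sum>p\<in>?H (Suc j). w \<gamma> p)" using fin[of "Suc j"] by (intro sum_mono2) auto
    finally show "(\<Sum>y\<in>?T. w \<gamma> (\<phi> (inv \<gamma>) y)) \<le> (\<Sum>p\<in>?H (Suc j). w \<gamma> p)" .
  qed
  also have "\<dots> = sum (outflow E w) (?H (Suc j))"
    unfolding outflow_def by (rule sum.swap)
  finally show ?thesis .
qed

section \<open>Simultaneous augmentation\<close>

definition measurable_flow :: "'g set \<Rightarrow> ('g \<Rightarrow> 'x \<Rightarrow> nat) \<Rightarrow> bool" where
  "measurable_flow E z \<longleftrightarrow> finite E \<and> E \<subseteq> carrier \<Gamma> \<and> (\<forall>\<gamma>\<in>E. z \<gamma> \<in> M \<rightarrow>\<^sub>M count_space UNIV)"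

definition saturating_flow ::
    "'g set \<Rightarrow> ('x \<Rightarrow> nat) \<Rightarrow> ('x \<Rightarrow> nat) \<Rightarrow> ('g \<Rightarrow> 'x \<Rightarrow> nat) \<Rightarrow> bool" where
  "saturating_flow E a b z \<longleftrightarrow>
    measurable_flow E z \<and> subflow E a b z \<and> (\<forall>x\<in>X. outflow E z x = a x)"

lemma outflow_cong: "(\<And>\<gamma>. \<gamma> \<in> E \<Longrightarrow> w \<gamma> p = z \<gamma> p) \<Longrightarrow> outflow E w p = outflow E z p"
  by (simp add: outflow_def)

lemma inflow_cong:
  "(\<And>\<gamma>. \<gamma> \<in> E \<Longrightarrow> w \<gamma> (\<phi> (inv \<gamma>) y) = z \<gamma> (\<phi> (inv \<gamma>) y)) \<Longrightarrow> inflow \<Gamma> \<phi> E w y = inflow \<Gamma> \<phi> E z y"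
  by (simp add: inflow_def)

text \<open>
  A local improvement at \<open>x\<close> is described by the new values of the flow on the finite window \<open>P x\<close>, and
  as these are bounded by \<open>A\<close> there are only finitely many descriptions. Whether a description is valid
  at \<open>x\<close> is a measurable condition on \<open>x\<close>, so the first valid one is a measurable choice. The separation
  of \<open>Y\<close> ensures that no source and no sink is affected by the windows of two points of \<open>Y\<close>.
\<close>

lemma improve_on_separated_set:
  assumes P: "finite P" "P \<subseteq> carrier \<Gamma>" "\<one> \<in> P" and z: "measurable_flow E z" "subflow E a b z"
    and ab: "a \<in> M \<rightarrow>\<^sub>M count_space UNIV" "b \<in> M \<rightarrow>\<^sub>M count_space UNIV" "\<And>x. x \<in> X \<Longrightarrow> a x \<le> A"
    and improve: "\<And>x w. x \<in> X \<Longrightarrow> subflow E a b w \<Longrightarrow> outflow E w x < a x \<Longrightarrow>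
      improvable E a b (translates \<phi> P {x}) w x"
    and Y: "Y \<in> sets M"
    and sep: "\<And>x x' g h k. x \<in> Y \<Longrightarrow> x' \<in> Y \<Longrightarrow> g \<in> P \<Longrightarrow> h \<in> P \<Longrightarrow> k \<in> quotients E \<Longrightarrow>
      \<phi> h x' = \<phi> k (\<phi> g x) \<Longrightarrow> x' = x"
  shows "\<exists>z'. measurable_flow E z' \<and> subflow E a b z' \<and> (\<forall>p\<in>X. outflow E z p \<le> outflow E z' p) \<and>
    (\<forall>x\<in>Y. outflow E z x < a x \<longrightarrow> outflow E z x < outflow E z' x)"
proof -
  have E: "finite E" "E \<subseteq> carrier \<Gamma>" and zm: "\<And>\<gamma>. \<gamma> \<in> E \<Longrightarrow> z \<gamma> \<in> M \<rightarrow>\<^sub>M count_space UNIV"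
    using z(1) by (auto simp: measurable_flow_def)
  have YX: "Y \<subseteq> X" using Y sets.sets_into_space by auto
  obtain gs where gs: "set gs = P" using finite_list[OF P(1)] by blast
  have "finite (PiE (P \<times> E) (\<lambda>_. {..A}))" using P E by (intro finite_PiE) auto
  from finite_list[OF this] obtain cs where cs: "set cs = PiE (P \<times> E) (\<lambda>_. {..A})" ..
  define patch where "patch c x = (\<lambda>\<gamma> p. first_that (\<lambda>g. \<phi> g x = p) (\<lambda>g. c (g, \<gamma>)) (z \<gamma> p) gs)"
    for c :: "'g \<times> 'g \<Rightarrow> nat" and x
  define valid where "valid c x \<longleftrightarrow>
      (\<forall>g\<in>P. outflow E (patch c x) (\<phi> g x) \<le> a (\<phi> g x)) \<and>
      (\<forall>g\<in>P. outflow E z (\<phi> g x) \<le> outflow E (patch c x) (\<phi> g x)) \<and>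
      (\<forall>g\<in>P. \<forall>\<gamma>\<in>E. inflow \<Gamma> \<phi> E (patch c x) (\<phi> (\<gamma> \<otimes> g) x) \<le> b (\<phi> (\<gamma> \<otimes> g) x)) \<and>
      outflow E z (\<phi> \<one> x) < outflow E (patch c x) (\<phi> \<one> x)" for c x
  define code where "code x = first_that (\<lambda>c. valid c x) (\<lambda>c. c) (\<lambda>_. 0) cs" for x
  define Y' where "Y' = {x \<in> Y. \<exists>c\<in>set cs. valid c x}"
  define z' where "z' \<gamma> p = first_that (\<lambda>g. \<phi> (inv g) p \<in> Y') (\<lambda>g. code (\<phi> (inv g) p) (g, \<gamma>)) (z \<gamma> p) gs"
    for \<gamma> p
  have patch_m: "(\<lambda>x. patch c x \<gamma> (\<phi> k x)) \<in> M \<rightarrow>\<^sub>M count_space UNIV" if "k \<in> carrier \<Gamma>" "\<gamma> \<in> E" for c \<gamma> k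
    unfolding patch_def
  proof (rule measurable_first_that)
    fix g assume "g \<in> set gs"
    then have "g \<in> carrier \<Gamma>" using gs P by auto
    then show "{x \<in> X. \<phi> g x = \<phi> k x} \<in> sets M" by (rule act_eq_measurable[OF _ that(1)])
    show "(\<lambda>x. c (g, \<gamma>)) \<in> M \<rightarrow>\<^sub>M count_space UNIV" by simp
  next
    show "(\<lambda>x. z \<gamma> (\<phi> k x)) \<in> M \<rightarrow>\<^sub>M count_space UNIV" by (rule act_compose[OF that(1) zm[OF that(2)]])
  qed
  have pout_m: "(\<lambda>x. outflow E (patch c x) (\<phi> k x)) \<in> M \<rightarrow>\<^sub>M count_space UNIV" if "k \<in> carrier \<Gamma>" for c k
    unfolding outflow_def by (rule measurable_nat_sum) (rule patch_m[OF that])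
  have zout_m: "(\<lambda>x. outflow E z (\<phi> k x)) \<in> M \<rightarrow>\<^sub>M count_space UNIV" if "k \<in> carrier \<Gamma>" for k
    by (intro act_compose[OF that] outflow_measurable zm)
  have pin_m: "(\<lambda>x. inflow \<Gamma> \<phi> E (patch c x) (\<phi> k x)) \<in> M \<rightarrow>\<^sub>M count_space UNIV" if k: "k \<in> carrier \<Gamma>" for c k
    unfolding inflow_def
  proof (rule measurable_nat_sum)
    fix \<gamma> assume g: "\<gamma> \<in> E"
    then have gc: "\<gamma> \<in> carrier \<Gamma>" using E by auto
    have "(\<lambda>x. patch c x \<gamma> (\<phi> (inv \<gamma> \<otimes> k) x)) \<in> M \<rightarrow>\<^sub>M count_space UNIV"
      by (rule patch_m) (use g gc k in auto)
    then show "(\<lambda>x. patch c x \<gamma> (\<phi> (inv \<gamma>) (\<phi> k x))) \<in> M \<rightarrow>\<^sub>M count_space UNIV"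
      by (rule measurable_cong[THEN iffD1, rotated]) (simp add: composition_rule gc k)
  qed
  have valid_m: "{x \<in> X. valid c x} \<in> sets M" for c
    unfolding valid_def
  proof (intro sets.sets_Collect_conj sets.sets_Collect_finite_All P E)
    fix g assume g: "g \<in> P"
    then have gc: "g \<in> carrier \<Gamma>" using P by auto
    show "{x \<in> X. outflow E (patch c x) (\<phi> g x) \<le> a (\<phi> g x)} \<in> sets M"
      by (rule measurable_nat_rel[OF pout_m[OF gc] act_compose[OF gc ab(1)]])
    show "{x \<in> X. outflow E z (\<phi> g x) \<le> outflow E (patch c x) (\<phi> g x)} \<in> sets M"
      by (rule measurable_nat_rel[OF zout_m[OF gc] pout_m[OF gc]])
    fix \<gamma> assume "\<gamma> \<in> E"
    then have gg: "\<gamma> \<otimes> g \<in> carrier \<Gamma>" using gc E by auto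
    show "{x \<in> X. inflow \<Gamma> \<phi> E (patch c x) (\<phi> (\<gamma> \<otimes> g) x) \<le> b (\<phi> (\<gamma> \<otimes> g) x)} \<in> sets M"
      by (rule measurable_nat_rel[OF pin_m[OF gg] act_compose[OF gg ab(2)]])
  next
    show "{x \<in> X. outflow E z (\<phi> \<one> x) < outflow E (patch c x) (\<phi> \<one> x)} \<in> sets M"
      by (rule measurable_nat_rel[OF zout_m pout_m]) auto
  qed
  have code_m: "(\<lambda>x. code x e) \<in> M \<rightarrow>\<^sub>M count_space UNIV" for e
    unfolding code_def first_that_apply[where h = "\<lambda>f. f e"]
    by (rule measurable_first_that) (auto intro: valid_m)
  have "Y' = Y \<inter> (\<Union>c\<in>set cs. {x \<in> X. valid c x})" using YX by (auto simp: Y'_def)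
  then have Y'm: "Y' \<in> sets M" using Y valid_m by auto
  have z'm: "measurable_flow E z'"
    unfolding measurable_flow_def
  proof (intro conjI ballI E)
    fix \<gamma> assume g: "\<gamma> \<in> E"
    show "z' \<gamma> \<in> M \<rightarrow>\<^sub>M count_space UNIV"
      unfolding z'_def
    proof (rule measurable_first_that)
      fix g assume "g \<in> set gs"
      then have "inv g \<in> carrier \<Gamma>" using gs P by auto
      then show "{x \<in> X. \<phi> (inv g) x \<in> Y'} \<in> sets M"
        and "(\<lambda>x. code (\<phi> (inv g) x) (g, \<gamma>)) \<in> M \<rightarrow>\<^sub>M count_space UNIV"
        using act_preimage Y'm act_compose[OF _ code_m] by auto
    qed (rule zm[OF g])
  qed
  \<comment> \<open>Near a centre the new flow agrees with the patched one, and elsewhere with the old one.\<close>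
  have code_valid: "valid (code x) x" if "x \<in> Y'" for x
    using that first_that_some[of cs "\<lambda>c. valid c x" "\<lambda>c. c" "\<lambda>_. 0"] by (auto simp: Y'_def code_def)
  have PX: "\<phi> g x \<in> X" if "g \<in> P" "x \<in> X" for g x using that P act_closed by auto
  have inv_centre: "\<phi> (inv g) p = x \<longleftrightarrow> \<phi> g x = p" if "g \<in> P" "x \<in> X" "p \<in> X" for g x p
    using that P act_eq_iff[of g x p] by auto
  have one_quot: "\<one> \<in> quotients E" by (simp add: quotients_def)
  have near: "z' \<gamma> p = patch (code x) x \<gamma> p" if x: "x \<in> Y'" and g: "g \<in> P" "p = \<phi> g x" for x g p \<gamma>
  proof -
    have xX: "x \<in> X" and pX: "p \<in> X" using x YX g PX by (auto simp: Y'_def)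
    have *: "\<phi> (inv h) p \<in> Y' \<longleftrightarrow> \<phi> h x = p" if h: "h \<in> P" for h
    proof
      assume c: "\<phi> (inv h) p \<in> Y'"
      then have cX: "\<phi> (inv h) p \<in> X" using YX by (auto simp: Y'_def)
      have "\<phi> h (\<phi> (inv h) p) = \<phi> \<one> (\<phi> g x)"
        using h P pX g act_act_inv act_one by auto
      then have "\<phi> (inv h) p = x"
        using sep[of x "\<phi> (inv h) p" g h \<one>] x c h g one_quot by (auto simp: Y'_def)
      then show "\<phi> h x = p" using inv_centre[OF h xX pX] by simp
    next
      assume "\<phi> h x = p"
      then show "\<phi> (inv h) p \<in> Y'" using inv_centre[OF h xX pX] x by simp
    qed
    show ?thesis
      unfolding z'_def patch_def
    proof (rule first_that_cong)
      fix h assume "h \<in> set gs"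
      then have h: "h \<in> P" using gs by simp
      show "\<phi> (inv h) p \<in> Y' \<longleftrightarrow> \<phi> h x = p" by (rule *[OF h])
      assume "\<phi> h x = p"
      then show "code (\<phi> (inv h) p) (h, \<gamma>) = code x (h, \<gamma>)" using inv_centre[OF h xX pX] by simp
    qed
  qed
  have far: "z' \<gamma> p = z \<gamma> p" if "p \<in> X" "\<And>x g. x \<in> Y' \<Longrightarrow> g \<in> P \<Longrightarrow> p \<noteq> \<phi> g x" for p \<gamma>
    unfolding z'_def
  proof (rule first_that_none)
    fix g assume "g \<in> set gs"
    then have "g \<in> carrier \<Gamma>" "g \<in> P" using gs P by auto
    then show "\<not> \<phi> (inv g) p \<in> Y'" using that act_act_inv[of g p] by metis
  qed
  have patch_far: "patch c x \<gamma> p = z \<gamma> p" if "\<And>g. g \<in> P \<Longrightarrow> p \<noteq> \<phi> g x" for c x \<gamma> p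
    unfolding patch_def by (rule first_that_none) (use that gs in auto)
  have out_cases: "(\<exists>x\<in>Y'. \<exists>g\<in>P. p = \<phi> g x \<and> outflow E z' p = outflow E (patch (code x) x) p) \<or>
      outflow E z' p = outflow E z p" if p: "p \<in> X" for p
  proof (cases "\<exists>x\<in>Y'. \<exists>g\<in>P. p = \<phi> g x")
    case True
    then obtain x g where "x \<in> Y'" "g \<in> P" "p = \<phi> g x" by blast
    then show ?thesis using near by (auto intro!: outflow_cong)
  next
    case False
    then show ?thesis using far[OF p] by (auto intro!: outflow_cong)
  qed
  have out_ge: "outflow E z p \<le> outflow E z' p" and out_le: "outflow E z' p \<le> a p" if p: "p \<in> X" for p
    using out_cases[OF p] code_valid z(2) p by (auto simp: valid_def subflow_def)
  have in_le: "inflow \<Gamma> \<phi> E z' y \<le> b y" if y: "y \<in> X" for y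
  proof (cases "\<exists>x\<in>Y'. \<exists>g\<in>P. \<exists>\<gamma>\<in>E. y = \<phi> \<gamma> (\<phi> g x)")
    case True
    then obtain x g \<gamma> where x: "x \<in> Y'" "g \<in> P" "\<gamma> \<in> E" "y = \<phi> \<gamma> (\<phi> g x)" by blast
    have xX: "x \<in> X" using x YX by (auto simp: Y'_def)
    have c: "g \<in> carrier \<Gamma>" "\<gamma> \<in> carrier \<Gamma>" using x P E by auto
    have "inflow \<Gamma> \<phi> E z' y = inflow \<Gamma> \<phi> E (patch (code x) x) y"
    proof (rule inflow_cong)
      fix \<delta> assume d: "\<delta> \<in> E"
      then have dc: "\<delta> \<in> carrier \<Gamma>" using E by auto
      let ?p = "\<phi> (inv \<delta>) y"
      have pX: "?p \<in> X" using dc y act_closed by simp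
      have pq: "?p = \<phi> (inv \<delta> \<otimes> \<gamma>) (\<phi> g x)" using x c dc xX PX by (simp add: composition_rule)
      have q: "inv \<delta> \<otimes> \<gamma> \<in> quotients E"
        using d x by (auto simp: quotients_def intro: image_eqI[of _ _ "(\<delta>, \<gamma>)"])
      show "z' \<delta> ?p = patch (code x) x \<delta> ?p"
      proof (cases "\<exists>x'\<in>Y'. \<exists>h\<in>P. ?p = \<phi> h x'")
        case True
        then obtain x' h where h: "x' \<in> Y'" "h \<in> P" "?p = \<phi> h x'" by blast
        then have "x' = x" using sep[of x x' g h "inv \<delta> \<otimes> \<gamma>"] x q pq by (auto simp: Y'_def)
        then show ?thesis using near[OF h(1,2)] h(3) by simp
      next
        case False
        then show ?thesis using far[OF pX] patch_far[of ?p x] x(1) by metis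
      qed
    qed
    also have "\<dots> \<le> b y"
    proof -
      have "y = \<phi> (\<gamma> \<otimes> g) x" using x c xX by (simp add: composition_rule)
      then show ?thesis using code_valid[OF x(1)] x by (auto simp: valid_def)
    qed
    finally show ?thesis .
  next
    case False
    have "inflow \<Gamma> \<phi> E z' y = inflow \<Gamma> \<phi> E z y"
    proof (rule inflow_cong)
      fix \<delta> assume d: "\<delta> \<in> E"
      then have dc: "\<delta> \<in> carrier \<Gamma>" using E by auto
      show "z' \<delta> (\<phi> (inv \<delta>) y) = z \<delta> (\<phi> (inv \<delta>) y)"
      proof (rule far)
        show "\<phi> (inv \<delta>) y \<in> X" using dc y act_closed by simp
        show "\<phi> (inv \<delta>) y \<noteq> \<phi> g x" if "x \<in> Y'" "g \<in> P" for x g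
          using False that d act_act_inv[OF dc y] by metis
      qed
    qed
    then show ?thesis using z(2) y by (simp add: subflow_def)
  qed
  have gain: "outflow E z x < outflow E z' x" if xY: "x \<in> Y" and unsat: "outflow E z x < a x" for x
  proof -
    have xX: "x \<in> X" using xY YX by blast
    obtain w' where w': "subflow E a b w'"
      "\<And>p \<gamma>. p \<in> X \<Longrightarrow> p \<notin> translates \<phi> P {x} \<Longrightarrow> \<gamma> \<in> E \<Longrightarrow> w' \<gamma> p = z \<gamma> p"
      "\<And>p. p \<in> X \<Longrightarrow> outflow E z p \<le> outflow E w' p" "outflow E z x < outflow E w' x"
      using improve[OF xX z(2) unsat] unfolding improvable_def by blast
    define c where "c = restrict (\<lambda>(g, \<gamma>). w' \<gamma> (\<phi> g x)) (P \<times> E)"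
    have "w' \<gamma> (\<phi> g x) \<le> A" if "g \<in> P" "\<gamma> \<in> E" for g \<gamma>
    proof -
      have "w' \<gamma> (\<phi> g x) \<le> outflow E w' (\<phi> g x)"
        unfolding outflow_def using E that by (intro member_le_sum) auto
      also have "\<dots> \<le> a (\<phi> g x)" using w'(1) PX[OF that(1) xX] by (simp add: subflow_def)
      finally show ?thesis using ab(3)[OF PX[OF that(1) xX]] by simp
    qed
    then have "c \<in> set cs" unfolding cs c_def by (intro restrict_PiE_iff[THEN iffD2]) auto
    have pw: "patch c x \<gamma> p = w' \<gamma> p" if "p \<in> X" "\<gamma> \<in> E" for \<gamma> p
    proof (cases "\<exists>g\<in>set gs. \<phi> g x = p")
      case True
      from first_that_some[OF this, of "\<lambda>g. c (g, \<gamma>)" "z \<gamma> p"] obtain g where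
        "g \<in> P" "\<phi> g x = p" "patch c x \<gamma> p = c (g, \<gamma>)" unfolding patch_def gs by blast
      then show ?thesis using that by (simp add: c_def)
    next
      case False
      then have "patch c x \<gamma> p = z \<gamma> p" unfolding patch_def by (intro first_that_none) auto
      moreover have "p \<notin> translates \<phi> P {x}" using False gs by (auto simp: translates_def)
      ultimately show ?thesis using w'(2)[of p \<gamma>] that by simp
    qed
    have o: "outflow E (patch c x) p = outflow E w' p" if "p \<in> X" for p
      by (rule outflow_cong) (rule pw[OF that])
    have i: "inflow \<Gamma> \<phi> E (patch c x) p = inflow \<Gamma> \<phi> E w' p" if "p \<in> X" for p
      by (rule inflow_cong, rule pw) (use that E act_closed in auto)
    have gg: "\<phi> (\<gamma> \<otimes> g) x \<in> X" if "g \<in> P" "\<gamma> \<in> E" for g \<gamma>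
      using that P E xX by (intro act_closed) auto
    have "valid c x"
      unfolding valid_def using o i PX[OF _ xX] gg w' act_one[OF xX] xX by (simp add: subflow_def)
    then have xY': "x \<in> Y'" using xY \<open>c \<in> set cs\<close> by (auto simp: Y'_def)
    have "outflow E z' x = outflow E (patch (code x) x) x"
      by (rule outflow_cong) (rule near[OF xY' P(3)], simp add: act_one xX)
    then show ?thesis using code_valid[OF xY'] act_one[OF xX] by (simp add: valid_def)
  qed
  show ?thesis
    using z'm out_ge out_le in_le gain by (intro exI[of _ z']) (auto simp: subflow_def)
qed

text \<open>
  One round runs through finitely many separated sets that cover \<open>X\<close> and raises the outflow of every
  unsaturated source, so \<open>A\<close> rounds saturate all of them.
\<close>

lemma saturating_flow_exists:
  assumes E: "finite E" "E \<subseteq> carrier \<Gamma>" and P: "finite P" "P \<subseteq> carrier \<Gamma>" "\<one> \<in> P"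
    and ab: "a \<in> M \<rightarrow>\<^sub>M count_space UNIV" "b \<in> M \<rightarrow>\<^sub>M count_space UNIV" "\<And>x. x \<in> X \<Longrightarrow> a x \<le> A"
    and improve: "\<And>x w. x \<in> X \<Longrightarrow> subflow E a b w \<Longrightarrow> outflow E w x < a x \<Longrightarrow>
      improvable E a b (translates \<phi> P {x}) w x"
  shows "\<exists>z. saturating_flow E a b z"
proof -
  define \<Delta> where "\<Delta> = (\<lambda>(h, k, g). inv h \<otimes> k \<otimes> g) ` (P \<times> quotients E \<times> P)"
  have Q: "finite (quotients E)" "quotients E \<subseteq> carrier \<Gamma>" "\<And>k. k \<in> quotients E \<Longrightarrow> inv k \<in> quotients E"
    using symmetric_nhd_quotients[OF E] by (auto simp: symmetric_nhd_def)
  have Delta_inv: "inv d \<in> \<Delta>" if "d \<in> \<Delta>" for d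
  proof -
    from that obtain h k g where d: "h \<in> P" "k \<in> quotients E" "g \<in> P" "d = inv h \<otimes> k \<otimes> g" by (auto simp: \<Delta>_def)
    then have "h \<in> carrier \<Gamma>" "k \<in> carrier \<Gamma>" "g \<in> carrier \<Gamma>" using P Q by auto
    then have "inv d = inv g \<otimes> inv k \<otimes> h" using d by (simp add: inv_mult_group m_assoc)
    then show ?thesis using d Q unfolding \<Delta>_def by (intro image_eqI[of _ _ "(g, inv k, h)"]) auto
  qed
  have Delta: "finite \<Delta>" "\<Delta> \<subseteq> carrier \<Gamma>" unfolding \<Delta>_def using P Q by (auto simp: subset_iff)
  obtain Ys where Ys0: "\<forall>Y\<in>set Ys. Y \<in> sets M \<and> (\<forall>x\<in>Y. \<forall>d\<in>\<Delta>. \<phi> d x \<noteq> x \<longrightarrow> \<phi> d x \<notin> Y)"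
    and Ys2: "X = \<Union>(set Ys)"
    using finite_coloring[of \<Delta>, OF Delta] Delta_inv by metis
  have Ys1: "Y \<in> sets M" if "Y \<in> set Ys" for Y using bspec[OF Ys0 that] by simp
  have Ys3: "\<phi> d x \<notin> Y" if "Y \<in> set Ys" "x \<in> Y" "d \<in> \<Delta>" "\<phi> d x \<noteq> x" for Y x d
    using bspec[OF Ys0 that(1)] that(2-4) by simp
  have sep: "x' = x" if Y: "Y \<in> set Ys" "x \<in> Y" "x' \<in> Y" and g: "g \<in> P" "h \<in> P" "k \<in> quotients E"
      and eq: "\<phi> h x' = \<phi> k (\<phi> g x)" for Y x x' g h k
  proof -
    have X: "x \<in> X" "x' \<in> X" using Y Ys2 by auto
    have c: "g \<in> carrier \<Gamma>" "h \<in> carrier \<Gamma>" "k \<in> carrier \<Gamma>" using g P Q by auto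
    have "x' = \<phi> (inv h) (\<phi> k (\<phi> g x))" using eq act_inv_act[OF c(2) X(2)] by simp
    also have "\<dots> = \<phi> (inv h \<otimes> k \<otimes> g) x" using c X by (simp add: composition_rule act_closed)
    finally have x': "x' = \<phi> (inv h \<otimes> k \<otimes> g) x" .
    moreover have "inv h \<otimes> k \<otimes> g \<in> \<Delta>" using g unfolding \<Delta>_def by (intro image_eqI[of _ _ "(h, k, g)"]) auto
    ultimately show ?thesis using Ys3[OF Y(1,2)] Y(3) by metis
  qed
  have round: "\<exists>z'. measurable_flow E z' \<and> subflow E a b z' \<and> (\<forall>p\<in>X. outflow E z p \<le> outflow E z' p) \<and>
      (\<forall>Y\<in>set Zs. \<forall>x\<in>Y. outflow E z x < a x \<longrightarrow> outflow E z x < outflow E z' x)"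
    if "set Zs \<subseteq> set Ys" "measurable_flow E z" "subflow E a b z" for Zs z
    using that
  proof (induction Zs arbitrary: z)
    case Nil
    then show ?case by (intro exI[of _ z]) auto
  next
    case (Cons Y Zs)
    then have Y: "Y \<in> set Ys" by simp
    have "\<exists>z'. measurable_flow E z' \<and> subflow E a b z' \<and> (\<forall>p\<in>X. outflow E z p \<le> outflow E z' p) \<and>
        (\<forall>x\<in>Y. outflow E z x < a x \<longrightarrow> outflow E z x < outflow E z' x)"
    proof (rule improve_on_separated_set[OF P Cons.prems(2,3) ab(1,2)])
      show "x' = x" if "x \<in> Y" "x' \<in> Y" "g \<in> P" "h \<in> P" "k \<in> quotients E" "\<phi> h x' = \<phi> k (\<phi> g x)"
        for x x' g h k by (rule sep[OF Y that])
    qed (rule Ys1[OF Y] ab(3) improve; assumption)+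
    then obtain z1 where z1: "measurable_flow E z1" "subflow E a b z1" "\<forall>p\<in>X. outflow E z p \<le> outflow E z1 p"
      "\<forall>x\<in>Y. outflow E z x < a x \<longrightarrow> outflow E z x < outflow E z1 x"
      by blast
    obtain z2 where z2: "measurable_flow E z2" "subflow E a b z2" "\<forall>p\<in>X. outflow E z1 p \<le> outflow E z2 p"
      "\<forall>Y\<in>set Zs. \<forall>x\<in>Y. outflow E z1 x < a x \<longrightarrow> outflow E z1 x < outflow E z2 x"
      using Cons.IH[OF _ z1(1,2)] Cons.prems(1) by auto
    have X: "x \<in> X" if "Y' \<in> set (Y # Zs)" "x \<in> Y'" for x Y'
      using that Cons.prems(1) Ys2 by auto
    have "outflow E z x < outflow E z2 x" if "Y' \<in> set (Y # Zs)" "x \<in> Y'" "outflow E z x < a x" for x Y'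
    proof (cases "outflow E z x < outflow E z1 x")
      case True
      then show ?thesis using z2(3) X[OF that(1,2)] by (meson less_le_trans)
    next
      case False
      then have eq: "outflow E z1 x = outflow E z x" using z1(3) X[OF that(1,2)] by (simp add: le_antisym)
      then have "Y' \<in> set Zs" using z1(4) that by auto
      then show ?thesis using z2(4) that eq by metis
    qed
    then show ?case using z1 z2 by (intro exI[of _ z2]) (meson order_trans)
  qed
  have "\<exists>z. measurable_flow E z \<and> subflow E a b z \<and> (\<forall>x\<in>X. min (a x) t \<le> outflow E z x)" for t
  proof (induction t)
    case 0
    show ?case
      using E by (intro exI[of _ "\<lambda>_ _. 0"]) (auto simp: measurable_flow_def subflow_def outflow_def inflow_def)
  next
    case (Suc t)
    then obtain z where z: "measurable_flow E z" "subflow E a b z" "\<forall>x\<in>X. min (a x) t \<le> outflow E z x" by blast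
    obtain z' where z': "measurable_flow E z'" "subflow E a b z'" "\<forall>p\<in>X. outflow E z p \<le> outflow E z' p"
      "\<forall>Y\<in>set Ys. \<forall>x\<in>Y. outflow E z x < a x \<longrightarrow> outflow E z x < outflow E z' x"
      using round[OF order_refl z(1,2)] by blast
    have "min (a x) (Suc t) \<le> outflow E z' x" if "x \<in> X" for x
    proof -
      have "outflow E z x < a x \<Longrightarrow> outflow E z x < outflow E z' x" using z'(4) that Ys2 by auto
      moreover have "min (a x) t \<le> outflow E z x" "outflow E z x \<le> outflow E z' x" using z(3) z'(3) that by auto
      ultimately show ?thesis by (cases "outflow E z x < a x") auto
    qed
    then show ?case using z' by blast
  qed
  from this[of A] obtain z where z: "measurable_flow E z" "subflow E a b z"
    "\<forall>x\<in>X. min (a x) A \<le> outflow E z x" by blast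
  have "outflow E z x = a x" if "x \<in> X" for x
    using z(2) bspec[OF z(3) that] that ab(3)[OF that] by (simp add: subflow_def min_absorb1 le_antisym)
  then show ?thesis using z unfolding saturating_flow_def by blast
qed

section \<open>Groups of subexponential growth\<close>

text \<open>
  All base points \<open>h\<close> are allowed because right Cayley graphs are invariant under left translation; this
  makes the bound subadditive (\<open>cayley_length_mult\<close>).
\<close>

definition cayley_length_le :: "'g set \<Rightarrow> 'g \<Rightarrow> nat \<Rightarrow> bool" where
  "cayley_length_le S g c \<longleftrightarrow> (\<forall>h\<in>carrier \<Gamma>. \<exists>j\<le>c. (h, h \<otimes> g) \<in> cayley_graph \<Gamma> S ^^ j)"

lemma cayley_length_mult:
  assumes "cayley_length_le S g c" "cayley_length_le S h d" "g \<in> carrier \<Gamma>" "h \<in> carrier \<Gamma>"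
  shows "cayley_length_le S (g \<otimes> h) (c + d)"
  unfolding cayley_length_le_def
proof
  fix k assume k: "k \<in> carrier \<Gamma>"
  obtain i where i: "i \<le> c" "(k, k \<otimes> g) \<in> cayley_graph \<Gamma> S ^^ i"
    using assms(1) k unfolding cayley_length_le_def by blast
  obtain j where j: "j \<le> d" "(k \<otimes> g, k \<otimes> g \<otimes> h) \<in> cayley_graph \<Gamma> S ^^ j"
    using assms(2,3) k unfolding cayley_length_le_def by (meson m_closed)
  have "(k, k \<otimes> (g \<otimes> h)) \<in> cayley_graph \<Gamma> S ^^ (i + j)"
    using i(2) j(2) k assms(3,4) by (auto simp: relpow_add m_assoc)
  then show "\<exists>l\<le>c + d. (k, k \<otimes> (g \<otimes> h)) \<in> cayley_graph \<Gamma> S ^^ l"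
    using i(1) j(1) by (intro exI[of _ "i + j"]) auto
qed

lemma cayley_length_one: "cayley_length_le S \<one> 0"
  by (auto simp: cayley_length_le_def)

lemma cayley_length_mono: "cayley_length_le S g c \<Longrightarrow> c \<le> d \<Longrightarrow> cayley_length_le S g d"
  unfolding cayley_length_le_def by (meson order_trans)

lemma cayley_length_generator:
  assumes "S \<subseteq> carrier \<Gamma>" "\<sigma> \<in> S"
  shows "cayley_length_le S \<sigma> 1" "cayley_length_le S (inv \<sigma>) 1"
proof -
  have s: "\<sigma> \<in> carrier \<Gamma>" using assms by auto
  have step: "\<exists>j\<le>1. (h, h') \<in> cayley_graph \<Gamma> S ^^ j"
    if "h \<in> carrier \<Gamma>" "h' \<in> carrier \<Gamma>" "h' = h \<otimes> \<sigma> \<or> h = h' \<otimes> \<sigma>" for h h'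
  proof (cases "h = h'")
    case True
    then show ?thesis by (intro exI[of _ 0]) auto
  next
    case False
    then show ?thesis using that assms(2) by (intro exI[of _ 1]) (auto simp: cayley_graph_def)
  qed
  show "cayley_length_le S \<sigma> 1"
    unfolding cayley_length_le_def using step s by auto
  have "h = h \<otimes> inv \<sigma> \<otimes> \<sigma>" if "h \<in> carrier \<Gamma>" for h
    using that s by (simp add: m_assoc)
  then show "cayley_length_le S (inv \<sigma>) 1"
    unfolding cayley_length_le_def using step s by auto
qed

lemma cayley_length_generate:
  assumes "S \<subseteq> carrier \<Gamma>" "g \<in> generate \<Gamma> S"
  shows "\<exists>c. cayley_length_le S g c"
  using assms(2)
proof induction
  case one
  then show ?case using cayley_length_one by blast
next
  case (incl h)
  then show ?case using cayley_length_generator assms by blast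
next
  case (inv h)
  then show ?case using cayley_length_generator assms by blast
next
  case (eng g h)
  then show ?case using cayley_length_mult generate_in_carrier[OF assms(1)] by blast
qed

lemma words_subset_cayley_ball:
  assumes S: "finite_generating_set \<Gamma> S" and D: "finite D" "D \<subseteq> carrier \<Gamma>"
  shows "\<exists>c. \<forall>r. words \<Gamma> D r \<subseteq> cayley_ball \<Gamma> S (c * r)"
proof -
  have "\<exists>c. cayley_length_le S d c" if "d \<in> D" for d
    using cayley_length_generate S D that unfolding finite_generating_set_def by blast
  then obtain c where c: "\<And>d. d \<in> D \<Longrightarrow> cayley_length_le S d (c d)" by metis
  define C where "C = (\<Sum>d\<in>D. c d)"
  have C: "cayley_length_le S d C" if "d \<in> D" for d
    by (rule cayley_length_mono[OF c[OF that]]) (use D that in \<open>auto simp: C_def intro: member_le_sum\<close>)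
  have len: "cayley_length_le S g (C * r)" if "g \<in> words \<Gamma> D r" for g r
    using that
  proof (induction r arbitrary: g)
    case 0
    then show ?case using cayley_length_one by simp
  next
    case (Suc r)
    then obtain d h where "d \<in> D" "h \<in> words \<Gamma> D r" "g = d \<otimes> h" by (auto simp: set_mult_def)
    then show ?case
      using cayley_length_mult[OF C Suc.IH, of d h] D words_carrier[OF D(2), of r] by auto
  qed
  have "g \<in> cayley_ball \<Gamma> S (C * r)" if g: "g \<in> words \<Gamma> D r" for g r
  proof -
    have gc: "g \<in> carrier \<Gamma>" using g words_carrier[OF D(2)] by blast
    have "\<exists>j\<le>C * r. (\<one>, g) \<in> cayley_graph \<Gamma> S ^^ j"
      using bspec[OF len[OF g, unfolded cayley_length_le_def] one_closed] l_one[OF gc] by simp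
    then show ?thesis using gc by (simp add: cayley_ball_def graph_dist_le_iff)
  qed
  then show ?thesis by blast
qed

lemma finite_cayley_ball:
  assumes "finite S" "S \<subseteq> carrier \<Gamma>"
  shows "finite (cayley_ball \<Gamma> S R)"
proof -
  have "finite {g. (\<one>, g) \<in> cayley_graph \<Gamma> S ^^ j}" for j
  proof (induction j)
    case 0
    then show ?case by simp
  next
    case (Suc j)
    have "{g. (\<one>, g) \<in> cayley_graph \<Gamma> S ^^ Suc j} \<subseteq>
        (\<lambda>(h, s). h \<otimes> s) ` ({g. (\<one>, g) \<in> cayley_graph \<Gamma> S ^^ j} \<times> (S \<union> (\<lambda>s. inv s) ` S))"
    proof
      fix g assume "g \<in> {g. (\<one>, g) \<in> cayley_graph \<Gamma> S ^^ Suc j}"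
      then obtain h where h: "(\<one>, h) \<in> cayley_graph \<Gamma> S ^^ j" "(h, g) \<in> cayley_graph \<Gamma> S" by auto
      then obtain s where s: "s \<in> S" "g = h \<otimes> s \<or> h = g \<otimes> s" "g \<in> carrier \<Gamma>" "h \<in> carrier \<Gamma>"
        by (auto simp: cayley_graph_def)
      then have "s \<in> carrier \<Gamma>" using assms by auto
      then have "g = h \<otimes> s \<or> g = h \<otimes> inv s" using s by (auto simp: m_assoc)
      then show "g \<in> (\<lambda>(h, s). h \<otimes> s) ` ({g. (\<one>, g) \<in> cayley_graph \<Gamma> S ^^ j} \<times> (S \<union> (\<lambda>s. inv s) ` S))"
        using h s by auto
    qed
    then show ?case by (rule finite_subset) (use Suc assms in auto)
  qed
  then have "finite (\<Union>j\<le>R. {g. (\<one>, g) \<in> cayley_graph \<Gamma> S ^^ j})" by blast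
  then show ?thesis
    by (rule rev_finite_subset) (auto simp: cayley_ball_def graph_dist_le_iff)
qed

lemma words_growth:
  assumes growth: "subexponential_growth \<Gamma>" and D: "finite D" "D \<subseteq> carrier \<Gamma>" and nm: "m < n"
  shows "\<exists>r. A * m ^ r * card (words \<Gamma> D r) < n ^ r"
proof (cases "m = 0")
  case True
  then show ?thesis using nm by (intro exI[of _ 1]) auto
next
  case False
  obtain S where S: "finite_generating_set \<Gamma> S"
    "\<And>\<epsilon>. \<epsilon> > 0 \<Longrightarrow> \<forall>\<^sub>F R in sequentially. real (card (cayley_ball \<Gamma> S R)) \<le> exp (\<epsilon> * real R)"
    using growth unfolding subexponential_growth_def by blast
  obtain c where c: "\<And>r. words \<Gamma> D r \<subseteq> cayley_ball \<Gamma> S (c * r)"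
    using words_subset_cayley_ball[OF S(1) D] by blast
  have c': "words \<Gamma> D r \<subseteq> cayley_ball \<Gamma> S (Suc c * r)" for r
  proof -
    have "cayley_ball \<Gamma> S (c * r) \<subseteq> cayley_ball \<Gamma> S (Suc c * r)"
      by (auto simp: cayley_ball_def graph_dist_le_iff) (meson trans_le_add2)
    then show ?thesis using c by blast
  qed
  define L where "L = ln (real n / real m)"
  have L: "L > 0" using nm False by (simp add: L_def)
  define \<epsilon> where "\<epsilon> = L / (2 * real (Suc c))"
  have "\<epsilon> > 0" using L by (simp add: \<epsilon>_def)
  then obtain R0 where R0: "\<And>R. R \<ge> R0 \<Longrightarrow> real (card (cayley_ball \<Gamma> S R)) \<le> exp (\<epsilon> * real R)"
    using S(2) unfolding eventually_sequentially by blast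
  obtain r1 :: nat where r1: "2 * real A / L < real r1" using reals_Archimedean2 by blast
  define r where "r = max R0 r1"
  have "R0 \<le> Suc c * r" by (simp add: r_def trans_le_add1 le_max_iff_disj)
  then have "real (card (cayley_ball \<Gamma> S (Suc c * r))) \<le> exp (\<epsilon> * real (Suc c * r))" by (rule R0)
  also have "\<epsilon> * real (Suc c * r) = real r * L / 2"
    unfolding \<epsilon>_def of_nat_mult by (simp add: field_simps del: of_nat_Suc)
  finally have ball: "real (card (cayley_ball \<Gamma> S (Suc c * r))) \<le> exp (real r * L / 2)" .
  have "card (words \<Gamma> D r) \<le> card (cayley_ball \<Gamma> S (Suc c * r))"
    using S(1) c' by (intro card_mono finite_cayley_ball) (auto simp: finite_generating_set_def)
  then have words: "real (card (words \<Gamma> D r)) \<le> exp (real r * L / 2)" using ball by linarith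
  have "2 * real A < L * real r1" using r1 L by (simp add: field_simps)
  also have "\<dots> \<le> L * real r" using L by (simp add: r_def)
  finally have "real A < real r * L / 2" by (simp add: mult.commute)
  also have "\<dots> < exp (real r * L / 2)" by (rule exp_gt_self) 
  finally have A: "real A < exp (real r * L / 2)" .
  have "real (A * m ^ r * card (words \<Gamma> D r)) = real m ^ r * (real A * real (card (words \<Gamma> D r)))"
    by simp
  also have "\<dots> \<le> real m ^ r * (real A * exp (real r * L / 2))"
    using words by (intro mult_left_mono) auto
  also have "\<dots> < real m ^ r * (exp (real r * L / 2) * exp (real r * L / 2))"
    using A False by (intro mult_strict_left_mono mult_strict_right_mono) auto
  also have "exp (real r * L / 2) * exp (real r * L / 2) = exp (real r * L)"
    by (simp add: exp_add[symmetric])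
  also have "\<dots> = (real n / real m) ^ r"
    using nm False by (simp add: exp_of_nat_mult L_def)
  also have "real m ^ r * (real n / real m) ^ r = real (n ^ r)"
    using False by (simp add: power_divide)
  finally show ?thesis by (intro exI[of _ r]) (simp only: of_nat_less_iff)
qed

lemma one_in_words: "\<one> \<in> D \<Longrightarrow> \<one> \<in> words \<Gamma> D j"
  by (induction j) (auto simp: set_mult_def intro!: bexI[of _ \<one>])

text \<open>
  A source without improvement in the ball of radius \<open>r\<close> would have \<open>n a(H\<^sub>j) \<le> m a(H\<^sub>j\<^sub>+\<^sub>1)\<close> for all
  \<open>j < r\<close>, hence \<open>n\<^sup>r \<le> m\<^sup>r A\<close> times the size of the ball, against \<open>words_growth\<close>.
\<close>

lemma saturating_flow_subexponential:
  assumes growth: "subexponential_growth \<Gamma>" and E: "finite E" "E \<subseteq> carrier \<Gamma>"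
    and ab: "a \<in> M \<rightarrow>\<^sub>M count_space UNIV" "b \<in> M \<rightarrow>\<^sub>M count_space UNIV" "\<And>x. x \<in> X \<Longrightarrow> a x \<le> A"
    and nm: "m < n"
    and expansion: "\<And>Y. finite Y \<Longrightarrow> Y \<subseteq> X \<Longrightarrow> n * sum a Y \<le> m * sum b (translates \<phi> E Y)"
  shows "\<exists>z. saturating_flow E a b z"
proof -
  let ?Q = "quotients E"
  have Q: "finite ?Q" "?Q \<subseteq> carrier \<Gamma>" "\<one> \<in> ?Q"
    using symmetric_nhd_quotients[OF E] by (auto simp: symmetric_nhd_def)
  obtain r where r: "A * m ^ r * card (words \<Gamma> ?Q r) < n ^ r"
    using words_growth[OF growth Q(1,2) nm] by blast
  show ?thesis
  proof (rule saturating_flow_exists[OF E finite_words[OF Q(1)] words_carrier[OF Q(2)] one_in_words[OF Q(3)] ab])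
    fix x w assume x: "x \<in> X" and w: "subflow E a b w" and unsat: "outflow E w x < a x"
    let ?H = "alternating \<phi> X E w x"
    let ?P = "words \<Gamma> ?Q r"
    have a0: "0 < a x" using unsat by simp
    have HX: "?H j \<subseteq> X" for j by (rule alternating_in_space[OF x])
    have fin: "finite (?H j)" for j by (rule finite_alternating[OF E w x a0])
    have Hr: "?H j \<subseteq> translates \<phi> ?P {x}" if "j \<le> r" for j
      using finite_alternating(1)[OF E w x a0, of r] alternating_mono[OF that] by blast
    show "improvable E a b (translates \<phi> ?P {x}) w x"
    proof (rule ccontr)
      assume no: "\<not> ?thesis"
      have sat: "b y \<le> inflow \<Gamma> \<phi> E w y" if "j \<le> r" "y \<in> translates \<phi> E (?H j)" for j y
        using improve_or_saturated[OF E w x unsat that(2)] improvable_mono[OF _ Hr[OF that(1)]] no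
        by (meson not_le_imp_less)
      have step: "n * sum a (?H j) \<le> m * sum a (?H (Suc j))" if "j \<le> r" for j
      proof -
        have "n * sum a (?H j) \<le> m * sum b (translates \<phi> E (?H j))" by (rule expansion[OF fin HX])
        also have "\<dots> \<le> m * sum (outflow E w) (?H (Suc j))"
          using saturated_expansion[OF E w x a0 sat[OF that]] by simp
        also have "\<dots> \<le> m * sum a (?H (Suc j))"
          using w HX by (intro mult_left_mono sum_mono) (auto simp: subflow_def subset_iff simp del: alternating.simps)
        finally show ?thesis .
      qed
      have "n ^ j \<le> m ^ j * sum a (?H j)" if "j \<le> r" for j
        using that
      proof (induction j)
        case 0
        then show ?case using a0 by simp
      next
        case (Suc j)
        have "n ^ Suc j \<le> n * (m ^ j * sum a (?H j))" using Suc by simp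
        also have "\<dots> = m ^ j * (n * sum a (?H j))" by simp
        also have "\<dots> \<le> m ^ j * (m * sum a (?H (Suc j)))" using step[of j] Suc.prems by simp
        finally show ?case by (simp add: mult.assoc del: alternating.simps) (simp add: ac_simps)
      qed
      then have "n ^ r \<le> m ^ r * sum a (?H r)" by simp
      also have "sum a (?H r) \<le> card (?H r) * A"
        using ab(3) HX sum_bounded_above[of "?H r" a A] by auto
      also have "card (?H r) \<le> card (words \<Gamma> ?Q r)"
      proof -
        have "card (?H r) \<le> card ((\<lambda>g. \<phi> g x) ` ?P)"
          using Hr[of r] finite_words[OF Q(1)] by (intro card_mono) (auto simp: translates_def)
        also have "\<dots> \<le> card ?P" by (rule card_image_le[OF finite_words[OF Q(1)]])
        finally show ?thesis .
      qed
      finally have "n ^ r \<le> A * m ^ r * card (words \<Gamma> ?Q r)" by (simp add: ac_simps)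
      with r show False by simp
    qed
  qed
qed

section \<open>Demands with finite components\<close>

text \<open>
  Inside a finite component the alternating sets stabilise, and a stable set \<open>H\<close> contradicts Hall's
  condition because \<open>x \<in> H\<close> is unsaturated. The components may be arbitrarily large, so no single window
  serves all of them: sources are sorted by the least radius (\<open>rank\<close>) that reaches the whole component
  from each of its points. Sources of different rank lie in different components and never share a
  sink, so the flows of all ranks can be used together.
\<close>

lemma saturating_flow_finite_components:
  assumes E: "finite E" "E \<subseteq> carrier \<Gamma>"
    and ab: "a \<in> M \<rightarrow>\<^sub>M count_space UNIV" "b \<in> M \<rightarrow>\<^sub>M count_space UNIV" "\<And>x. x \<in> X \<Longrightarrow> a x \<le> A"
    and expansion: "\<And>Y. finite Y \<Longrightarrow> Y \<subseteq> X \<Longrightarrow> sum a Y \<le> sum b (translates \<phi> E Y)"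
    and fin: "\<And>x. x \<in> X \<Longrightarrow> 0 < a x \<Longrightarrow>
      finite ((adjacency \<phi> (quotients E) {q \<in> X. 0 < a q})\<^sup>* `` {x})"
  shows "\<exists>z. saturating_flow E a b z"
proof -
  let ?Q = "quotients E"
  have nhd: "symmetric_nhd ?Q" by (rule symmetric_nhd_quotients[OF E])
  have Q: "finite ?Q" "?Q \<subseteq> carrier \<Gamma>" "\<one> \<in> ?Q" using nhd by (auto simp: symmetric_nhd_def)
  define V where "V = {q \<in> X. 0 < a q}"
  have VX: "V \<subseteq> X" by (auto simp: V_def)
  have Vm: "V \<in> sets M" unfolding V_def using measurable_nat_rel[OF ab(1) ab(1), of "\<lambda>i j. 0 < i"] by simp
  define R where "R = adjacency \<phi> ?Q V"
  have Rsym: "(p, q) \<in> R \<Longrightarrow> (q, p) \<in> R" for p q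
    unfolding R_def by (rule adjacency_sym[OF nhd VX])
  have Rssym: "(p, q) \<in> R\<^sup>* \<Longrightarrow> (q, p) \<in> R\<^sup>*" for p q
    using Rsym by (meson sym_rtrancl symD symI)
  have Rmono: "(x, y) \<in> R ^^ j" if "(x, y) \<in> R ^^ i" "i \<le> j" "x \<in> V" for x y i j
    using adjacency_relpow_mono[OF nhd VX that(3,2)] that(1) by (simp add: R_def)
  have RV: "q \<in> V" if "(p, q) \<in> R\<^sup>*" "p \<in> V" for p q
    using that by (induction rule: rtrancl_induct) (auto simp: R_def adjacency_def)
  have Rwords: "\<exists>g\<in>words \<Gamma> ?Q j. y = \<phi> g x" if "(x, y) \<in> R ^^ j" "x \<in> V" for x y j
    using adjacency_relpow_words[OF Q(2) VX] that by (simp add: R_def)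
  have Rm: "{x \<in> X. (x, \<phi> g x) \<in> R ^^ j} \<in> sets M" if "g \<in> words \<Gamma> ?Q i" for g i j
    unfolding R_def using that words_carrier[OF Q(2)]
    by (intro adjacency_relpow_measurable[OF Q(2,1) Vm]) auto
  \<comment> \<open>\<open>St r\<close>: the component is contained in the ball of radius \<open>r\<close>; \<open>W r\<close>: this holds from all points of the component.\<close>
  define St where "St r = {x \<in> V. \<forall>g\<in>words \<Gamma> ?Q (Suc r). (x, \<phi> g x) \<in> R ^^ Suc r \<longrightarrow> (x, \<phi> g x) \<in> R ^^ r}" for r
  have St_iff: "x \<in> St r \<longleftrightarrow> x \<in> V \<and> (\<forall>q. (x, q) \<in> R\<^sup>* \<longrightarrow> (x, q) \<in> R ^^ r)" for x r
  proof
    assume x: "x \<in> St r"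
    then have xV: "x \<in> V" by (simp add: St_def)
    have "(x, q) \<in> R ^^ r" if "(x, q) \<in> R\<^sup>*" for q
      using that
    proof (induction rule: rtrancl_induct)
      case base
      have "(x, x) \<in> R ^^ 0" by simp
      then show ?case using Rmono[of x x 0 r] xV by blast
    next
      case (step p q)
      then have pq: "(x, q) \<in> R ^^ Suc r" by auto
      then obtain g where "g \<in> words \<Gamma> ?Q (Suc r)" "q = \<phi> g x" using Rwords xV by blast
      then show ?case using x pq by (auto simp: St_def simp del: relpow.simps words.simps)
    qed
    then show "x \<in> V \<and> (\<forall>q. (x, q) \<in> R\<^sup>* \<longrightarrow> (x, q) \<in> R ^^ r)" using xV by blast
  next
    assume "x \<in> V \<and> (\<forall>q. (x, q) \<in> R\<^sup>* \<longrightarrow> (x, q) \<in> R ^^ r)"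
    then show "x \<in> St r" unfolding St_def by (blast intro: relpow_imp_rtrancl)
  qed
  have Stm: "St r \<in> sets M" for r
  proof -
    have "St r = V \<inter> {x \<in> X. \<forall>g\<in>words \<Gamma> ?Q (Suc r). (x, \<phi> g x) \<in> R ^^ Suc r \<longrightarrow> (x, \<phi> g x) \<in> R ^^ r}"
      using VX by (auto simp: St_def)
    also have "\<dots> \<in> sets M"
      by (intro sets.Int Vm sets.sets_Collect_finite_All sets.sets_Collect_imp finite_words Q) (rule Rm; assumption)+
    finally show ?thesis .
  qed
  define W where "W r = {x \<in> St r. \<forall>g\<in>words \<Gamma> ?Q r. (x, \<phi> g x) \<in> R ^^ r \<longrightarrow> \<phi> g x \<in> St r}" for r
  have W_iff: "x \<in> W r \<longleftrightarrow> x \<in> V \<and> (\<forall>p. (x, p) \<in> R\<^sup>* \<longrightarrow> p \<in> St r)" for x r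
  proof
    assume x: "x \<in> W r"
    then have xV: "x \<in> V" and xS: "x \<in> St r" by (simp_all add: W_def St_def)
    have "p \<in> St r" if "(x, p) \<in> R\<^sup>*" for p
    proof -
      have "(x, p) \<in> R ^^ r" using xS that St_iff by blast
      then show ?thesis using Rwords[of x p r] xV x unfolding W_def by blast
    qed
    then show "x \<in> V \<and> (\<forall>p. (x, p) \<in> R\<^sup>* \<longrightarrow> p \<in> St r)" using xV by blast
  next
    assume "x \<in> V \<and> (\<forall>p. (x, p) \<in> R\<^sup>* \<longrightarrow> p \<in> St r)"
    then show "x \<in> W r" unfolding W_def by (blast intro: relpow_imp_rtrancl)
  qed
  have Wm: "W r \<in> sets M" for r
  proof -
    have "W r = St r \<inter> {x \<in> X. \<forall>g\<in>words \<Gamma> ?Q r. (x, \<phi> g x) \<in> R ^^ r \<longrightarrow> \<phi> g x \<in> St r}"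
      using VX by (auto simp: W_def St_def)
    also have "\<dots> \<in> sets M"
      using words_carrier[OF Q(2), of r]
      by (intro sets.Int Stm sets.sets_Collect_finite_All sets.sets_Collect_imp finite_words Q)
        ((rule Rm; assumption) | (rule act_preimage[OF _ Stm]; blast))+
    finally show ?thesis .
  qed
  have W_ex: "\<exists>r. x \<in> W r" if xV: "x \<in> V" for x
  proof -
    let ?C = "R\<^sup>* `` {x}"
    have finC: "finite ?C" using fin[of x] xV by (simp add: V_def R_def)
    have conn: "(p, q) \<in> R\<^sup>*" if "p \<in> ?C" "q \<in> ?C" for p q
      using that Rssym[of x p] by (auto intro: rtrancl_trans)
    then have "\<forall>e\<in>?C \<times> ?C. \<exists>k. e \<in> R ^^ k" using rtrancl_imp_relpow by (metis mem_Sigma_iff surj_pair)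
    then obtain k where k: "\<And>e. e \<in> ?C \<times> ?C \<Longrightarrow> e \<in> R ^^ k e" by metis
    define r where "r = (\<Sum>e\<in>?C \<times> ?C. k e)"
    have kr: "k e \<le> r" if "e \<in> ?C \<times> ?C" for e
      unfolding r_def using that finC by (intro member_le_sum) auto
    have "p \<in> St r" if p: "p \<in> ?C" for p
    proof -
      have pV: "p \<in> V" using RV[of x p] p xV by auto
      have "(p, q) \<in> R ^^ r" if "(p, q) \<in> R\<^sup>*" for q
      proof -
        have "(p, q) \<in> ?C \<times> ?C" using p that by (auto intro: rtrancl_trans)
        then show ?thesis using Rmono[OF k kr pV] by blast
      qed
      then show ?thesis using pV St_iff by blast
    qed
    then show ?thesis using W_iff xV by blast
  qed
  have W_inv: "p \<in> W r \<longleftrightarrow> x \<in> W r" if "(x, p) \<in> R\<^sup>*" "x \<in> V" for x p r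
    unfolding W_iff using RV[OF that] that Rssym[OF that(1)] by (meson rtrancl_trans)
  define rank where "rank x = (LEAST r. x \<in> W r)" for x
  have rank_inv: "rank p = rank x" if "(x, p) \<in> R\<^sup>*" "x \<in> V" for x p
    unfolding rank_def using W_inv[OF that] by simp
  have rank_W: "x \<in> W (rank x)" if "x \<in> V" for x
    unfolding rank_def using W_ex[OF that] by (rule LeastI_ex)
  have rankm: "rank \<in> M \<rightarrow>\<^sub>M count_space UNIV"
    unfolding rank_def using Wm by (intro measurable_Least) auto
  define a' where "a' r x = (if rank x = r then a x else 0)" for r x
  have a'm: "a' r \<in> M \<rightarrow>\<^sub>M count_space UNIV" for r
    unfolding a'_def using measurable_nat_op[OF rankm ab(1), of "\<lambda>i j. if i = r then j else 0"] by simp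
  have "\<exists>z. saturating_flow E (a' r) b z" for r
  proof (rule saturating_flow_exists[OF E finite_words[OF Q(1)] words_carrier[OF Q(2)] one_in_words[OF Q(3)] a'm ab(2)])
    show "a' r x \<le> A" if "x \<in> X" for x using ab(3)[OF that] by (simp add: a'_def)
    fix x w assume x: "x \<in> X" and w: "subflow E (a' r) b w" and unsat: "outflow E w x < a' r x"
    let ?H = "alternating \<phi> X E w x"
    let ?P = "words \<Gamma> ?Q r"
    have a0: "0 < a' r x" using unsat by simp
    then have xV: "x \<in> V" and rx: "rank x = r" using x by (auto simp: V_def a'_def split: if_splits)
    have HX: "?H j \<subseteq> X" for j by (rule alternating_in_space[OF x])
    have fin_H: "finite (?H j)" for j by (rule finite_alternating[OF E w x a0])
    have H_C: "?H j \<subseteq> R\<^sup>* `` {x}" for j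
    proof
      fix p assume "p \<in> ?H j"
      then have "(x, p) \<in> adjacency \<phi> ?Q {q \<in> X. 0 < a' r q} ^^ j" by (rule alternating_adjacency[OF E w x a0])
      then have "(x, p) \<in> (adjacency \<phi> ?Q {q \<in> X. 0 < a' r q})\<^sup>*" by (rule relpow_imp_rtrancl)
      moreover have "adjacency \<phi> ?Q {q \<in> X. 0 < a' r q} \<subseteq> R"
        by (auto simp: R_def adjacency_def V_def a'_def split: if_splits)
      ultimately show "p \<in> R\<^sup>* `` {x}" using rtrancl_mono by blast
    qed
    have "x \<in> St r" using rank_W[OF xV] rx by (simp add: W_def)
    then have C_P: "R\<^sup>* `` {x} \<subseteq> translates \<phi> ?P {x}"
      using St_iff[of x r] Rwords[of x _ r] xV by (fastforce simp: translates_def)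
    have "\<exists>j. ?H (Suc j) = ?H j"
    proof (rule ccontr)
      assume "\<not> ?thesis"
      then have strict: "?H j \<subset> ?H (Suc j)" for j using alternating_mono[OF le_SucI[OF order_refl], of E w x j] by blast
      have "j \<le> card (?H j)" for j
      proof (induction j)
        case (Suc j)
        have "card (?H j) < card (?H (Suc j))" by (rule psubset_card_mono[OF fin_H strict])
        then show ?case using Suc by simp
      qed simp
      then have "Suc (card (R\<^sup>* `` {x})) \<le> card (?H (Suc (card (R\<^sup>* `` {x}))))" by blast
      also have "\<dots> \<le> card (R\<^sup>* `` {x})"
        by (rule card_mono[OF _ H_C]) (use fin[of x] xV in \<open>simp add: V_def R_def\<close>)
      finally show False by simp
    qed
    then obtain j where j: "?H (Suc j) = ?H j" by blast
    show "improvable E (a' r) b (translates \<phi> ?P {x}) w x"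
    proof (rule ccontr)
      assume no: "\<not> ?thesis"
      have HP: "?H j \<subseteq> translates \<phi> ?P {x}" using H_C C_P by blast
      have sat: "b y \<le> inflow \<Gamma> \<phi> E w y" if "y \<in> translates \<phi> E (?H j)" for y
        using improve_or_saturated[OF E w x unsat that] improvable_mono[OF _ HP] no
        by (meson not_le_imp_less)
      have "sum b (translates \<phi> E (?H j)) \<le> sum (outflow E w) (?H j)"
        using saturated_expansion[OF E w x a0, of j, unfolded j] sat by blast
      also have "\<dots> < sum (a' r) (?H j)"
      proof (rule sum_strict_mono_ex1[OF fin_H])
        show "\<forall>p\<in>?H j. outflow E w p \<le> a' r p" using w HX[of j] by (auto simp: subflow_def)
        have "x \<in> ?H j" using alternating_mono[of 0 j E w x] by auto
        then show "\<exists>p\<in>?H j. outflow E w p < a' r p" using unsat by blast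
      qed
      also have "\<dots> \<le> sum a (?H j)" by (rule sum_mono) (simp add: a'_def)
      also have "\<dots> \<le> sum b (translates \<phi> E (?H j))" by (rule expansion[OF fin_H HX])
      finally show False by simp
    qed
  qed
  then have "\<forall>r. \<exists>z. saturating_flow E (a' r) b z" by blast
  then obtain Z where "\<forall>r. saturating_flow E (a' r) b (Z r)" by (rule choice[THEN exE])
  then have Z: "\<And>r. measurable_flow E (Z r)" "\<And>r. subflow E (a' r) b (Z r)"
    "\<And>r x. x \<in> X \<Longrightarrow> outflow E (Z r) x = a' r x"
    by (simp_all add: saturating_flow_def)
  define z where "z \<gamma> x = Z (rank x) \<gamma> x" for \<gamma> x
  have "measurable_flow E z"
    unfolding measurable_flow_def
  proof (intro conjI ballI E)
    fix \<gamma> assume "\<gamma> \<in> E"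
    then have "Z r \<gamma> \<in> M \<rightarrow>\<^sub>M count_space UNIV" for r
      using Z(1)[of r] by (simp add: measurable_flow_def)
    then show "z \<gamma> \<in> M \<rightarrow>\<^sub>M count_space UNIV"
      unfolding z_def by (rule measurable_compose_countable[OF _ rankm])
  qed
  moreover have out: "outflow E z x = a x" if "x \<in> X" for x
    using Z(3)[OF that, of "rank x"] by (simp add: outflow_def z_def a'_def)
  moreover have "inflow \<Gamma> \<phi> E z y \<le> b y" if y: "y \<in> X" for y
  proof (cases "\<exists>\<gamma>\<in>E. 0 < z \<gamma> (\<phi> (inv \<gamma>) y)")
    case False
    then show ?thesis by (simp add: inflow_def)
  next
    case True
    then obtain \<gamma> where g: "\<gamma> \<in> E" "0 < z \<gamma> (\<phi> (inv \<gamma>) y)" by blast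
    have src: "\<phi> (inv \<delta>) y \<in> V" if "\<delta> \<in> E" "0 < z \<delta> (\<phi> (inv \<delta>) y)" for \<delta>
    proof -
      have X: "\<phi> (inv \<delta>) y \<in> X" using that E y act_closed by auto
      have "z \<delta> (\<phi> (inv \<delta>) y) \<le> outflow E z (\<phi> (inv \<delta>) y)"
        unfolding outflow_def using that E by (intro member_le_sum) auto
      then show ?thesis using X out[OF X] that by (simp add: V_def)
    qed
    let ?r = "rank (\<phi> (inv \<gamma>) y)"
    have "z \<delta> (\<phi> (inv \<delta>) y) \<le> Z ?r \<delta> (\<phi> (inv \<delta>) y)" if d: "\<delta> \<in> E" for \<delta>
    proof (cases "0 < z \<delta> (\<phi> (inv \<delta>) y)")
      case True
      have c: "\<gamma> \<in> carrier \<Gamma>" "\<delta> \<in> carrier \<Gamma>" using g d E by auto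
      have "\<phi> (inv \<delta>) y = \<phi> (inv \<delta> \<otimes> \<gamma>) (\<phi> (inv \<gamma>) y)"
        using c y by (simp add: composition_rule act_closed act_act_inv)
      moreover have "inv \<delta> \<otimes> \<gamma> \<in> ?Q"
        using g d by (auto simp: quotients_def intro: image_eqI[of _ _ "(\<delta>, \<gamma>)"])
      ultimately have "(\<phi> (inv \<gamma>) y, \<phi> (inv \<delta>) y) \<in> R"
        using src[OF g] src[OF d True] by (auto simp: R_def adjacency_def)
      then have "rank (\<phi> (inv \<delta>) y) = ?r" using rank_inv src[OF g] by blast
      then show ?thesis by (simp add: z_def)
    qed simp
    then have "inflow \<Gamma> \<phi> E z y \<le> inflow \<Gamma> \<phi> E (Z ?r) y"
      unfolding inflow_def by (intro sum_mono)
    also have "\<dots> \<le> b y" using Z(2) y by (simp add: subflow_def)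
    finally show ?thesis .
  qed
  ultimately show ?thesis by (intro exI[of _ z]) (simp add: saturating_flow_def subflow_def)
qed

section \<open>Covers from the asymptotic separation index\<close>

definition finite_components :: "'g set \<Rightarrow> 'x set \<Rightarrow> bool" where
  "finite_components D U \<longleftrightarrow> (\<forall>x\<in>U. finite ((adjacency \<phi> D U)\<^sup>* `` {x}))"

text \<open>
  The condition \<open>asi \<le> s\<close> in terms of finite sets of group elements instead of powers of a Schreier
  graph. The sequence continues beyond \<open>s\<close> (with empty sets) so that functions defined by the first
  member containing a point are measurable without case distinctions.
\<close>

definition has_finite_covers :: "nat \<Rightarrow> bool" where
  "has_finite_covers s \<longleftrightarrow> (\<forall>D. finite D \<longrightarrow> D \<subseteq> carrier \<Gamma> \<longrightarrow>
    (\<exists>U :: nat \<Rightarrow> 'x set. (\<forall>i. U i \<in> sets M \<and> finite_components D (U i)) \<and> X = (\<Union>i\<le>s. U i)))"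

lemma finite_components_of_graph_finite:
  assumes near: "\<And>d x. d \<in> D \<Longrightarrow> x \<in> X \<Longrightarrow> \<exists>j\<le>k. (x, \<phi> d x) \<in> G ^^ j"
    and U: "graph_finite (graph_power X G k) U" "U \<subseteq> X"
  shows "finite_components D U"
  unfolding finite_components_def
proof
  fix x assume x: "x \<in> U"
  let ?P = "graph_power X G k \<inter> U \<times> U"
  have "adjacency \<phi> D U \<subseteq> ?P\<^sup>="
  proof (rule subrelI)
    fix p q assume "(p, q) \<in> adjacency \<phi> D U"
    then obtain d where d: "p \<in> U" "q \<in> U" "d \<in> D" "q = \<phi> d p" by (auto simp: adjacency_def)
    then have "\<exists>j\<le>k. (p, q) \<in> G ^^ j" using near[of d p] U(2) by auto
    then show "(p, q) \<in> ?P\<^sup>=" using d U(2) by (auto simp: graph_power_iff)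
  qed
  then have "(adjacency \<phi> D U)\<^sup>* \<subseteq> ?P\<^sup>*" by (metis rtrancl_mono rtrancl_reflcl)
  then have "(adjacency \<phi> D U)\<^sup>* `` {x} \<subseteq> {y. (x, y) \<in> ?P\<^sup>*}" by blast
  moreover have "finite {y. (x, y) \<in> ?P\<^sup>*}" using U(1) x unfolding graph_finite_def by blast
  ultimately show "finite ((adjacency \<phi> D U)\<^sup>* `` {x})" by (rule finite_subset)
qed

lemma has_finite_covers_of_asi:
  assumes "asi_action \<Gamma> M \<phi> < \<infinity>"
  shows "\<exists>s. has_finite_covers s"
proof -
  obtain S where S: "finite_generating_set \<Gamma> S" "asi M (schreier_graph X \<phi> S) < \<infinity>"
    using assms unfolding asi_action_def INF_less_iff by blast
  let ?G = "schreier_graph X \<phi> S"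
  obtain s :: nat where s: "\<And>k. \<exists>U :: nat \<Rightarrow> 'x set.
      (\<forall>i\<le>s. U i \<in> sets M \<and> graph_finite (graph_power X ?G k) (U i)) \<and> (\<Union>i\<le>s. U i) = X"
    using S(2) unfolding asi_def INF_less_iff by blast
  have "has_finite_covers s"
    unfolding has_finite_covers_def
  proof (intro allI impI)
    fix D assume D: "finite D" "D \<subseteq> carrier \<Gamma>"
    have "\<exists>c. \<forall>x\<in>X. \<exists>j\<le>c. (x, \<phi> d x) \<in> ?G ^^ j" if "d \<in> D" for d
      using schreier_word[OF group_action_axioms, of S d] S(1) D that
      unfolding finite_generating_set_def by blast
    then obtain c where c: "\<And>d x. d \<in> D \<Longrightarrow> x \<in> X \<Longrightarrow> \<exists>j\<le>c d. (x, \<phi> d x) \<in> ?G ^^ j" by metis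
    define k where "k = (\<Sum>d\<in>D. c d)"
    have ck: "c d \<le> k" if "d \<in> D" for d unfolding k_def using D that by (intro member_le_sum) auto
    have near: "\<exists>j\<le>k. (x, \<phi> d x) \<in> ?G ^^ j" if "d \<in> D" "x \<in> X" for d x
      using c[OF that] ck[OF that(1)] by (meson order_trans)
    obtain U :: "nat \<Rightarrow> 'x set" where U: "\<And>i. i \<le> s \<Longrightarrow> U i \<in> sets M"
      "\<And>i. i \<le> s \<Longrightarrow> graph_finite (graph_power X ?G k) (U i)" "(\<Union>i\<le>s. U i) = X"
      using s[of k] by blast
    let ?U = "\<lambda>i. if i \<le> s then U i else {}"
    have "?U i \<in> sets M \<and> finite_components D (?U i)" for i
    proof (cases "i \<le> s")
      case True
      then show ?thesis
        using U(1)[of i] finite_components_of_graph_finite[OF near U(2)[OF True]] sets.sets_into_space[OF U(1)[OF True]]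
        by auto
    qed (simp add: finite_components_def)
    moreover have "X = (\<Union>i\<le>s. ?U i)" using U(3) by auto
    ultimately show "\<exists>U :: nat \<Rightarrow> 'x set. (\<forall>i. U i \<in> sets M \<and> finite_components D (U i)) \<and> X = (\<Union>i\<le>s. U i)"
      by (intro exI[of _ ?U]) blast
  qed
  then show ?thesis ..
qed

text \<open>
  A \<open>D\<close>-path in \<open>V\<close> projects to a path in \<open>U\<close> whose steps are products \<open>g\<^sup>-\<^sup>1 d h\<close>.
\<close>

lemma finite_components_thicken:
  assumes G: "finite G" "G \<subseteq> carrier \<Gamma>" and D: "D \<subseteq> carrier \<Gamma>" and U: "U \<subseteq> X"
    and fin: "finite_components ((\<lambda>(g, d, h). inv g \<otimes> d \<otimes> h) ` (G \<times> D \<times> G)) U"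
    and V: "V \<subseteq> translates \<phi> G U"
  shows "finite_components D V"
  unfolding finite_components_def
proof
  let ?D = "(\<lambda>(g, d, h). inv g \<otimes> d \<otimes> h) ` (G \<times> D \<times> G)"
  fix x assume "x \<in> V"
  then obtain g u where u: "g \<in> G" "u \<in> U" "x = \<phi> g u" using V by (auto simp: translates_def)
  let ?C = "(adjacency \<phi> ?D U)\<^sup>* `` {u}"
  have CU: "v \<in> U" if "v \<in> ?C" for v
    using that u(2) by (auto elim: rtrancl_induct simp: adjacency_def)
  have "y \<in> translates \<phi> G ?C" if "(x, y) \<in> (adjacency \<phi> D V)\<^sup>*" for y
    using that
  proof (induction rule: rtrancl_induct)
    case base
    then show ?case using u by (auto simp: translates_def)
  next
    case (step y y')
    then obtain h v where v: "h \<in> G" "v \<in> ?C" "y = \<phi> h v" by (auto simp: translates_def)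
    obtain d where d: "d \<in> D" "y' = \<phi> d y" "y' \<in> V" using step by (auto simp: adjacency_def)
    then obtain h' v' where v': "h' \<in> G" "v' \<in> U" "y' = \<phi> h' v'" using V by (auto simp: translates_def)
    have X: "v \<in> X" "v' \<in> X" using CU[OF v(2)] v' U by auto
    have c: "h \<in> carrier \<Gamma>" "h' \<in> carrier \<Gamma>" "d \<in> carrier \<Gamma>" using v v' d G D by auto
    have "v' = \<phi> (inv h') (\<phi> d (\<phi> h v))" using v v' d act_inv_act[OF c(2) X(2)] by simp
    also have "\<dots> = \<phi> (inv h' \<otimes> d \<otimes> h) v" using c X by (simp add: composition_rule act_closed)
    finally have e: "v' = \<phi> (inv h' \<otimes> d \<otimes> h) v" .
    have "inv h' \<otimes> d \<otimes> h \<in> ?D" using v v' d by (intro image_eqI[of _ _ "(h', d, h)"]) auto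
    then have "(v, v') \<in> adjacency \<phi> ?D U"
      using e CU[OF v(2)] v'(2) unfolding adjacency_def by blast
    then have "v' \<in> ?C" using v(2) by (auto intro: rtrancl_into_rtrancl)
    then show ?case using v' by (auto simp: translates_def)
  qed
  then have "(adjacency \<phi> D V)\<^sup>* `` {x} \<subseteq> translates \<phi> G ?C" by blast
  moreover have "finite ?C" using fin u(2) unfolding finite_components_def by blast
  ultimately show "finite ((adjacency \<phi> D V)\<^sup>* `` {x})"
    using finite_translates[OF G(1)] finite_subset by blast
qed

lemma finite_cover_thickened:
  assumes "has_finite_covers s" and G: "finite G" "G \<subseteq> carrier \<Gamma>" and D: "finite D" "D \<subseteq> carrier \<Gamma>"
  obtains U :: "nat \<Rightarrow> 'x set" where "\<And>i. U i \<in> sets M" "X = (\<Union>i\<le>s. U i)"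
    "\<And>i V. V \<subseteq> translates \<phi> G (U i) \<Longrightarrow> finite_components D V"
proof -
  define D' where "D' = (\<lambda>(g, d, h). inv g \<otimes> d \<otimes> h) ` (G \<times> D \<times> G)"
  have "finite D'" "D' \<subseteq> carrier \<Gamma>" unfolding D'_def using G D by (auto simp: subset_iff)
  then obtain U :: "nat \<Rightarrow> 'x set" where U: "\<forall>i. U i \<in> sets M \<and> finite_components D' (U i)" "X = (\<Union>i\<le>s. U i)"
    using assms(1) unfolding has_finite_covers_def by meson
  show thesis
  proof (rule that[of U])
    show "U i \<in> sets M" for i using U(1) by simp
    show "finite_components D V" if "V \<subseteq> translates \<phi> G (U i)" for i V
      by (rule finite_components_thicken[OF G D(2) _ _ that])
        (use U(1) sets.sets_into_space in \<open>auto simp: D'_def\<close>)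
  qed (rule U(2))
qed

lemma words_mono:
  assumes "\<one> \<in> D" "D \<subseteq> carrier \<Gamma>" "i \<le> j"
  shows "words \<Gamma> D i \<subseteq> words \<Gamma> D j"
  using assms(3)
proof (induction rule: dec_induct)
  case (step k)
  have "words \<Gamma> D k \<subseteq> words \<Gamma> D (Suc k)"
  proof
    fix g assume g: "g \<in> words \<Gamma> D k"
    then have "g = \<one> \<otimes> g" using words_carrier[OF assms(2), of k] by auto
    then show "g \<in> words \<Gamma> D (Suc k)" using g assms(1) by (auto simp: set_mult_def)
  qed
  then show ?case using step by blast
qed simp

section \<open>A Borel fractional flow\<close>

text \<open>
  For each cover set \<open>U i\<close> there is a Borel flow \<open>f i\<close> that sends \<open>n\<close> units for each unit of \<open>a\<close> near
  \<open>U i\<close> and loads each sink by at most \<open>m b\<close>. At level \<open>t < K\<close> the source \<open>x\<close> follows the first \<open>f i\<close> for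
  which \<open>x\<close> lies in the \<open>t\<close>-fold thickening \<open>V i t\<close> of \<open>U i\<close>, and the flows of all levels are added. A
  level at which all sources of a sink make the same choice loads the sink by at most \<open>m b\<close>, any other
  level by at most \<open>(s + 1) m b\<close>. For fixed \<open>i\<close>, the boundary of \<open>V i t\<close> separates the sources of a given
  sink for at most one \<open>t\<close>, so there are at most \<open>s + 1\<close> levels of the second kind.
\<close>

lemma measurable_fractional_flow:
  assumes covers: "has_finite_covers s" and E: "finite E" "E \<subseteq> carrier \<Gamma>"
    and ab: "a \<in> M \<rightarrow>\<^sub>M count_space UNIV" "b \<in> M \<rightarrow>\<^sub>M count_space UNIV" "\<And>x. x \<in> X \<Longrightarrow> a x \<le> A"
    and nm: "m < n"
    and expansion: "\<And>Y. finite Y \<Longrightarrow> Y \<subseteq> X \<Longrightarrow> n * sum a Y \<le> m * sum b (translates \<phi> E Y)"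
  shows "\<exists>n' m' z. m' < n' \<and> measurable_flow E z \<and> (\<forall>x\<in>X. outflow E z x = n' * a x) \<and>
    (\<forall>y\<in>X. inflow \<Gamma> \<phi> E z y \<le> m' * b y)"
proof -
  define Q where "Q = quotients E"
  have Q: "finite Q" "Q \<subseteq> carrier \<Gamma>" "\<one> \<in> Q"
    using symmetric_nhd_quotients[OF E] by (auto simp: symmetric_nhd_def Q_def)
  \<comment> \<open>With this many levels the loss \<open>m (s + 1)\<^sup>2\<close> is smaller than the gain \<open>(n - m) K\<close>.\<close>
  define K where "K = m * ((s + 1) * (s + 1)) + 1"
  obtain U :: "nat \<Rightarrow> 'x set" where U: "\<And>i. U i \<in> sets M" "X = (\<Union>i\<le>s. U i)"
    "\<And>i V. V \<subseteq> translates \<phi> (words \<Gamma> Q K) (U i) \<Longrightarrow> finite_components Q V"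
    using finite_cover_thickened[OF covers finite_words[OF Q(1), of K] words_carrier[OF Q(2), of K] Q(1,2)] by metis
  have UX: "U i \<subseteq> X" for i using sets.sets_into_space[OF U(1)] .
  define V where "V i t = translates \<phi> (words \<Gamma> Q t) (U i)" for i t
  have Vm: "V i t \<in> sets M" for i t
    unfolding V_def by (intro translates_sets finite_words words_carrier Q U)
  have VX: "V i t \<subseteq> X" for i t using sets.sets_into_space[OF Vm] .
  have Vmono: "V i t \<subseteq> V i t'" if "t \<le> t'" for i t t'
    unfolding V_def using words_mono[OF Q(3,2) that] by (intro translates_mono) auto
  have UV: "U i \<subseteq> V i t" for i t
  proof -
    have "U i = V i 0" using translates_one[OF UX] by (simp add: V_def)
    then show ?thesis using Vmono[of 0 t i] by simp
  qed
  have Vstep: "\<phi> d x \<in> V i (Suc t)" if x: "x \<in> V i t" and d: "d \<in> Q" for d x i t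
  proof -
    obtain g u where g: "g \<in> words \<Gamma> Q t" "u \<in> U i" "x = \<phi> g u" using x by (auto simp: V_def translates_def)
    have "\<phi> d x = \<phi> (d \<otimes> g) u"
      using g d Q words_carrier[OF Q(2), of t] UX[of i] composition_rule[of u d g] by (auto simp: subset_iff)
    moreover have "d \<otimes> g \<in> words \<Gamma> Q (Suc t)" using g d by (auto simp: set_mult_def)
    ultimately show ?thesis using g(2) unfolding V_def translates_def by blast
  qed
  define a' where "a' i x = (if x \<in> V i K then n * a x else 0)" for i x
  have a'm: "a' i \<in> M \<rightarrow>\<^sub>M count_space UNIV" for i
    unfolding a'_def using measurable_nat_op[OF ab(1) ab(1), of "\<lambda>i j. n * i"] Vm
    by (intro measurable_nat_restrict) auto
  have mbm: "(\<lambda>y. m * b y) \<in> M \<rightarrow>\<^sub>M count_space UNIV"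
    using measurable_nat_op[OF ab(2) ab(2), of "\<lambda>i j. m * i"] .
  have "\<exists>z. saturating_flow E (a' i) (\<lambda>y. m * b y) z" for i
  proof (rule saturating_flow_finite_components[OF E a'm mbm])
    show "a' i x \<le> n * A" if "x \<in> X" for x using ab(3)[OF that] by (simp add: a'_def)
    show "sum (a' i) Y \<le> (\<Sum>y\<in>translates \<phi> E Y. m * b y)" if "finite Y" "Y \<subseteq> X" for Y
    proof -
      have "sum (a' i) Y \<le> (\<Sum>x\<in>Y. n * a x)" by (rule sum_mono) (simp add: a'_def)
      also have "\<dots> \<le> m * sum b (translates \<phi> E Y)" using expansion[OF that] by (simp add: sum_distrib_left)
      finally show ?thesis by (simp add: sum_distrib_left)
    qed
    show "finite ((adjacency \<phi> (quotients E) {q \<in> X. 0 < a' i q})\<^sup>* `` {x})" if "x \<in> X" "0 < a' i x" for x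
    proof -
      have "finite_components Q {q \<in> X. 0 < a' i q}"
        by (rule U(3)[of _ i]) (auto simp: a'_def V_def split: if_splits)
      then show ?thesis using that unfolding finite_components_def Q_def by blast
    qed
  qed
  then have "\<forall>i. \<exists>z. saturating_flow E (a' i) (\<lambda>y. m * b y) z" by blast
  then obtain f where "\<forall>i. saturating_flow E (a' i) (\<lambda>y. m * b y) (f i)" by (rule choice[THEN exE])
  then have f: "\<And>i \<gamma>. \<gamma> \<in> E \<Longrightarrow> f i \<gamma> \<in> M \<rightarrow>\<^sub>M count_space UNIV"
    "\<And>i y. y \<in> X \<Longrightarrow> inflow \<Gamma> \<phi> E (f i) y \<le> m * b y" "\<And>i x. x \<in> X \<Longrightarrow> outflow E (f i) x = a' i x"
    by (simp_all add: saturating_flow_def measurable_flow_def subflow_def)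
  define c where "c t x = (LEAST i. x \<in> V i t)" for t x
  have cm: "c t \<in> M \<rightarrow>\<^sub>M count_space UNIV" for t
    unfolding c_def using Vm by (intro measurable_Least) auto
  have c: "c t x \<le> s" "x \<in> V (c t x) t" if x: "x \<in> X" for t x
  proof -
    obtain i where i: "i \<le> s" "x \<in> U i" using x U(2) by auto
    then have "x \<in> V i t" using UV by blast
    then show "x \<in> V (c t x) t" unfolding c_def by (rule LeastI)
    have "c t x \<le> i" unfolding c_def by (rule Least_le) fact
    with i show "c t x \<le> s" by simp
  qed
  define z where "z \<gamma> x = (\<Sum>t<K. f (c t x) \<gamma> x)" for \<gamma> x
  have "measurable_flow E z"
    unfolding measurable_flow_def
  proof (intro conjI ballI E)
    fix \<gamma> assume g: "\<gamma> \<in> E"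
    show "z \<gamma> \<in> M \<rightarrow>\<^sub>M count_space UNIV"
      unfolding z_def
      by (rule measurable_nat_sum) (rule measurable_compose_countable[OF f(1)[OF g] cm])
  qed
  moreover have "outflow E z x = n * K * a x" if x: "x \<in> X" for x
  proof -
    have "outflow E z x = (\<Sum>t<K. outflow E (f (c t x)) x)"
      unfolding outflow_def z_def by (rule sum.swap)
    also have "\<dots> = (\<Sum>t<K. n * a x)"
    proof (rule sum.cong)
      fix t assume "t \<in> {..<K}"
      then have "x \<in> V (c t x) K" using c(2)[OF x, of t] Vmono[of t K "c t x"] by auto
      then show "outflow E (f (c t x)) x = n * a x" using f(3)[OF x] by (simp add: a'_def)
    qed simp
    finally show ?thesis by (simp add: ac_simps)
  qed
  moreover have "inflow \<Gamma> \<phi> E z y \<le> m * (K + (s + 1) * (s + 1)) * b y" if y: "y \<in> X" for y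
  proof -
    define L where "L t = (\<Sum>\<gamma>\<in>E. f (c t (\<phi> (inv \<gamma>) y)) \<gamma> (\<phi> (inv \<gamma>) y))" for t
    have src: "\<phi> (inv \<gamma>) y \<in> X" if "\<gamma> \<in> E" for \<gamma> using that E y act_closed by auto
    have L_all: "L t \<le> (s + 1) * (m * b y)" for t
    proof -
      have "L t \<le> (\<Sum>\<gamma>\<in>E. \<Sum>i\<le>s. f i \<gamma> (\<phi> (inv \<gamma>) y))"
        unfolding L_def using c(1)[OF src] by (intro sum_mono member_le_sum) auto
      also have "\<dots> = (\<Sum>i\<le>s. inflow \<Gamma> \<phi> E (f i) y)" unfolding inflow_def by (rule sum.swap)
      also have "\<dots> \<le> (\<Sum>i\<le>s. m * b y)" by (rule sum_mono) (rule f(2)[OF y])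
      finally show ?thesis by simp
    qed
    define bad where "bad = {t. t < K \<and> (\<exists>\<gamma>\<in>E. \<exists>\<delta>\<in>E. c t (\<phi> (inv \<gamma>) y) \<noteq> c t (\<phi> (inv \<delta>) y))}"
    have L_good: "L t \<le> m * b y" if "t < K" "t \<notin> bad" for t
    proof (cases "E = {}")
      case True
      then show ?thesis by (simp add: L_def)
    next
      case False
      then obtain \<delta> where d: "\<delta> \<in> E" by blast
      have same: "c t (\<phi> (inv \<gamma>) y) = c t (\<phi> (inv \<delta>) y)" if "\<gamma> \<in> E" for \<gamma>
        using \<open>t < K\<close> \<open>t \<notin> bad\<close> that d unfolding bad_def by blast
      have "L t = inflow \<Gamma> \<phi> E (f (c t (\<phi> (inv \<delta>) y))) y"
        unfolding L_def inflow_def by (rule sum.cong) (simp_all add: same)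
      then show ?thesis using f(2)[OF y] by simp
    qed
    have split: "\<exists>i\<le>s. \<exists>\<gamma>\<in>E. \<exists>\<delta>\<in>E. \<phi> (inv \<gamma>) y \<in> V i t \<and> \<phi> (inv \<delta>) y \<notin> V i t" if "t \<in> bad" for t
    proof -
      obtain \<gamma> \<delta> where g: "\<gamma> \<in> E" "\<delta> \<in> E" "c t (\<phi> (inv \<gamma>) y) \<noteq> c t (\<phi> (inv \<delta>) y)"
        using \<open>t \<in> bad\<close> by (auto simp: bad_def)
      then consider "c t (\<phi> (inv \<gamma>) y) < c t (\<phi> (inv \<delta>) y)" | "c t (\<phi> (inv \<delta>) y) < c t (\<phi> (inv \<gamma>) y)"
        by linarith
      then show ?thesis
      proof cases
        case 1
        then have "\<phi> (inv \<delta>) y \<notin> V (c t (\<phi> (inv \<gamma>) y)) t"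
          unfolding c_def[of t "\<phi> (inv \<delta>) y"] by (rule not_less_Least)
        then show ?thesis using c[OF src[OF g(1)]] g by blast
      next
        case 2
        then have "\<phi> (inv \<gamma>) y \<notin> V (c t (\<phi> (inv \<delta>) y)) t"
          unfolding c_def[of t "\<phi> (inv \<gamma>) y"] by (rule not_less_Least)
        then show ?thesis using c[OF src[OF g(2)]] g by blast
      qed
    qed
    then have "\<forall>t\<in>bad. \<exists>i. i \<le> s \<and> (\<exists>\<gamma>\<in>E. \<exists>\<delta>\<in>E. \<phi> (inv \<gamma>) y \<in> V i t \<and> \<phi> (inv \<delta>) y \<notin> V i t)" by blast
    then obtain \<iota> where \<iota>: "\<And>t. t \<in> bad \<Longrightarrow> \<iota> t \<le> s"
      "\<And>t. t \<in> bad \<Longrightarrow> \<exists>\<gamma>\<in>E. \<exists>\<delta>\<in>E. \<phi> (inv \<gamma>) y \<in> V (\<iota> t) t \<and> \<phi> (inv \<delta>) y \<notin> V (\<iota> t) t"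
      by metis
    have no_two: False if t: "t \<in> bad" "t' \<in> bad" "t < t'" "\<iota> t = \<iota> t'" for t t'
    proof -
      obtain \<gamma> where g: "\<gamma> \<in> E" "\<phi> (inv \<gamma>) y \<in> V (\<iota> t) t" using \<iota>(2)[OF t(1)] by blast
      obtain \<delta> where d: "\<delta> \<in> E" "\<phi> (inv \<delta>) y \<notin> V (\<iota> t) t'" using \<iota>(2)[OF t(2)] t(4) by auto
      have gc: "\<gamma> \<in> carrier \<Gamma>" "\<delta> \<in> carrier \<Gamma>" using g d E by auto
      have "inv \<delta> \<otimes> \<gamma> \<in> Q"
        using g d by (auto simp: Q_def quotients_def intro: image_eqI[of _ _ "(\<delta>, \<gamma>)"])
      then have "\<phi> (inv \<delta> \<otimes> \<gamma>) (\<phi> (inv \<gamma>) y) \<in> V (\<iota> t) (Suc t)" using Vstep g(2) by blast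
      moreover have "\<phi> (inv \<delta> \<otimes> \<gamma>) (\<phi> (inv \<gamma>) y) = \<phi> (inv \<delta>) y"
        using gc y by (simp add: composition_rule act_closed act_act_inv)
      ultimately show False using d(2) Vmono[of "Suc t" t' "\<iota> t"] t(3) by auto
    qed
    have "inj_on \<iota> bad"
    proof (rule inj_onI, rule ccontr)
      fix t t' assume t: "t \<in> bad" "t' \<in> bad" "\<iota> t = \<iota> t'" "t \<noteq> t'"
      then consider "t < t'" | "t' < t" by linarith
      then show False using no_two[OF t(1,2)] no_two[OF t(2,1)] t(3) by cases simp_all
    qed
    moreover have "\<iota> ` bad \<subseteq> {..s}" using \<iota>(1) by auto
    ultimately have card_bad: "card bad \<le> s + 1" using card_inj_on_le[of \<iota> bad "{..s}"] by simp
    have "inflow \<Gamma> \<phi> E z y = (\<Sum>t<K. L t)"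
      unfolding inflow_def z_def L_def by (rule sum.swap)
    also have "\<dots> \<le> (\<Sum>t<K. m * b y + (if t \<in> bad then (s + 1) * (m * b y) else 0))"
      using L_all L_good by (intro sum_mono) (auto simp: trans_le_add2)
    also have "\<dots> = K * (m * b y) + card ({..<K} \<inter> bad) * ((s + 1) * (m * b y))"
      by (simp add: sum.distrib sum.If_cases)
    also have "{..<K} \<inter> bad = bad" by (auto simp: bad_def)
    also have "K * (m * b y) + card bad * ((s + 1) * (m * b y)) \<le>
        K * (m * b y) + (s + 1) * ((s + 1) * (m * b y))"
      using card_bad by (intro add_left_mono mult_right_mono) auto
    also have "\<dots> = m * (K + (s + 1) * (s + 1)) * b y" by (simp add: algebra_simps)
    finally show ?thesis .
  qed
  moreover have "m * (K + (s + 1) * (s + 1)) < n * K"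
  proof -
    have "m * (K + (s + 1) * (s + 1)) < m * K + K" unfolding K_def by (simp add: algebra_simps)
    also have "\<dots> = Suc m * K" by simp
    also have "\<dots> \<le> n * K" using nm by (intro mult_right_mono) auto
    finally show ?thesis .
  qed
  ultimately show ?thesis by blast
qed

section \<open>Rounding a fractional flow\<close>

lemma ball_grows_or_component:
  assumes D: "symmetric_nhd D" and V: "V \<subseteq> X" and x: "x \<in> V"
  shows "j < card ((adjacency \<phi> D V ^^ j) `` {x}) \<or>
    (adjacency \<phi> D V)\<^sup>* `` {x} \<subseteq> (adjacency \<phi> D V ^^ j) `` {x}"
proof (induction j)
  case 0
  show ?case by simp
next
  case (Suc j)
  let ?R = "adjacency \<phi> D V"
  have mono: "(?R ^^ j) `` {x} \<subseteq> (?R ^^ Suc j) `` {x}"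
    using adjacency_relpow_mono[OF D V x le_SucI[OF order_refl]] by blast
  have "(?R ^^ Suc j) `` {x} \<subseteq> (\<lambda>g. \<phi> g x) ` words \<Gamma> D (Suc j)"
    using adjacency_relpow_words[of D V x _ "Suc j"] D V x unfolding symmetric_nhd_def by blast
  then have fin: "finite ((?R ^^ Suc j) `` {x})"
    using finite_words[of D "Suc j"] D unfolding symmetric_nhd_def by (meson finite_imageI finite_subset)
  show ?case
  proof (cases "(?R ^^ Suc j) `` {x} = (?R ^^ j) `` {x}")
    case True
    have "(x, y) \<in> ?R ^^ j" if "(x, y) \<in> ?R\<^sup>*" for y
      using that
    proof (induction rule: rtrancl_induct)
      case base
      have "(x, x) \<in> ?R ^^ 0" by simp
      then show ?case by (rule adjacency_relpow_mono[OF D V x le0])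
    next
      case (step p q)
      then have "(x, q) \<in> ?R ^^ Suc j" by (intro relpow_Suc_I)
      then have "q \<in> (?R ^^ Suc j) `` {x}" by (rule ImageI) simp
      then show ?case unfolding True by simp
    qed
    then show ?thesis using mono by blast
  next
    case False
    then have "card ((?R ^^ j) `` {x}) < card ((?R ^^ Suc j) `` {x})"
      using mono fin by (intro psubset_card_mono) auto
    moreover have "?R\<^sup>* `` {x} \<subseteq> (?R ^^ Suc j) `` {x}" if "?R\<^sup>* `` {x} \<subseteq> (?R ^^ j) `` {x}"
      using that mono by blast
    ultimately show ?thesis using Suc by linarith
  qed
qed

lemma inflow_mono:
  "(\<And>\<gamma> x. \<gamma> \<in> E \<Longrightarrow> w \<gamma> x \<le> z \<gamma> x) \<Longrightarrow> inflow \<Gamma> \<phi> E w y \<le> inflow \<Gamma> \<phi> E z y"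
  unfolding inflow_def by (rule sum_mono) auto

lemma inflow_sum: "inflow \<Gamma> \<phi> E (\<lambda>\<gamma> x. \<Sum>i\<in>I. z i \<gamma> x) y = (\<Sum>i\<in>I. inflow \<Gamma> \<phi> E (z i) y)"
  unfolding inflow_def by (rule sum.swap)

lemma outflow_sum: "outflow E (\<lambda>\<gamma> x. \<Sum>i\<in>I. z i \<gamma> x) y = (\<Sum>i\<in>I. outflow E (z i) y)"
  unfolding outflow_def by (rule sum.swap)

lemma inflow_mult: "inflow \<Gamma> \<phi> E (\<lambda>\<gamma> x. m * z \<gamma> x) y = m * inflow \<Gamma> \<phi> E z y"
  unfolding inflow_def by (simp add: sum_distrib_left)

text \<open>
  Rounding the class shares \<open>e i / n\<close> up costs less than \<open>s + 1\<close> units in total, which is affordable if \<open>q\<close>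
  is large. If there is only one class, then \<open>m q / n\<close> rounded up is at most \<open>q\<close> since \<open>m < n\<close>.
\<close>

lemma ceiling_div_sum_le:
  fixes e :: "nat \<Rightarrow> nat"
  assumes e: "(\<Sum>i\<le>s. e i) \<le> m * q" and mn: "m < n"
    and alt: "n * (s + 1) \<le> q \<or> (\<exists>i0. \<forall>i\<le>s. 0 < e i \<longrightarrow> i = i0)"
  shows "(\<Sum>i\<le>s. (e i + (n - 1)) div n) \<le> q"
  using alt
proof
  assume q: "n * (s + 1) \<le> q"
  have "n * (\<Sum>i\<le>s. (e i + (n - 1)) div n) \<le> (\<Sum>i\<le>s. e i + (n - 1))"
    unfolding sum_distrib_left by (rule sum_mono) simp
  also have "\<dots> = (\<Sum>i\<le>s. e i) + (s + 1) * (n - 1)" by (simp add: sum.distrib)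
  also have "\<dots> \<le> m * q + (s + 1) * n" using e by (intro add_mono mult_left_mono) auto
  also have "\<dots> \<le> m * q + q" using q by (simp add: ac_simps)
  also have "\<dots> = Suc m * q" by simp
  also have "\<dots> \<le> n * q" using mn by (intro mult_right_mono) auto
  finally show ?thesis using mn by simp
next
  assume "\<exists>i0. \<forall>i\<le>s. 0 < e i \<longrightarrow> i = i0"
  then obtain i0 where i0: "\<And>i. i \<le> s \<Longrightarrow> 0 < e i \<Longrightarrow> i = i0" by blast
  have zero: "(e i + (n - 1)) div n = 0" if "i \<le> s" "i \<noteq> i0" for i
  proof -
    have "e i = 0" using i0[OF that(1)] that(2) by auto
    then show ?thesis using mn by simp
  qed
  show ?thesis
  proof (cases "i0 \<le> s")
    case True
    have single: "(\<Sum>i\<le>s. (e i + (n - 1)) div n) = (\<Sum>i\<in>{i0}. (e i + (n - 1)) div n)"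
      using True zero by (intro sum.mono_neutral_right) auto
    have "e i0 \<le> (\<Sum>i\<le>s. e i)" using True by (intro member_le_sum) auto
    then have "e i0 \<le> m * q" using e by simp
    also have "\<dots> \<le> n * q" using mn by simp
    finally have "e i0 + (n - 1) < Suc q * n" using mn by (simp add: mult.commute)
    then have "(e i0 + (n - 1)) div n < Suc q" by (rule less_mult_imp_div_less)
    then show ?thesis unfolding single by simp
  next
    case False
    then have "(\<Sum>i\<le>s. (e i + (n - 1)) div n) = 0" using zero by (intro sum.neutral) auto
    then show ?thesis by simp
  qed
qed

text \<open>
  Centres form a maximal set of points of \<open>B\<close> at distance more than \<open>2 h\<close> in \<open>B\<close>. By maximality every point
  has a centre within distance \<open>2 h\<close>, and as balls of radius \<open>h\<close> around different centres are disjoint,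
  each cell can be made to contain the ball of radius \<open>h\<close> around its centre. Distances are measured by
  paths inside \<open>B\<close>, so that a cell stays within one component.
\<close>

lemma cells_exist:
  assumes B: "B \<in> sets M" and D: "symmetric_nhd D"
  shows "\<exists>k. k \<in> M \<rightarrow>\<^sub>M count_space UNIV \<and>
    (\<forall>y\<in>B. k y \<in> words \<Gamma> D (2 * h) \<and> (y, \<phi> (k y) y) \<in> adjacency \<phi> D B ^^ (2 * h)) \<and>
    (\<forall>y\<in>B. \<forall>y'\<in>B. (\<phi> (k y) y, y') \<in> adjacency \<phi> D B ^^ h \<longrightarrow> \<phi> (k y') y' = \<phi> (k y) y)"
proof -
  have BX: "B \<subseteq> X" by (rule sets.sets_into_space[OF B])
  have D': "finite D" "D \<subseteq> carrier \<Gamma>" "\<one> \<in> D" using D by (auto simp: symmetric_nhd_def)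
  define R where "R = adjacency \<phi> D B"
  have Rsym: "(q, p) \<in> R ^^ j" if "(p, q) \<in> R ^^ j" for p q j
    using relpow_sym[OF _ that] adjacency_sym[OF D BX] by (auto simp: R_def)
  have Rmono: "(x, y) \<in> R ^^ j" if "(x, y) \<in> R ^^ i" "i \<le> j" "x \<in> B" for x y i j
    using adjacency_relpow_mono[OF D BX that(3,2)] that(1) by (simp add: R_def)
  define P where "P = words \<Gamma> D (2 * h)"
  have P: "finite P" "P \<subseteq> carrier \<Gamma>" "\<one> \<in> P"
    unfolding P_def using finite_words words_carrier one_in_words D' by auto
  have Rm: "{y \<in> X. (y, \<phi> g y) \<in> R ^^ j} \<in> sets M" if "g \<in> P" for g j
    unfolding R_def using that P by (intro adjacency_relpow_measurable D' B) auto
  define r where "r x y \<longleftrightarrow> x \<in> B \<and> y \<in> B \<and> x \<noteq> y \<and> (x, y) \<in> R ^^ (2 * h)" for x y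
  have "\<exists>I\<in>sets M. I \<subseteq> B \<and> (\<forall>x\<in>I. \<forall>y\<in>I. \<not> r x y) \<and> (\<forall>x\<in>B - I. \<exists>y\<in>I. r x y)"
  proof (rule maximal_independent_set[where r = r, OF P(1,2) B])
    show "r y x" if "r x y" for x y using that Rsym by (auto simp: r_def)
    show "\<exists>d\<in>P. y = \<phi> d x" if "r x y" for x y
      using that adjacency_relpow_words[OF D'(2) BX] by (auto simp: r_def R_def P_def)
    show "\<not> r x x" for x by (simp add: r_def)
    show "{x \<in> X. r x (\<phi> d x)} \<in> sets M" if d: "d \<in> P" for d
    proof -
      have dc: "d \<in> carrier \<Gamma>" using d P by auto
      have "{x \<in> X. r x (\<phi> d x)} = (B \<inter> {x \<in> X. \<phi> d x \<in> B} \<inter> {x \<in> X. (x, \<phi> d x) \<in> R ^^ (2 * h)}) -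
          {x \<in> X. \<phi> d x = \<phi> \<one> x}"
        using BX by (auto simp: r_def act_one)
      also have "\<dots> \<in> sets M"
        by (intro sets.Diff sets.Int B act_preimage Rm act_eq_measurable dc d one_closed)
      finally show ?thesis .
    qed
  qed
  then obtain I where I: "I \<in> sets M" "I \<subseteq> B" "\<forall>x\<in>I. \<forall>y\<in>I. \<not> r x y" "\<forall>x\<in>B - I. \<exists>y\<in>I. r x y"
    by (elim bexE conjE)
  obtain gs where gs: "set gs = P" using finite_list[OF P(1)] ..
  define near where "near j y g \<longleftrightarrow> \<phi> g y \<in> I \<and> (y, \<phi> g y) \<in> R ^^ j" for j y g
  \<comment> \<open>A point within distance \<open>h\<close> of a centre goes to that centre, any other point to some centre in reach.\<close>
  define far where "far y = first_that (near (2 * h) y) (\<lambda>g. g) \<one> gs" for y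
  define k where "k y = first_that (near h y) (\<lambda>g. g) (far y) gs" for y
  have nearm: "{y \<in> X. near j y g} \<in> sets M" if g: "g \<in> set gs" for j g
  proof -
    have "{y \<in> X. near j y g} = {y \<in> X. \<phi> g y \<in> I} \<inter> {y \<in> X. (y, \<phi> g y) \<in> R ^^ j}"
      by (auto simp: near_def)
    also have "\<dots> \<in> sets M" using g gs P by (intro sets.Int act_preimage I Rm) auto
    finally show ?thesis .
  qed
  have "far \<in> M \<rightarrow>\<^sub>M count_space UNIV"
    unfolding far_def by (rule measurable_first_that) (simp_all add: nearm)
  then have km: "k \<in> M \<rightarrow>\<^sub>M count_space UNIV"
    unfolding k_def by (intro measurable_first_that nearm) simp_all
  have near_h: "near h y (k y) \<and> k y \<in> P" if "\<exists>g\<in>P. near h y g" for y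
    using first_that_some[of gs "near h y" "\<lambda>g. g" "far y"] that gs by (auto simp: k_def)
  have near_2h: "near (2 * h) y (k y) \<and> k y \<in> P" if y: "y \<in> B" for y
  proof (cases "\<exists>g\<in>P. near h y g")
    case True
    then show ?thesis using near_h[OF True] Rmono[of y _ h "2 * h"] y by (auto simp: near_def)
  next
    case False
    then have k: "k y = far y" unfolding k_def using gs by (intro first_that_none) auto
    have "\<exists>g\<in>P. near (2 * h) y g"
    proof (cases "y \<in> I")
      case True
      have "y \<in> X" using y BX by blast
      then have "near (2 * h) y \<one>"
        using True Rmono[of y y 0 "2 * h"] y by (simp add: near_def act_one)
      then show ?thesis using P(3) by blast
    next
      case False
      then obtain c where c: "c \<in> I" "r y c" using I(4) y by blast
      then obtain g where "g \<in> P" "c = \<phi> g y"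
        using adjacency_relpow_words[OF D'(2) BX, of y c "2 * h"] y by (auto simp: r_def R_def P_def)
      then show ?thesis using c by (auto simp: near_def r_def)
    qed
    then show ?thesis
      using first_that_some[of gs "near (2 * h) y" "\<lambda>g. g" \<one>] gs by (auto simp: k far_def)
  qed
  have "\<phi> (k y') y' = \<phi> (k y) y" if y: "y \<in> B" "y' \<in> B" "(\<phi> (k y) y, y') \<in> R ^^ h" for y y'
  proof -
    let ?c = "\<phi> (k y) y"
    have c: "?c \<in> I" using near_2h[OF y(1)] by (simp add: near_def)
    have rev: "(y', ?c) \<in> R ^^ h" by (rule Rsym[OF y(3)])
    then obtain g where "g \<in> words \<Gamma> D h" "?c = \<phi> g y'"
      using adjacency_relpow_words[OF D'(2) BX, of y' ?c h] y(2) by (auto simp: R_def)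
    moreover from this have "g \<in> P" using words_mono[OF D'(3,2), of h "2 * h"] by (auto simp: P_def)
    ultimately have "\<exists>g\<in>P. near h y' g" using c rev by (metis near_def)
    then have k': "\<phi> (k y') y' \<in> I" "(y', \<phi> (k y') y') \<in> R ^^ h" using near_h[of y'] by (auto simp: near_def)
    have "(?c, \<phi> (k y') y') \<in> R ^^ (h + h)" using y(3) k'(2) by (auto simp: relpow_add)
    then have "\<not> ?c \<noteq> \<phi> (k y') y'" using I(2,3) c k'(1) by (auto simp: r_def mult_2)
    then show ?thesis by simp
  qed
  note centre = this
  show ?thesis
    unfolding P_def[symmetric] R_def[symmetric]
  proof (intro exI[of _ k] conjI ballI impI km)
    fix y assume y: "y \<in> B"
    show "k y \<in> P" "(y, \<phi> (k y) y) \<in> R ^^ (2 * h)" using near_2h[OF y] by (simp_all add: near_def)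
    fix y' assume "y' \<in> B" "(\<phi> (k y) y, y') \<in> R ^^ h"
    then show "\<phi> (k y') y' = \<phi> (k y) y" by (rule centre[OF y])
  qed
qed

text \<open>
  The flow \<open>f\<close> gathers the capacity \<open>b\<close> at the centres of the cells, and \<open>z\<close> sends the demand \<open>a\<close> to the
  centres. Each source belongs to one of \<open>s + 1\<close> classes, determined by the cells to which it sends flow,
  such that every class has finite components. If \<open>e i c\<close> units of class \<open>i\<close> reach the cell of \<open>c\<close>, then class
  \<open>i\<close> is granted \<open>e i c / n\<close> units of capacity at \<open>c\<close>, rounded up; this satisfies Hall's condition for the
  class, because each of its sources sends \<open>n\<close> units. By \<open>ceiling_div_sum_le\<close> the grants fit into the
  capacity of the cell: by \<open>ball_grows_or_component\<close> the cell either contains more than \<open>n (s + 1)\<close> points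
  of \<open>B\<close>, or is a whole component of \<open>B\<close>, and in the latter case all its sources have the same class.
\<close>

lemma round_fractional_flow:
  assumes covers: "has_finite_covers s" and \<Phi>: "measurable_flow E \<Phi>"
    and ab: "a \<in> M \<rightarrow>\<^sub>M count_space UNIV" "b \<in> M \<rightarrow>\<^sub>M count_space UNIV" "\<And>x. x \<in> X \<Longrightarrow> a x \<le> A"
    and nm: "m < n"
    and out: "\<And>x. x \<in> X \<Longrightarrow> outflow E \<Phi> x = n * a x"
    and inle: "\<And>y. y \<in> X \<Longrightarrow> inflow \<Gamma> \<phi> E \<Phi> y \<le> m * b y"
  shows "\<exists>P f E' z. measurable_flow P f \<and> measurable_flow E' z \<and>
    (\<forall>y\<in>X. outflow P f y = b y) \<and> (\<forall>x\<in>X. outflow E' z x = a x) \<and>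
    (\<forall>y\<in>X. inflow \<Gamma> \<phi> E' z y \<le> inflow \<Gamma> \<phi> P f y)"
proof -
  have E: "finite E" "E \<subseteq> carrier \<Gamma>" and \<Phi>m: "\<And>\<gamma>. \<gamma> \<in> E \<Longrightarrow> \<Phi> \<gamma> \<in> M \<rightarrow>\<^sub>M count_space UNIV"
    using \<Phi> by (auto simp: measurable_flow_def)
  define B where "B = {y \<in> X. 0 < b y}"
  have BX: "B \<subseteq> X" by (auto simp: B_def)
  have Bm: "B \<in> sets M" unfolding B_def using measurable_nat_rel[OF ab(2) ab(2), of "\<lambda>i j. 0 < i"] by simp
  define D where "D = quotients ((\<lambda>\<gamma>. inv \<gamma>) ` E)"
  have D: "symmetric_nhd D" unfolding D_def using E by (intro symmetric_nhd_quotients) auto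
  have D': "finite D" "D \<subseteq> carrier \<Gamma>" "\<one> \<in> D" using D by (auto simp: symmetric_nhd_def)
  define h where "h = n * (s + 1)"
  define P where "P = words \<Gamma> D (2 * h)"
  have P: "finite P" "P \<subseteq> carrier \<Gamma>" unfolding P_def using finite_words words_carrier D' by auto
  define R where "R = adjacency \<phi> D B"
  obtain k where km: "k \<in> M \<rightarrow>\<^sub>M count_space UNIV"
    and k1: "\<forall>y\<in>B. k y \<in> P \<and> (y, \<phi> (k y) y) \<in> R ^^ (2 * h)"
    and k2: "\<forall>y\<in>B. \<forall>y'\<in>B. (\<phi> (k y) y, y') \<in> R ^^ h \<longrightarrow> \<phi> (k y') y' = \<phi> (k y) y"
    using cells_exist[OF Bm D, of h] unfolding P_def R_def by (elim exE conjE)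
  \<comment> \<open>\<open>cell f\<close> is the flow that moves the mass \<open>f\<close> on \<open>B\<close> to the centres of the cells.\<close>
  define cell where "cell f g y = (if y \<in> B \<and> k y = g then f y else (0::nat))" for f g y
  have cell_m: "cell f g \<in> M \<rightarrow>\<^sub>M count_space UNIV" if "f \<in> M \<rightarrow>\<^sub>M count_space UNIV" for f g
  proof -
    have "{y \<in> X. k y = g} \<in> sets M" using measurable_sets[OF km, of "{g}"] by (simp add: vimage_def Int_def conj_commute)
    then have "B \<inter> {y \<in> X. k y = g} \<in> sets M" using Bm by blast
    from measurable_nat_restrict[OF that this] show ?thesis
      by (rule measurable_cong[THEN iffD1, rotated]) (auto simp: cell_def)
  qed
  have cell_flow: "measurable_flow P (cell f)" if "f \<in> M \<rightarrow>\<^sub>M count_space UNIV" for f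
    using P cell_m[OF that] by (simp add: measurable_flow_def)
  have cell_out: "outflow P (cell f) y = f y" if "y \<in> B" for f y
    using that k1 P unfolding outflow_def cell_def by (simp add: sum.delta)
  have cell_out0: "outflow P (cell b) y = b y" if "y \<in> X" for y
    using that cell_out[of y b] by (cases "y \<in> B") (auto simp: B_def cell_def outflow_def)
  define push where "push f = inflow \<Gamma> \<phi> P (cell f)" for f
  have push_m: "push f \<in> M \<rightarrow>\<^sub>M count_space UNIV" if "f \<in> M \<rightarrow>\<^sub>M count_space UNIV" for f
    unfolding push_def by (intro inflow_measurable P cell_m that)
  have push_pos: "\<exists>y\<in>B. \<phi> (k y) y = c \<and> 0 < f y" if pos: "0 < push f c" and c: "c \<in> X" for f c
  proof -
    have "\<exists>g\<in>P. cell f g (\<phi> (inv g) c) \<noteq> 0"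
    proof (rule ccontr)
      assume "\<not> ?thesis"
      then have "push f c = 0" unfolding push_def inflow_def by (intro sum.neutral) simp
      with pos show False by simp
    qed
    then obtain g where g: "g \<in> P" "cell f g (\<phi> (inv g) c) \<noteq> 0" by blast
    have "g \<in> carrier \<Gamma>" using g P by auto
    then have "\<phi> g (\<phi> (inv g) c) = c" using c by (rule act_act_inv)
    moreover have "\<phi> (inv g) c \<in> B" "k (\<phi> (inv g) c) = g" "0 < f (\<phi> (inv g) c)"
      using g(2) by (auto simp: cell_def split: if_splits)
    ultimately show ?thesis by (intro bexI[of _ "\<phi> (inv g) c"]) simp_all
  qed
  have push_mono: "push f c \<le> push f' c" if "\<And>y. y \<in> B \<Longrightarrow> f y \<le> f' y" for f f' c
    unfolding push_def by (rule inflow_mono) (use that in \<open>auto simp: cell_def\<close>)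
  have push_sum: "push (\<lambda>y. \<Sum>i\<le>s. L i y) c = (\<Sum>i\<le>s. push (L i) c)" for L :: "nat \<Rightarrow> 'x \<Rightarrow> nat" and c
  proof -
    have "cell (\<lambda>y. \<Sum>i\<le>s. L i y) = (\<lambda>g y. \<Sum>i\<le>s. cell (L i) g y)" by (intro ext) (auto simp: cell_def)
    then show ?thesis unfolding push_def by (simp add: inflow_sum)
  qed
  have push_mult: "push (\<lambda>y. m * f y) c = m * push f c" for f c
  proof -
    have "cell (\<lambda>y. m * f y) = (\<lambda>g y. m * cell f g y)" by (intro ext) (simp add: cell_def)
    then show ?thesis unfolding push_def by (simp add: inflow_mult)
  qed
  define E2 where "E2 = P <#>\<^bsub>\<Gamma>\<^esub> E"
  have E2: "finite E2" "E2 \<subseteq> carrier \<Gamma>" unfolding E2_def using P E by (auto simp: finite_set_mult dest: set_mult_carrier[THEN subsetD])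
  define Q where "Q = quotients E2"
  have Q: "finite Q" "Q \<subseteq> carrier \<Gamma>" using symmetric_nhd_quotients[OF E2] by (auto simp: symmetric_nhd_def Q_def)
  have iE2: "finite ((\<lambda>g. inv g) ` E2)" "(\<lambda>g. inv g) ` E2 \<subseteq> carrier \<Gamma>" using E2 by auto
  obtain U :: "nat \<Rightarrow> 'x set" where U: "\<And>i. U i \<in> sets M" "X = (\<Union>i\<le>s. U i)"
    "\<And>i V. V \<subseteq> translates \<phi> ((\<lambda>g. inv g) ` E2) (U i) \<Longrightarrow> finite_components Q V"
    using finite_cover_thickened[OF covers iE2 Q] by metis
  \<comment> \<open>A source belongs to the first cover set that contains the centre of a sink to which it sends flow.\<close>
  define T where "T i = {y \<in> B. \<phi> (k y) y \<in> U i}" for i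
  have Tm: "T i \<in> sets M" for i
  proof -
    have "T i = (\<Union>g\<in>P. B \<inter> (k -` {g} \<inter> X) \<inter> {y \<in> X. \<phi> g y \<in> U i})"
      using k1 BX by (auto simp: T_def)
    also have "\<dots> \<in> sets M"
      using P by (intro sets.finite_UN sets.Int Bm measurable_sets[OF km] act_preimage U) auto
    finally show ?thesis .
  qed
  define S where "S i = {x \<in> X. \<exists>\<gamma>\<in>E. 0 < \<Phi> \<gamma> x \<and> \<phi> \<gamma> x \<in> T i}" for i
  have Sm: "S i \<in> sets M" for i
  proof -
    have "S i = (\<Union>\<gamma>\<in>E. {x \<in> X. 0 < \<Phi> \<gamma> x} \<inter> {x \<in> X. \<phi> \<gamma> x \<in> T i})" by (auto simp: S_def)
    also have "\<dots> \<in> sets M"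
    proof (intro sets.finite_UN sets.Int E)
      fix \<gamma> assume "\<gamma> \<in> E"
      then show "{x \<in> X. 0 < \<Phi> \<gamma> x} \<in> sets M" "{x \<in> X. \<phi> \<gamma> x \<in> T i} \<in> sets M"
        using measurable_nat_rel[OF \<Phi>m \<Phi>m, of \<gamma> \<gamma> "\<lambda>i j. 0 < i"] act_preimage[OF _ Tm] E by auto
    qed
    finally show ?thesis .
  qed
  define cls where "cls x = (LEAST i. x \<in> S i)" for x
  have clsm: "cls \<in> M \<rightarrow>\<^sub>M count_space UNIV"
    unfolding cls_def using Sm by (intro measurable_Least) auto
  have target_B: "\<phi> \<gamma> x \<in> B" if "\<gamma> \<in> E" "x \<in> X" "0 < \<Phi> \<gamma> x" for \<gamma> x
  proof -
    have gc: "\<gamma> \<in> carrier \<Gamma>" using that E by auto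
    have yX: "\<phi> \<gamma> x \<in> X" using gc that act_closed by simp
    have "\<Phi> \<gamma> (\<phi> (inv \<gamma>) (\<phi> \<gamma> x)) \<le> inflow \<Gamma> \<phi> E \<Phi> (\<phi> \<gamma> x)"
      unfolding inflow_def using that E by (intro member_le_sum[of \<gamma> E "\<lambda>\<gamma>'. \<Phi> \<gamma>' (\<phi> (inv \<gamma>') (\<phi> \<gamma> x))"]) auto
    then have "0 < inflow \<Gamma> \<phi> E \<Phi> (\<phi> \<gamma> x)" using that gc act_inv_act by simp
    then have "0 < m * b (\<phi> \<gamma> x)" using inle[OF yX] by (rule less_le_trans)
    then show ?thesis using yX by (simp add: B_def)
  qed
  have cls: "cls x \<le> s" "x \<in> S (cls x)" if x: "x \<in> X" "0 < a x" for x
  proof -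
    have "0 < outflow E \<Phi> x" using out[OF x(1)] x(2) nm by simp
    have "\<exists>\<gamma>\<in>E. 0 < \<Phi> \<gamma> x"
    proof (rule ccontr)
      assume "\<not> ?thesis"
      then have "outflow E \<Phi> x = 0" unfolding outflow_def by (intro sum.neutral) simp
      with \<open>0 < outflow E \<Phi> x\<close> show False by simp
    qed
    then obtain \<gamma> where g: "\<gamma> \<in> E" "0 < \<Phi> \<gamma> x" by blast
    have yB: "\<phi> \<gamma> x \<in> B" by (rule target_B[OF g(1) x(1) g(2)])
    have "\<phi> (k (\<phi> \<gamma> x)) (\<phi> \<gamma> x) \<in> X"
      by (rule act_closed) (use yB k1 P BX in auto)
    then obtain i where i: "i \<le> s" "\<phi> (k (\<phi> \<gamma> x)) (\<phi> \<gamma> x) \<in> U i" using U(2) by auto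
    then have xS: "x \<in> S i" using g yB x by (auto simp: S_def T_def)
    then show "x \<in> S (cls x)" unfolding cls_def by (rule LeastI)
    have "cls x \<le> i" unfolding cls_def using xS by (rule Least_le)
    then show "cls x \<le> s" using i by simp
  qed
  define \<Psi> where "\<Psi> i \<gamma> x = (if cls x = i then \<Phi> \<gamma> x else 0)" for i \<gamma> x
  define a' where "a' i x = (if cls x = i then a x else 0)" for i x
  have \<Psi>m: "\<Psi> i \<gamma> \<in> M \<rightarrow>\<^sub>M count_space UNIV" if "\<gamma> \<in> E" for i \<gamma>
    unfolding \<Psi>_def using measurable_nat_op[OF clsm \<Phi>m[OF that], of "\<lambda>j c. if j = i then c else 0"] by simp
  have a'm: "a' i \<in> M \<rightarrow>\<^sub>M count_space UNIV" for i
    unfolding a'_def using measurable_nat_op[OF clsm ab(1), of "\<lambda>j c. if j = i then c else 0"] by simp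
  define L where "L i = inflow \<Gamma> \<phi> E (\<Psi> i)" for i
  have Lm: "L i \<in> M \<rightarrow>\<^sub>M count_space UNIV" for i
    unfolding L_def by (intro inflow_measurable E \<Psi>m)
  have L_le: "(\<Sum>i\<le>s. L i y) \<le> m * b y" if "y \<in> X" for y
  proof -
    have "(\<Sum>i\<le>s. L i y) = inflow \<Gamma> \<phi> E (\<lambda>\<gamma> x. \<Sum>i\<le>s. \<Psi> i \<gamma> x) y"
      unfolding L_def by (rule inflow_sum[symmetric])
    also have "\<dots> \<le> inflow \<Gamma> \<phi> E \<Phi> y" by (rule inflow_mono) (simp add: \<Psi>_def)
    also have "\<dots> \<le> m * b y" by (rule inle[OF that])
    finally show ?thesis .
  qed
  have L_B: "y \<in> B" if yX: "y \<in> X" and "0 < L i y" for y i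
  proof -
    have "L i y \<le> inflow \<Gamma> \<phi> E \<Phi> y" unfolding L_def by (rule inflow_mono) (simp add: \<Psi>_def)
    then have "0 < m * b y" using that(2) inle[OF yX] by linarith
    then show ?thesis using yX by (simp add: B_def)
  qed
  define e where "e i = push (L i)" for i
  define cap where "cap i y = (e i y + (n - 1)) div n" for i y
  have capm: "cap i \<in> M \<rightarrow>\<^sub>M count_space UNIV" for i
    unfolding cap_def e_def
    using measurable_nat_op[OF push_m[OF Lm] push_m[OF Lm], of "\<lambda>j c. (j + (n - 1)) div n" i i] by simp
  have e_cap: "e i y \<le> n * cap i y" for i y
  proof -
    have "e i y + (n - 1) = n * cap i y + (e i y + (n - 1)) mod n" unfolding cap_def by simp
    moreover have "(e i y + (n - 1)) mod n \<le> n - 1" using nm mod_less_divisor[of n "e i y + (n - 1)"] by linarith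
    ultimately show ?thesis by linarith
  qed
  have "\<exists>z. saturating_flow E2 (a' i) (cap i) z" for i
  proof (rule saturating_flow_finite_components[OF E2 a'm capm])
    show "a' i x \<le> A" if "x \<in> X" for x using ab(3)[OF that] by (simp add: a'_def)
    show "sum (a' i) Y \<le> sum (cap i) (translates \<phi> E2 Y)" if Y: "finite Y" "Y \<subseteq> X" for Y
    proof -
      let ?EY = "translates \<phi> E Y"
      have EY: "finite ?EY" "?EY \<subseteq> X" using finite_translates[OF E(1) Y(1)] translates_in_space[OF E(2) Y(2)] by auto
      have "n * sum (a' i) Y = sum (outflow E (\<Psi> i)) Y"
        unfolding sum_distrib_left
      proof (rule sum.cong)
        fix x assume "x \<in> Y"
        then have "outflow E \<Phi> x = n * a x" using out Y by blast
        then show "n * a' i x = outflow E (\<Psi> i) x" by (simp add: a'_def \<Psi>_def outflow_def)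
      qed simp
      also have "\<dots> \<le> sum (L i) ?EY" unfolding L_def by (rule sum_outflow_le_sum_inflow[OF E Y])
      also have "\<dots> \<le> sum (outflow P (cell (L i))) ?EY"
      proof (rule sum_mono)
        fix y assume "y \<in> ?EY"
        then show "L i y \<le> outflow P (cell (L i)) y" using L_B[of y i] cell_out[of y "L i"] EY by fastforce
      qed
      also have "\<dots> \<le> sum (e i) (translates \<phi> P ?EY)"
        unfolding e_def push_def by (rule sum_outflow_le_sum_inflow[OF P EY])
      also have "translates \<phi> P ?EY = translates \<phi> E2 Y"
        unfolding E2_def by (rule translates_translates[OF P(2) E(2) Y(2)])
      also have "sum (e i) (translates \<phi> E2 Y) \<le> n * sum (cap i) (translates \<phi> E2 Y)"
        unfolding sum_distrib_left by (rule sum_mono) (rule e_cap)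
      finally show ?thesis using nm by simp
    qed
    show "finite ((adjacency \<phi> (quotients E2) {q \<in> X. 0 < a' i q})\<^sup>* `` {x})" if "x \<in> X" "0 < a' i x" for x
    proof -
      have "{q \<in> X. 0 < a' i q} \<subseteq> translates \<phi> ((\<lambda>g. inv g) ` E2) (U i)"
      proof
        fix x assume "x \<in> {q \<in> X. 0 < a' i q}"
        then have x: "x \<in> X" "0 < a x" "cls x = i" by (auto simp: a'_def split: if_splits)
        then obtain \<gamma> where g: "\<gamma> \<in> E" "\<phi> \<gamma> x \<in> T i" using cls(2)[OF x(1,2)] by (auto simp: S_def)
        let ?k = "k (\<phi> \<gamma> x)"
        have kP: "?k \<in> P" "\<phi> ?k (\<phi> \<gamma> x) \<in> U i" using g k1 by (auto simp: T_def)
        have c: "?k \<in> carrier \<Gamma>" "\<gamma> \<in> carrier \<Gamma>" using kP P g E by auto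
        have "?k \<otimes> \<gamma> \<in> E2" using kP g by (auto simp: E2_def set_mult_def)
        moreover have "\<phi> (?k \<otimes> \<gamma>) x = \<phi> ?k (\<phi> \<gamma> x)" using c x by (simp add: composition_rule)
        then have "x = \<phi> (inv (?k \<otimes> \<gamma>)) (\<phi> ?k (\<phi> \<gamma> x))" using act_inv_act[of "?k \<otimes> \<gamma>" x] c x by simp
        ultimately show "x \<in> translates \<phi> ((\<lambda>g. inv g) ` E2) (U i)"
          using kP(2) unfolding translates_def by blast
      qed
      then have "finite_components Q {q \<in> X. 0 < a' i q}" by (rule U(3))
      then show ?thesis using that unfolding finite_components_def Q_def by blast
    qed
  qed
  then have "\<forall>i. \<exists>z. saturating_flow E2 (a' i) (cap i) z" by blast
  then obtain f where "\<forall>i. saturating_flow E2 (a' i) (cap i) (f i)" by (rule choice[THEN exE])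
  then have f: "\<And>i \<gamma>. \<gamma> \<in> E2 \<Longrightarrow> f i \<gamma> \<in> M \<rightarrow>\<^sub>M count_space UNIV"
    "\<And>i y. y \<in> X \<Longrightarrow> inflow \<Gamma> \<phi> E2 (f i) y \<le> cap i y" "\<And>i x. x \<in> X \<Longrightarrow> outflow E2 (f i) x = a' i x"
    by (simp_all add: saturating_flow_def measurable_flow_def subflow_def)
  define z where "z = (\<lambda>\<gamma> x. \<Sum>i\<le>s. f i \<gamma> x)"
  have zflow: "measurable_flow E2 z"
    unfolding measurable_flow_def z_def using E2 f(1) by (auto intro!: measurable_nat_sum)
  have zout: "outflow E2 z x = a x" if x: "x \<in> X" for x
  proof -
    have "outflow E2 z x = (\<Sum>i\<le>s. a' i x)" unfolding z_def outflow_sum using f(3)[OF x] by simp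
    also have "\<dots> = a x" using cls(1)[OF x] by (cases "a x = 0") (auto simp: a'_def)
    finally show ?thesis .
  qed
  have cap_sum: "(\<Sum>i\<le>s. cap i c) \<le> push b c" if c: "c \<in> X" for c
    unfolding cap_def
  proof (rule ceiling_div_sum_le[OF _ nm])
    have "(\<Sum>i\<le>s. e i c) = push (\<lambda>y. \<Sum>i\<le>s. L i y) c" unfolding e_def by (rule push_sum[symmetric])
    also have "\<dots> \<le> push (\<lambda>y. m * b y) c" using L_le BX by (intro push_mono) blast
    finally show "(\<Sum>i\<le>s. e i c) \<le> m * push b c" by (simp add: push_mult)
    show "n * (s + 1) \<le> push b c \<or> (\<exists>i0. \<forall>i\<le>s. 0 < e i c \<longrightarrow> i = i0)"
    proof (cases "\<exists>i\<le>s. 0 < e i c")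
      case False
      then show ?thesis by blast
    next
      case True
      then obtain y0 where y0: "y0 \<in> B" "\<phi> (k y0) y0 = c" using push_pos[OF _ c] unfolding e_def by blast
      have y0c: "(y0, c) \<in> R ^^ (2 * h)" using k1 y0 by blast
      then have cB: "c \<in> B" using adjacency_relpow_in y0(1) unfolding R_def by blast
      have cell_c: "\<phi> (k y) y = c" if "(c, y) \<in> R ^^ h" for y
        using k2 y0 that adjacency_relpow_in[OF _ cB] unfolding R_def by blast
      consider "h < card ((R ^^ h) `` {c})" | "R\<^sup>* `` {c} \<subseteq> (R ^^ h) `` {c}"
        using ball_grows_or_component[OF D BX cB, of h] unfolding R_def by blast
      then show ?thesis
      proof cases
        case 1
        let ?N = "(R ^^ h) `` {c}"
        have N: "y \<in> B" "\<phi> (k y) y = c" "k y \<in> P" "\<phi> (inv (k y)) c = y" if "y \<in> ?N" for y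
        proof -
          show yB: "y \<in> B" using that adjacency_relpow_in[OF _ cB] unfolding R_def by blast
          show yc: "\<phi> (k y) y = c" using that cell_c by blast
          show kP: "k y \<in> P" using k1 yB by blast
          show "\<phi> (inv (k y)) c = y" using act_inv_act[of "k y" y] kP P yB BX yc by auto
        qed
        have "inj_on k ?N" by (rule inj_onI) (metis N(4))
        have kNP: "k ` ?N \<subseteq> P" using N(3) by blast
        have "card ?N = card (k ` ?N)" by (rule card_image[symmetric]) fact
        also have "\<dots> = (\<Sum>g\<in>k ` ?N. 1)" by simp
        also have "\<dots> \<le> (\<Sum>g\<in>k ` ?N. cell b g (\<phi> (inv g) c))"
        proof (rule sum_mono)
          fix g assume "g \<in> k ` ?N"
          then obtain y where y: "y \<in> ?N" "g = k y" by blast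
          have "cell b g (\<phi> (inv g) c) = b y" using N[OF y(1)] y(2) by (simp add: cell_def)
          then show "1 \<le> cell b g (\<phi> (inv g) c)" using N(1)[OF y(1)] by (simp add: B_def Suc_le_eq)
        qed
        also have "\<dots> \<le> push b c" unfolding push_def inflow_def using P kNP by (intro sum_mono2) auto
        finally show ?thesis using 1 unfolding h_def by linarith
      next
        case 2
        have "i = (LEAST j. c \<in> U j)" if i: "0 < e i c" for i
        proof -
          obtain y where y: "y \<in> B" "\<phi> (k y) y = c" "0 < L i y" using push_pos[OF _ c] i unfolding e_def by blast
          have yX: "y \<in> X" using y BX by blast
          have "\<exists>\<gamma>\<in>E. \<Psi> i \<gamma> (\<phi> (inv \<gamma>) y) \<noteq> 0"
          proof (rule ccontr)
            assume "\<not> ?thesis"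
            then have "L i y = 0" unfolding L_def inflow_def by (intro sum.neutral) simp
            with y(3) show False by simp
          qed
          then obtain \<gamma> where g: "\<gamma> \<in> E" "\<Psi> i \<gamma> (\<phi> (inv \<gamma>) y) \<noteq> 0" by blast
          have gc: "\<gamma> \<in> carrier \<Gamma>" using g E by auto
          define x where "x = \<phi> (inv \<gamma>) y"
          have x: "x \<in> X" "\<phi> \<gamma> x = y" "cls x = i" "0 < \<Phi> \<gamma> x"
            using gc yX g(2) act_closed act_act_inv by (auto simp: x_def \<Psi>_def split: if_splits)
          have cy: "(c, y) \<in> R\<^sup>*"
          proof -
            have "(c, y) \<in> R ^^ (2 * h)"
              using relpow_sym[of R y c "2 * h"] adjacency_sym[OF D BX] k1 y unfolding R_def by blast
            then show ?thesis by (rule relpow_imp_rtrancl)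
          qed
          have S_iff: "x \<in> S j \<longleftrightarrow> c \<in> U j" for j
          proof
            assume "c \<in> U j"
            then have "y \<in> T j" using y by (simp add: T_def)
            then show "x \<in> S j" using x g(1) by (auto simp: S_def)
          next
            assume "x \<in> S j"
            then obtain \<delta> where d: "\<delta> \<in> E" "0 < \<Phi> \<delta> x" "\<phi> \<delta> x \<in> T j" by (auto simp: S_def)
            have dc: "\<delta> \<in> carrier \<Gamma>" using d E by auto
            have y': "\<phi> \<delta> x \<in> B" "\<phi> (k (\<phi> \<delta> x)) (\<phi> \<delta> x) \<in> U j" using d(3) by (auto simp: T_def)
            have "\<phi> \<delta> x = \<phi> (\<delta> \<otimes> inv \<gamma>) y" using gc dc yX by (simp add: composition_rule x_def)
            moreover have "\<delta> \<otimes> inv \<gamma> \<in> D"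
              unfolding D_def quotients_def using g(1) d(1) dc
              by (intro insertI2 image_eqI[of _ _ "(inv \<delta>, inv \<gamma>)"]) auto
            ultimately have "(y, \<phi> \<delta> x) \<in> R" using y(1) y'(1) unfolding R_def adjacency_def by blast
            then have "(c, \<phi> \<delta> x) \<in> R\<^sup>*" using cy by (rule rtrancl_into_rtrancl[rotated])
            then have "\<phi> (k (\<phi> \<delta> x)) (\<phi> \<delta> x) = c" using 2 cell_c by blast
            then show "c \<in> U j" using y' by simp
          qed
          have "cls x = (LEAST j. c \<in> U j)" unfolding cls_def by (simp add: S_iff)
          then show ?thesis using x(3) by simp
        qed
        then show ?thesis by blast
      qed
    qed
  qed
  have "inflow \<Gamma> \<phi> E2 z c \<le> push b c" if c: "c \<in> X" for c
  proof -
    have "inflow \<Gamma> \<phi> E2 z c \<le> (\<Sum>i\<le>s. cap i c)"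
      unfolding z_def inflow_sum using f(2)[OF c] by (rule sum_mono)
    also have "\<dots> \<le> push b c" by (rule cap_sum[OF c])
    finally show ?thesis .
  qed
  then show ?thesis
    using cell_flow[OF ab(2)] zflow cell_out0 zout unfolding push_def by blast
qed

end

section \<open>Comparison of types\<close>

text \<open>
  The neutral element is not identified with \<open>[\<emptyset>]\<close>, so the comparison with \<open>\<beta> = 0\<close> is a case of its own.
\<close>

lemma type_equiv_empty_iff: "type_equiv \<Gamma> \<phi> \<A> u v \<Longrightarrow> u = {#} \<longleftrightarrow> v = {#}"
  by (induction rule: type_equiv.induct) auto

context borel_system
begin

lemma measurable_of_superlevels:
  fixes f :: "'x \<Rightarrow> nat"
  assumes "\<And>t. {x \<in> X. t \<le> f x} \<in> sets M"
  shows "f \<in> M \<rightarrow>\<^sub>M count_space UNIV"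
proof -
  have "f -` {t} \<inter> X = {x \<in> X. t \<le> f x} - {x \<in> X. Suc t \<le> f x}" for t by auto
  then have "f -` {t} \<inter> X \<in> sets M" for t using assms by auto
  then show ?thesis by (subst measurable_count_space_eq2_countable) auto
qed

lemma superlevel_measurable:
  fixes f :: "'x \<Rightarrow> nat"
  shows "f \<in> M \<rightarrow>\<^sub>M count_space UNIV \<Longrightarrow> {x \<in> X. t \<le> f x} \<in> sets M"
  using measurable_nat_rel[of f M f "\<lambda>i j. t \<le> i"] by simp

lemma type_equiv_of_measurable_flow:
  assumes z: "measurable_flow E z" and u: "set_mset u \<subseteq> sets M" and v: "set_mset v \<subseteq> sets M"
    and "\<And>x. x \<in> X \<Longrightarrow> cover_count u x = outflow E z x"
    and "\<And>x. x \<in> X \<Longrightarrow> cover_count v x = inflow \<Gamma> \<phi> E z x"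
  shows "type_equiv \<Gamma> \<phi> (sets M) (u + {#{}#}) (v + {#{}#})"
proof (rule type_equiv_of_flow[of E z "size u"])
  show "finite E" "E \<subseteq> carrier \<Gamma>" using z by (auto simp: measurable_flow_def)
  show "{x \<in> X. t \<le> z \<gamma> x} \<in> sets M" if "\<gamma> \<in> E" for \<gamma> t
    using z that by (intro superlevel_measurable) (auto simp: measurable_flow_def)
  show "z \<gamma> x \<le> size u" if "\<gamma> \<in> E" "x \<in> X" for \<gamma> x
  proof -
    have "z \<gamma> x \<le> outflow E z x"
      unfolding outflow_def using z that by (intro member_le_sum) (auto simp: measurable_flow_def)
    also have "\<dots> \<le> size u" using assms(4)[OF that(2)] cover_count_le_size[of u x] by simp
    finally show ?thesis .
  qed
qed (use assms in auto)

lemma inflow_bounded: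
  assumes z: "measurable_flow E z" and bound: "\<And>x. x \<in> X \<Longrightarrow> outflow E z x \<le> A" and y: "y \<in> X"
  shows "inflow \<Gamma> \<phi> E z y \<le> card E * A"
proof -
  have E: "finite E" "E \<subseteq> carrier \<Gamma>" using z by (auto simp: measurable_flow_def)
  have "z \<gamma> (\<phi> (inv \<gamma>) y) \<le> A" if "\<gamma> \<in> E" for \<gamma>
  proof -
    have X: "\<phi> (inv \<gamma>) y \<in> X" using that E y act_closed by auto
    have "z \<gamma> (\<phi> (inv \<gamma>) y) \<le> outflow E z (\<phi> (inv \<gamma>) y)"
      unfolding outflow_def using E that by (intro member_le_sum) auto
    then show ?thesis using bound[OF X] by simp
  qed
  then show ?thesis unfolding inflow_def using sum_bounded_above[of E _ A] by simp
qed

lemma superlevels_of_measurable: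
  assumes "f \<in> M \<rightarrow>\<^sub>M count_space UNIV"
  shows "set_mset (superlevels f K) \<subseteq> sets M"
  by (intro superlevels_members superlevel_measurable assms)

text \<open>
  Via \<open>f\<close> the element represented by \<open>v\<close> equals the one with multiplicity function \<open>inflow \<Gamma> \<phi> P f\<close>, and
  via \<open>z\<close> a part of the latter equals the one represented by \<open>u\<close>.
\<close>

lemma type_equiv_of_dominated_flows:
  assumes u: "set_mset u \<subseteq> sets M" and v: "set_mset v \<subseteq> sets M"
    and f: "measurable_flow P f" "\<And>x. x \<in> X \<Longrightarrow> outflow P f x = cover_count v x"
    and z: "measurable_flow E z" "\<And>x. x \<in> X \<Longrightarrow> outflow E z x = cover_count u x"
    and le: "\<And>y. y \<in> X \<Longrightarrow> inflow \<Gamma> \<phi> E z y \<le> inflow \<Gamma> \<phi> P f y"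
  shows "\<exists>w. set_mset w \<subseteq> sets M \<and> type_equiv \<Gamma> \<phi> (sets M) (v + {#{}#}) (u + w)"
proof -
  let ?f = "inflow \<Gamma> \<phi> P f" and ?z = "inflow \<Gamma> \<phi> E z"
  have fm: "?f \<in> M \<rightarrow>\<^sub>M count_space UNIV" and zm: "?z \<in> M \<rightarrow>\<^sub>M count_space UNIV"
    using f(1) z(1) by (auto simp: measurable_flow_def intro!: inflow_measurable)
  have rm: "(\<lambda>y. ?f y - ?z y) \<in> M \<rightarrow>\<^sub>M count_space UNIV" by (rule measurable_nat_op[OF fm zm])
  define K where "K = card P * size v"
  have fK: "?f y \<le> K" if "y \<in> X" for y
    unfolding K_def using f(2) cover_count_le_size[of v] by (intro inflow_bounded[OF f(1) _ that]) simp
  let ?F = "superlevels ?f K" and ?Z = "superlevels ?z K" and ?r = "superlevels (\<lambda>y. ?f y - ?z y) K"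
  have mem: "set_mset ?F \<subseteq> sets M" "set_mset ?Z \<subseteq> sets M" "set_mset ?r \<subseteq> sets M"
    using superlevels_of_measurable fm zm rm by auto
  have cF: "cover_count ?F y = ?f y" if "y \<in> X" for y
    by (rule cover_count_superlevels[of y ?f, OF that fK[OF that]])
  have cZ: "cover_count ?Z y = ?z y" if "y \<in> X" for y
    by (rule cover_count_superlevels[of y ?z, OF that order_trans[OF le[OF that] fK[OF that]]])
  have cr: "cover_count ?r y = ?f y - ?z y" if "y \<in> X" for y
    by (rule cover_count_superlevels[OF that, of "\<lambda>y. ?f y - ?z y"]) (use fK[OF that] in simp)
  have 1: "type_equiv \<Gamma> \<phi> (sets M) (v + {#{}#}) (?F + {#{}#})"
    by (rule type_equiv_of_measurable_flow[OF f(1) v mem(1)]) (simp_all add: f(2) cF)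
  have 2: "type_equiv \<Gamma> \<phi> (sets M) (?F + {#{}#}) ((?Z + ?r) + {#{}#})"
    by (rule type_equiv_of_cover_count_eq) (use mem le in \<open>simp_all add: cF cZ cr\<close>)
  have "type_equiv \<Gamma> \<phi> (sets M) (u + {#{}#}) (?Z + {#{}#})"
    by (rule type_equiv_of_measurable_flow[OF z(1) u mem(2)]) (simp_all add: z(2) cZ)
  then have "type_equiv \<Gamma> \<phi> (sets M) ((?Z + {#{}#}) + ?r) ((u + {#{}#}) + ?r)"
    by (rule type_equiv.add[OF type_equiv.sym type_equiv.refl[OF mem(3)]])
  then have 3: "type_equiv \<Gamma> \<phi> (sets M) ((?Z + ?r) + {#{}#}) (u + (?r + {#{}#}))"
    by (simp add: ac_simps)
  have "type_equiv \<Gamma> \<phi> (sets M) (v + {#{}#}) (u + (?r + {#{}#}))"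
    by (rule type_equiv.trans[OF 1 type_equiv.trans[OF 2 3]])
  then show ?thesis using mem(3) by (intro exI[of _ "?r + {#{}#}"]) auto
qed

lemma type_le_of_expansion:
  assumes hyp: "subexponential_growth \<Gamma> \<or> asi_action \<Gamma> M \<phi> < \<infinity>"
    and u: "set_mset u \<subseteq> sets M" and v: "set_mset v \<subseteq> sets M" and nm: "m < n"
    and F: "finite F" "F \<subseteq> carrier \<Gamma>"
    and expansion: "\<And>Y. finite Y \<Longrightarrow> Y \<subseteq> X \<Longrightarrow>
      n * sum (cover_count u) Y \<le> m * sum (cover_count v) (translates \<phi> F Y)"
  shows "\<exists>w. set_mset w \<subseteq> sets M \<and> type_equiv \<Gamma> \<phi> (sets M) (v + {#{}#}) (u + w)"
proof -
  let ?a = "cover_count u" and ?b = "cover_count v"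
  have am: "?a \<in> M \<rightarrow>\<^sub>M count_space UNIV" and bm: "?b \<in> M \<rightarrow>\<^sub>M count_space UNIV"
    using superlevel_in_algebra u v by (auto intro!: measurable_of_superlevels)
  have aA: "?a x \<le> size u" for x by (rule cover_count_le_size)
  from hyp show ?thesis
  proof
    assume growth: "subexponential_growth \<Gamma>"
    obtain z where z: "measurable_flow F z" "subflow F ?a ?b z" "\<forall>x\<in>X. outflow F z x = ?a x"
      using saturating_flow_subexponential[OF growth F am bm aA nm expansion]
      unfolding saturating_flow_def by blast
    define f where "f \<gamma> x = (if \<gamma> = \<one> then ?b x else 0)" for \<gamma> x
    have f: "measurable_flow {\<one>} f" unfolding measurable_flow_def f_def using bm by simp
    show ?thesis
    proof (rule type_equiv_of_dominated_flows[OF u v f _ z(1)])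
      show "outflow {\<one>} f x = ?b x" for x by (simp add: outflow_def f_def)
      show "outflow F z x = ?a x" if "x \<in> X" for x using z(3) that by blast
      show "inflow \<Gamma> \<phi> F z y \<le> inflow \<Gamma> \<phi> {\<one>} f y" if "y \<in> X" for y
        using z(2) that by (simp add: subflow_def inflow_def f_def act_one)
    qed
  next
    assume "asi_action \<Gamma> M \<phi> < \<infinity>"
    then obtain s where s: "has_finite_covers s" using has_finite_covers_of_asi by blast
    obtain n' m' \<Phi> where \<Phi>: "m' < n'" "measurable_flow F \<Phi>" "\<forall>x\<in>X. outflow F \<Phi> x = n' * ?a x"
      "\<forall>y\<in>X. inflow \<Gamma> \<phi> F \<Phi> y \<le> m' * ?b y"
      using measurable_fractional_flow[OF s F am bm aA nm expansion] by blast
    have "\<exists>P f E' z. measurable_flow P f \<and> measurable_flow E' z \<and>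
      (\<forall>y\<in>X. outflow P f y = ?b y) \<and> (\<forall>x\<in>X. outflow E' z x = ?a x) \<and>
      (\<forall>y\<in>X. inflow \<Gamma> \<phi> E' z y \<le> inflow \<Gamma> \<phi> P f y)"
      by (rule round_fractional_flow[OF s \<Phi>(2) am bm aA \<Phi>(1)]) (use \<Phi>(3,4) in auto)
    then obtain P f E' z where z: "measurable_flow P f" "measurable_flow E' z"
      "\<forall>y\<in>X. outflow P f y = ?b y" "\<forall>x\<in>X. outflow E' z x = ?a x"
      "\<forall>y\<in>X. inflow \<Gamma> \<phi> E' z y \<le> inflow \<Gamma> \<phi> P f y"
      by (elim exE conjE)
    show ?thesis
      by (rule type_equiv_of_dominated_flows[OF u v z(1) _ z(2)]) (use z in auto)
  qed
qed

end

theorem theorem1p33: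
  fixes \<Gamma> :: "('g, 'b) monoid_scheme"
    and M :: "'x measure"
    and \<phi> :: "'g \<Rightarrow> 'x \<Rightarrow> 'x"
    and \<alpha> \<beta> :: "'x set multiset set"
    and n m :: nat
  assumes "standard_borel M"
    and "finitely_generated \<Gamma>"
    and "borel_action \<Gamma> M \<phi>"
    and "subexponential_growth \<Gamma> \<or> asi_action \<Gamma> M \<phi> < \<infinity>"
    and "\<alpha> \<in> carrier (type_semigroup \<Gamma> \<phi> (sets M))"
    and "\<beta> \<in> carrier (type_semigroup \<Gamma> \<phi> (sets M))"
    and "n > m"
    and "monoid_le (full_type_semigroup \<Gamma> (space M) \<phi>)
           (type_map \<Gamma> \<phi> (Pow (space M)) \<alpha> [^]\<^bsub>full_type_semigroup \<Gamma> (space M) \<phi>\<^esub> n)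
           (type_map \<Gamma> \<phi> (Pow (space M)) \<beta> [^]\<^bsub>full_type_semigroup \<Gamma> (space M) \<phi>\<^esub> m)"
  shows "monoid_le (type_semigroup \<Gamma> \<phi> (sets M)) \<alpha> \<beta>"
proof -
  interpret borel_system \<Gamma> M \<phi> by unfold_locales fact+
  interpret full: invariant_algebra \<Gamma> "space M" \<phi> "Pow (space M)"
    by (rule invariant_algebra_Pow[OF group_action_axioms])
  have sub: "sets M \<subseteq> Pow (space M)" by (rule sets.space_closed)
  obtain u where u: "set_mset u \<subseteq> sets M" "\<alpha> = type_cong \<Gamma> \<phi> (sets M) `` {u}"
    using assms(5) type_class_in_carrier_iff by blast
  obtain v where v: "set_mset v \<subseteq> sets M" "\<beta> = type_cong \<Gamma> \<phi> (sets M) `` {v}"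
    using assms(6) type_class_in_carrier_iff by blast
  have map: "type_map \<Gamma> \<phi> (Pow (space M)) (type_cong \<Gamma> \<phi> (sets M) `` {x}) [^]\<^bsub>full_type_semigroup \<Gamma> (space M) \<phi>\<^esub> k =
      type_cong \<Gamma> \<phi> (Pow (space M)) `` {repeat_mset k x}" if "set_mset x \<subseteq> sets M" for x and k :: nat
    using type_map_class[OF invariant_algebra_axioms full.invariant_algebra_axioms sub that]
      full.type_class_pow[of x k] that sub by auto
  have rep: "set_mset (repeat_mset k x) \<subseteq> Pow (space M)" if "set_mset x \<subseteq> sets M" for x and k :: nat
    using that sub by (induction k) auto
  obtain w where w: "set_mset w \<subseteq> Pow (space M)"
    "type_equiv \<Gamma> \<phi> (Pow (space M)) (repeat_mset m v) (repeat_mset n u + w)"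
    using assms(8) unfolding u(2) v(2) map[OF u(1)] map[OF v(1)]
      full.monoid_le_type_class_iff[OF rep[OF u(1)] rep[OF v(1)]] by blast
  have "\<exists>w. set_mset w \<subseteq> sets M \<and> type_equiv \<Gamma> \<phi> (sets M) v (u + w)"
  proof (cases "v = {#}")
    case True
    then have "repeat_mset n u = {#}" using type_equiv_empty_iff[OF w(2)] by simp
    then have "u = {#}" using assms(7) by (cases n) simp_all
    then show ?thesis using True by (intro exI[of _ "{#}"]) (auto intro: type_equiv.refl)
  next
    case False
    obtain F where F: "finite F" "F \<subseteq> carrier \<Gamma>" "\<And>Y. finite Y \<Longrightarrow> Y \<subseteq> space M \<Longrightarrow>
        sum (cover_count (repeat_mset n u + w)) Y \<le> sum (cover_count (repeat_mset m v)) (translates \<phi> F Y)"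
      using type_equiv_expansion[OF w(2)] unfolding expands_into_def by blast
    have "n * sum (cover_count u) Y \<le> m * sum (cover_count v) (translates \<phi> F Y)"
      if "finite Y" "Y \<subseteq> space M" for Y
    proof -
      have "n * sum (cover_count u) Y \<le> sum (cover_count (repeat_mset n u + w)) Y"
        unfolding sum_distrib_left by (rule sum_mono) simp
      also have "\<dots> \<le> sum (cover_count (repeat_mset m v)) (translates \<phi> F Y)" by (rule F(3)[OF that])
      also have "\<dots> = m * sum (cover_count v) (translates \<phi> F Y)" by (simp add: sum_distrib_left)
      finally show ?thesis .
    qed
    then obtain w' where w': "set_mset w' \<subseteq> sets M" "type_equiv \<Gamma> \<phi> (sets M) (v + {#{}#}) (u + w')"
      using type_le_of_expansion[OF assms(4) u(1) v(1) assms(7) F(1,2)] by blast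
    have "type_equiv \<Gamma> \<phi> (sets M) v (u + w')"
      by (rule type_equiv.trans[OF type_equiv_add_empty[OF v(1) False] w'(2)])
    then show ?thesis using w'(1) by blast
  qed
  then show ?thesis unfolding u(2) v(2) by (simp add: monoid_le_type_class_iff u(1) v(1))
qed

end
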